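(* Let $K$ be an algebraically closed field of characteristic $p$, and let $(x(t),y(t))=(t^a,\,t^b+\sum_{i>b}a_it^i)$, with $a<b$ and $a\nmid b$, be a primitive parameterization of a plane branch over $K$ with semigroup $\Gamma$, semi-module $\Lambda$, Zariski number $\lambda$ and conductor $c=c(\Gamma)$. Assume that $p>c$. Then there exist $\overline x(t)=t^a$ and $\overline y(t)=t^b+t^\lambda+\sum_{i>\lambda,\ i+a\notin\Lambda}b_it^i$ with $b_i\in K$ such that $(x(t),y(t))\sim_{\mathcal A}(\overline x(t),\overline y(t))$. (The case $\lambda=\infty$ is included, in which case $\overline y(t)=t^b$.)
   Context: A parameterization $(x(t),y(t))\in(tK[[t]])^2$ is primitive if $\dim_K K[[t]]/K[[x(t),y(t)]]<\infty$. Its semigroup is $\Gamma=\{\mathrm{ord}_t(h)\mid 0\ne h\in K[[x(t),y(t)]]\}$, with multiplicity $m(\Gamma)$ the smallest nonzero element of $\Gamma$ and conductor $c(\Gamma)=\min\{n\in\Gamma\mid n+m\in\Gamma\ \forall m\ge0\}$. Let $\Omega\subset K[[t]]$ be the $K[[x(t),y(t)]]$-submodule generated by $\frac{d x(t)}{dt}$ and $\frac{d y(t)}{dt}$ (isomorphic to the module of Kähler differentials of $K[[x(t),y(t)]]$ modulo torsion), $\Gamma(\Omega)=\{\mathrm{ord}_t(w)\mid 0\ne w\in\Omega\}$ and $\Lambda=(\Gamma(\Omega)+1)\cup\{0\}$, the semi-module of values of differentials. The Zariski number is $\lambda=\min\{s\mid s\in\Lambda\setminus\Gamma\}-m(\Gamma)$,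 with $\lambda=\infty$ if $\Lambda=\Gamma$. Two parameterizations $\psi,\phi$ are $\mathcal A$-equivalent ($\psi\sim_{\mathcal A}\phi$) if there are $r\in tK[[t]]$ with $r'(0)\ne0$ and $L_1,L_2\in\langle x,y\rangle K[[x,y]]$ with invertible linear part such that $\phi(t)=(L_1(\psi(r(t))),L_2(\psi(r(t))))$. *)

theory Defs
  imports
    "HOL-Computational_Algebra.Polynomial"
    "HOL-Computational_Algebra.Formal_Power_Series"
    "HOL-Analysis.Cartesian_Space"
    "HOL-Library.Extended_Nat"
begin

text \<open>
  A series \<open>F\<close> in \<open>K[[x,y]]\<close> is an element of \<open>K[[y]][[x]]\<close>, i.e. of type \<open>'a fps fps\<close>;
  the coefficient of \<open>x^i y^j\<close> is \<open>coeff2 F i j\<close>.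
\<close>

definition coeff2 :: "'a::zero fps fps \<Rightarrow> nat \<Rightarrow> nat \<Rightarrow> 'a" where
  "coeff2 F i j = fps_nth (fps_nth F i) j"

text \<open>
  Substitution \<open>F(u(t),v(t))\<close> for \<open>u, v\<close> in \<open>tK[[t]]\<close>. Since \<open>u^i v^j\<close> then has order at least
  \<open>i + j\<close>, only indices \<open>i, j \<le> n\<close> contribute to the coefficient of \<open>t^n\<close>. The value is not
  meaningful for \<open>u\<close> or \<open>v\<close> with nonzero constant term.
\<close>

definition subst2 :: "'a::comm_ring_1 fps fps \<Rightarrow> 'a fps \<Rightarrow> 'a fps \<Rightarrow> 'a fps" where
  "subst2 F u v =
     Abs_fps (\<lambda>n. \<Sum>i\<le>n. \<Sum>j\<le>n. coeff2 F i j * fps_nth (u ^ i * v ^ j) n)"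

definition branch_ring :: "'a::comm_ring_1 fps \<Rightarrow> 'a fps \<Rightarrow> 'a fps set" where
  "branch_ring x y = range (\<lambda>F. subst2 F x y)"

text \<open>
  \<open>dim\<^sub>K K[[t]]/W < \<infinity>\<close>: the quotient is spanned by the classes of finitely many series.
\<close>

definition finite_codim :: "'a::field fps set \<Rightarrow> bool" where
  "finite_codim W \<longleftrightarrow>
     (\<exists>B. finite B \<and> (\<forall>h. \<exists>w\<in>W. h - w \<in> module.span (\<lambda>k g. fps_const k * g) B))"

definition primitive_parameterization :: "'a::field fps \<Rightarrow> 'a fps \<Rightarrow> bool" where
  "primitive_parameterization x y \<longleftrightarrow>
     fps_nth x 0 = 0 \<and> fps_nth y 0 = 0 \<and> finite_codim (branch_ring x y)"

definition value_set :: "'a::zero fps set \<Rightarrow> nat set" where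
  "value_set W = {subdegree h | h. h \<in> W \<and> h \<noteq> 0}"

definition semigroup_of :: "'a::field fps \<Rightarrow> 'a fps \<Rightarrow> nat set" where
  "semigroup_of x y = value_set (branch_ring x y)"

definition multiplicity_of :: "nat set \<Rightarrow> nat" where
  "multiplicity_of \<Gamma> = (LEAST n. n \<in> \<Gamma> \<and> n \<noteq> 0)"

definition conductor :: "nat set \<Rightarrow> nat" where
  "conductor \<Gamma> = (LEAST n. n \<in> \<Gamma> \<and> (\<forall>m. n + m \<in> \<Gamma>))"

definition differentials :: "'a::field fps \<Rightarrow> 'a fps \<Rightarrow> 'a fps set" where
  "differentials x y =
     {f * fps_deriv x + g * fps_deriv y | f g. f \<in> branch_ring x y \<and> g \<in> branch_ring x y}"

definition semimodule_of :: "'a::field fps \<Rightarrow> 'a fps \<Rightarrow> nat set" where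
  "semimodule_of x y = Suc ` value_set (differentials x y) \<union> {0}"

text \<open>
  In positive characteristic \<open>\<Gamma> \<subseteq> \<Lambda>\<close> may fail (e.g. for \<open>(t\<^sup>2,t\<^sup>3)\<close> in characteristic 3), so the
  case \<open>\<lambda> = \<infinity>\<close> is taken to be \<open>\<Lambda> - \<Gamma> = {}\<close>, exactly when the minimum does not exist.
  The subtraction does not truncate, as every nonzero element of \<open>\<Lambda>\<close> is at least \<open>m(\<Gamma>)\<close>.
\<close>

definition zariski_number :: "'a::field fps \<Rightarrow> 'a fps \<Rightarrow> enat" where
  "zariski_number x y =
     (let \<Gamma> = semigroup_of x y; \<Lambda> = semimodule_of x y in
      if \<Lambda> - \<Gamma> = {} then \<infinity>
      else enat ((LEAST s. s \<in> \<Lambda> - \<Gamma>) - multiplicity_of \<Gamma>))"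

definition A_equivalent :: "'a::field fps \<times> 'a fps \<Rightarrow> 'a fps \<times> 'a fps \<Rightarrow> bool"
    (infix \<open>\<sim>\<^sub>A\<close> 50) where
  "\<psi> \<sim>\<^sub>A \<phi> \<longleftrightarrow>
     (\<exists>r L1 L2.
        fps_nth r 0 = 0 \<and> fps_nth (fps_deriv r) 0 \<noteq> 0 \<and>
        coeff2 L1 0 0 = 0 \<and> coeff2 L2 0 0 = 0 \<and>
        invertible (vector [vector [coeff2 L1 1 0, coeff2 L1 0 1],
                            vector [coeff2 L2 1 0, coeff2 L2 0 1]] :: 'a^2^2) \<and>
        fst \<phi> = subst2 L1 (fps_compose (fst \<psi>) r) (fps_compose (snd \<psi>) r) \<and>
        snd \<phi> = subst2 L2 (fps_compose (fst \<psi>) r) (fps_compose (snd \<psi>) r))"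

end

theory Submission
  imports Defs "HOL-Analysis.Determinants"
begin

text \<open>
  Write \<open>O(n)\<close> for \<open>t\<^sup>n K[[t]]\<close>, which appears below as \<open>fps_X ^ n dvd h\<close>; let \<open>R\<close> be the ring of the
  branch, \<open>c\<close> its conductor, and let \<open>x = t\<^sup>a\<close> stay fixed while \<open>y\<close> is modified.

  A vector field \<open>- g \<partial>/\<partial>x + f \<partial>/\<partial>y\<close> on the plane, combined with the reparametrization that restores
  \<open>x = t\<^sup>a\<close>, changes \<open>y\<close> to first order by \<open>w = f + g y'/x' = (f x' + g y') / x'\<close>, where \<open>f, g\<close> lie in \<open>R\<close>.
  The orders of such \<open>w\<close> are the \<open>k\<close> with \<open>k + a\<close> in \<open>\<Lambda>\<close>, so these are the exponents whose
  coefficients can be moved. To pass from first order to an actual equivalence one exponentiates the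
  derivation \<open>D = -(g/x') d/dt\<close> of \<open>K[[t]]\<close>. If \<open>g\<close> has order greater than \<open>a\<close>, then \<open>D\<close> raises
  orders, and for \<open>k < c < p\<close> the series \<open>\<Sum> D\<^sup>n/n!\<close> cut after \<open>n = k\<close> has invertible denominators and
  is multiplicative modulo \<open>O(k+1)\<close>; hence it is the substitution \<open>h \<mapsto> h(\<tau>)\<close> there. On the other side
  the chain rule shows that \<open>D\<close> maps \<open>R\<close> into \<open>R + w R\<close>. So \<open>x(\<tau>)\<close> and \<open>y(\<tau>) + w\<close> agree with
  elements of \<open>R\<close> up to terms that do not matter, and the new generators of \<open>R\<close> obtained in this way,
  written in a parameter \<open>t\<close> with \<open>x = t\<^sup>a\<close>, give a \<open>y\<close> whose first modified coefficient is the one at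
  \<open>t\<^sup>k\<close> (\<open>elimination.shift_coefficient\<close>). Terms of order at least \<open>c\<close> belong to \<open>R\<close>, so they can be
  subtracted at once, and no division by \<open>p\<close> ever occurs.

  What remains is to find \<open>f\<close> and \<open>g\<close> of large enough order. The expansion of elements of \<open>R\<close> to first
  order in \<open>z = y - t\<^sup>b\<close> (\<open>closed_alg_expansion\<close>) controls the few dangerous coefficients. While no term
  beyond \<open>t\<^sup>b\<close> has appeared, a removable \<open>k\<close> has \<open>k + a\<close> in the monoid generated by \<open>a\<close> and \<open>b\<close> and a monomial does
  the job. The Euler form \<open>x y' - (b/a) y x'\<close> shows that the first exponent \<open>q > b\<close> which survives has
  \<open>q + a\<close> in \<open>\<Lambda>\<close>, so it is \<open>\<lambda>\<close>; its coefficient cannot vanish, since otherwise \<open>\<lambda> + a\<close> would not be a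
  value of a differential. Once it is present, two linear equations for the leading coefficients of
  \<open>f\<close> and \<open>g\<close> force both of them to be zero (\<open>plane_curve.diff_after_first\<close>). A final scaling of \<open>t\<close>
  by a root makes the coefficient at \<open>t\<^sup>\<lambda>\<close> equal to 1.

  Coordinate changes are never composed. Instead, all parametrizations met on the way generate the
  same ring up to substitution of a parameter (\<open>curve_equiv\<close>), which preserves the semigroup and the
  values of differentials, and only the last one is translated into power series \<open>L1, L2\<close>.
  For \<open>a = 2\<close> everything above \<open>t\<^sup>b\<close> already lies in \<open>R\<close>; for \<open>a \<ge> 3\<close> one has \<open>c \<ge> b + 2\<close>, so that
  \<open>a\<close>, \<open>b\<close> and all differences of exponents below \<open>c\<close> are nonzero in \<open>K\<close>.
\<close>

section \<open>Orders of power series\<close>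

lemma X_power_dvd_iff:
  fixes f :: "'a::field fps"
  shows "fps_X ^ n dvd f \<longleftrightarrow> (\<forall>i<n. fps_nth f i = 0)"
proof (cases "f = 0")
  case False
  have "fps_X ^ n dvd f \<longleftrightarrow> n \<le> subdegree f"
    using False by (simp add: fps_dvd_iff)
  also have "\<dots> \<longleftrightarrow> (\<forall>i<n. fps_nth f i = 0)"
    using False subdegree_geI[of f n] by (auto intro: nth_less_subdegree_zero)
  finally show ?thesis .
qed simp

lemma X_power_dvd_nth: "fps_X ^ n dvd (f :: 'a::field fps) \<Longrightarrow> i < n \<Longrightarrow> fps_nth f i = 0"
  by (simp add: X_power_dvd_iff)

lemma X_power_dvd_Suc_iff:
  fixes f :: "'a::field fps"
  shows "fps_X ^ Suc n dvd f \<longleftrightarrow> fps_X ^ n dvd f \<and> fps_nth f n = 0"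
  unfolding X_power_dvd_iff by (auto simp: less_Suc_eq)

lemma X_power_dvd_mult:
  fixes f g :: "'a::field fps"
  assumes "fps_X ^ m dvd f" "fps_X ^ n dvd g"
  shows "fps_X ^ (m + n) dvd f * g"
  using assms by (simp add: power_add mult_dvd_mono)

lemma X_power_dvd_diff_trans:
  fixes f g h :: "'a::field fps"
  assumes "fps_X ^ n dvd f - g" "fps_X ^ n dvd g - h"
  shows "fps_X ^ n dvd f - h"
  using dvd_add[OF assms] by simp

lemma X_power_dvd_diff_sym:
  fixes f g :: "'a::field fps"
  shows "fps_X ^ n dvd f - g \<Longrightarrow> fps_X ^ n dvd g - f"
  by (metis dvd_minus_iff minus_diff_eq)

lemma X_power_dvd_deriv:
  fixes f :: "'a::field fps"
  assumes "fps_X ^ n dvd f"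
  shows "fps_X ^ (n - 1) dvd fps_deriv f"
  using assms unfolding X_power_dvd_iff by auto

lemma X_power_dvd_compose:
  fixes f r :: "'a::field fps"
  assumes "fps_nth r 0 = 0" "fps_X ^ n dvd f"
  shows "fps_X ^ n dvd f oo r"
proof -
  obtain g where f: "f = fps_X ^ n * g"
    using assms(2) by auto
  have "f oo r = r ^ n * (g oo r)"
    unfolding f fps_compose_mult_distrib[OF assms(1)] fps_X_power_compose[OF assms(1)] ..
  moreover have "fps_X ^ 1 dvd r"
    using assms(1) by (simp only: X_power_dvd_iff) simp
  ultimately show ?thesis
    by (simp add: dvd_power_same)
qed

lemma X_power_dvd_zero:
  fixes f :: "'a::field fps"
  assumes "\<And>n. fps_X ^ n dvd f"
  shows "f = 0"
proof (rule fps_ext)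
  show "fps_nth f n = fps_nth 0 n" for n
    using X_power_dvd_nth[OF assms[of "Suc n"], of n] by simp
qed

lemma X_power_dvd_diff_cong_mult:
  fixes f f' g g' :: "'a::field fps"
  assumes "fps_X ^ n dvd f - f'" "fps_X ^ n dvd g - g'"
  shows "fps_X ^ n dvd f * g - f' * g'"
proof -
  have "fps_X ^ n dvd (f - f') * g + f' * (g - g')"
    using assms by (intro dvd_add) auto
  also have "(f - f') * g + f' * (g - g') = f * g - f' * g'"
    by (simp add: algebra_simps)
  finally show ?thesis .
qed

lemma subdegree_cong:
  fixes f g :: "'a::field fps"
  assumes "fps_X ^ Suc n dvd f - g" and "subdegree f = n" "f \<noteq> 0"
  shows "subdegree g = n" "g \<noteq> 0"
proof -
  have eq: "fps_nth g i = fps_nth f i" if "i \<le> n" for i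
    using X_power_dvd_nth[OF assms(1), of i] that by simp
  have nz: "fps_nth g n \<noteq> 0"
    using eq[OF order_refl] nth_subdegree_nonzero[OF assms(3)] unfolding assms(2) by metis
  have "fps_nth g i = 0" if "i < n" for i
    using eq[OF less_imp_le[OF that]] nth_less_subdegree_zero[of i f] that unfolding assms(2) by metis
  then show "subdegree g = n" using nz by (rule subdegreeI[rotated])
  show "g \<noteq> 0" using nz by fastforce
qed

lemma fps_compose_fps_inv_cancel:
  fixes h r :: "'a::field fps"
  assumes "fps_nth r 0 = 0" "fps_nth r 1 \<noteq> 0"
  shows "(h oo fps_inv r) oo r = h" "(h oo r) oo fps_inv r = h"
proof -
  have i0: "fps_nth (fps_inv r) 0 = 0" by (simp add: fps_inv_def)
  show "(h oo fps_inv r) oo r = h"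
    using fps_compose_assoc[OF assms(1) i0, of h] fps_inv[OF assms] by simp
  show "(h oo r) oo fps_inv r = h"
    using fps_compose_assoc[OF i0 assms(1), of h] fps_inv_right[OF assms] by simp
qed

section \<open>The algebra of two series and its closure\<close>

interpretation fps_space: vector_space "\<lambda>k (g :: 'a::field fps). fps_const k * g"
  by unfold_locales (simp_all add: algebra_simps flip: fps_const_add fps_const_mult)

text \<open>
  The weight of \<open>u\<^sup>i v\<^sup>j\<close> is the order that it has if \<open>u, v\<close> have orders \<open>a, b\<close>; cancellation can make
  the order of a polynomial larger than its weight, and \<open>poly_alg_weighted\<close> says when it cannot.
\<close>

definition weighted_poly :: "nat \<Rightarrow> nat \<Rightarrow> 'a::field fps \<Rightarrow> 'a fps \<Rightarrow> nat \<Rightarrow> 'a fps set" where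
  "weighted_poly a b u v n = fps_space.span {u ^ i * v ^ j | i j. n \<le> a * i + b * j}"

definition poly_alg :: "'a::field fps \<Rightarrow> 'a fps \<Rightarrow> 'a fps set" where
  "poly_alg u v = fps_space.span {u ^ i * v ^ j | i j. True}"

text \<open>
  The closure of \<open>K[u,v]\<close> in the \<open>t\<close>-adic topology. It equals \<open>K[[u,v]]\<close> for the branches considered
  here (\<open>branch_ring_eq_closed_alg\<close>), but membership can be checked with polynomials modulo \<open>O(N)\<close>.
\<close>

definition closed_alg :: "'a::field fps \<Rightarrow> 'a fps \<Rightarrow> 'a fps set" where
  "closed_alg u v = {h. \<forall>N. \<exists>P\<in>poly_alg u v. fps_X ^ N dvd h - P}"

lemma weighted_poly_0: "weighted_poly a b u v 0 = poly_alg u v"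
  by (simp add: weighted_poly_def poly_alg_def)

lemma weighted_poly_mono: "n \<le> m \<Longrightarrow> weighted_poly a b u v m \<subseteq> weighted_poly a b u v n"
  unfolding weighted_poly_def by (rule fps_space.span_mono) (auto intro: le_trans)

lemma span_mult:
  assumes f: "f \<in> fps_space.span A" and g: "g \<in> fps_space.span B"
  shows "f * g \<in> fps_space.span {p * q | p q. p \<in> A \<and> q \<in> B}"
proof -
  have *: "p * g \<in> fps_space.span {p * q | p q. p \<in> A \<and> q \<in> B}" if "p \<in> A" for p
    using g
  proof (induction rule: fps_space.span_induct_alt)
    case (step c q y)
    have "p * q \<in> fps_space.span {p * q | p q. p \<in> A \<and> q \<in> B}"
      using step that by (auto intro: fps_space.span_base)
    from fps_space.span_add[OF fps_space.span_scale[OF this, of c] step(2)]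
    show ?case by (simp add: algebra_simps)
  qed (simp add: fps_space.span_zero)
  show ?thesis
    using f
  proof (induction rule: fps_space.span_induct_alt)
    case (step c p y)
    from fps_space.span_add[OF fps_space.span_scale[OF *[OF step(1)], of c] step(2)]
    show ?case by (simp add: algebra_simps)
  qed (simp add: fps_space.span_zero)
qed

lemma weighted_poly_mult:
  assumes "f \<in> weighted_poly a b u v m" "g \<in> weighted_poly a b u v n"
  shows "f * g \<in> weighted_poly a b u v (m + n)"
proof -
  have "{p * q | p q. p \<in> {u ^ i * v ^ j | i j. m \<le> a * i + b * j} \<and> q \<in> {u ^ i * v ^ j | i j. n \<le> a * i + b * j}}
     \<subseteq> {u ^ i * v ^ j | i j. m + n \<le> a * i + b * j}"
  proof clarify
    fix i j i' j' assume "m \<le> a * i + b * j" "n \<le> a * i' + b * j'"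
    then show "\<exists>i'' j''. u ^ i * v ^ j * (u ^ i' * v ^ j') = u ^ i'' * v ^ j'' \<and> m + n \<le> a * i'' + b * j''"
      by (intro exI[of _ "i + i'"] exI[of _ "j + j'"]) (auto simp: power_add algebra_simps)
  qed
  then show ?thesis
    using span_mult[OF assms[unfolded weighted_poly_def]] fps_space.span_mono
    unfolding weighted_poly_def by blast
qed

lemma monomial_in_poly_alg: "u ^ i * v ^ j \<in> poly_alg u v"
  unfolding poly_alg_def by (rule fps_space.span_base) auto

lemma poly_alg_add: "f \<in> poly_alg u v \<Longrightarrow> g \<in> poly_alg u v \<Longrightarrow> f + g \<in> poly_alg u v"
  unfolding poly_alg_def by (rule fps_space.span_add)

lemma poly_alg_scale: "f \<in> poly_alg u v \<Longrightarrow> fps_const c * f \<in> poly_alg u v"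
  unfolding poly_alg_def by (rule fps_space.span_scale)

lemma poly_alg_mult: "f \<in> poly_alg u v \<Longrightarrow> g \<in> poly_alg u v \<Longrightarrow> f * g \<in> poly_alg u v"
  using weighted_poly_mult[of f 0 0 u v 0 g 0] by (simp add: weighted_poly_0)

lemma poly_alg_0: "0 \<in> poly_alg u v"
  unfolding poly_alg_def by (rule fps_space.span_zero)

lemma poly_alg_const: "fps_const c \<in> poly_alg u v"
  using poly_alg_scale[OF monomial_in_poly_alg[of u 0 v 0], of c] by simp

lemma poly_alg_induct [consumes 1, case_names zero step]:
  assumes "h \<in> poly_alg u v" "Q 0"
    and "\<And>c i j f. Q f \<Longrightarrow> Q (fps_const c * (u ^ i * v ^ j) + f)"
  shows "Q h"
  using assms(1) unfolding poly_alg_def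
  by (induction rule: fps_space.span_induct_alt) (auto intro: assms)

lemma poly_alg_subset_closed_alg: "poly_alg u v \<subseteq> closed_alg u v"
proof
  fix h assume "h \<in> poly_alg u v"
  then show "h \<in> closed_alg u v"
    unfolding closed_alg_def by (intro CollectI allI bexI[of _ h]) auto
qed

lemma closed_algE:
  assumes "h \<in> closed_alg u v"
  obtains P where "P \<in> poly_alg u v" "fps_X ^ N dvd h - P"
  using assms unfolding closed_alg_def by auto

lemma closed_algI:
  assumes "\<And>N. \<exists>P\<in>closed_alg u v. fps_X ^ N dvd h - P"
  shows "h \<in> closed_alg u v"
  unfolding closed_alg_def
proof (intro CollectI allI)
  fix N
  obtain P where P: "P \<in> closed_alg u v" "fps_X ^ N dvd h - P"
    using assms by blast
  obtain Q where Q: "Q \<in> poly_alg u v" "fps_X ^ N dvd P - Q"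
    using closed_algE[OF P(1)] by blast
  from X_power_dvd_diff_trans[OF P(2) Q(2)] Q(1)
  show "\<exists>P\<in>poly_alg u v. fps_X ^ N dvd h - P" by blast
qed

lemma closed_alg_add:
  assumes "f \<in> closed_alg u v" "g \<in> closed_alg u v"
  shows "f + g \<in> closed_alg u v"
  unfolding closed_alg_def
proof (intro CollectI allI)
  fix N
  obtain P Q where "P \<in> poly_alg u v" "fps_X ^ N dvd f - P" "Q \<in> poly_alg u v" "fps_X ^ N dvd g - Q"
    using closed_algE[OF assms(1)] closed_algE[OF assms(2)] by metis
  then show "\<exists>P\<in>poly_alg u v. fps_X ^ N dvd f + g - P"
    by (intro bexI[of _ "P + Q"]) (auto simp: poly_alg_add add_diff_add)
qed

lemma closed_alg_mult:
  assumes "f \<in> closed_alg u v" "g \<in> closed_alg u v"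
  shows "f * g \<in> closed_alg u v"
  unfolding closed_alg_def
proof (intro CollectI allI)
  fix N
  obtain P Q where "P \<in> poly_alg u v" "fps_X ^ N dvd f - P" "Q \<in> poly_alg u v" "fps_X ^ N dvd g - Q"
    using closed_algE[OF assms(1)] closed_algE[OF assms(2)] by metis
  then show "\<exists>P\<in>poly_alg u v. fps_X ^ N dvd f * g - P"
    by (intro bexI[of _ "P * Q"]) (auto simp: poly_alg_mult X_power_dvd_diff_cong_mult)
qed

lemma closed_alg_const: "fps_const c \<in> closed_alg u v"
  using poly_alg_const poly_alg_subset_closed_alg by blast

lemma closed_alg_scale: "f \<in> closed_alg u v \<Longrightarrow> fps_const c * f \<in> closed_alg u v"
  by (intro closed_alg_mult closed_alg_const)

lemma closed_alg_uminus: "f \<in> closed_alg u v \<Longrightarrow> - f \<in> closed_alg u v"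
  using closed_alg_scale[of f u v "-1"] by (simp flip: fps_const_neg)

lemma closed_alg_diff: "f \<in> closed_alg u v \<Longrightarrow> g \<in> closed_alg u v \<Longrightarrow> f - g \<in> closed_alg u v"
  using closed_alg_add[of f u v "- g"] closed_alg_uminus[of g u v] by simp

lemma closed_alg_0: "0 \<in> closed_alg u v"
  using poly_alg_0 poly_alg_subset_closed_alg by blast

lemma closed_alg_monomial: "u ^ i * v ^ j \<in> closed_alg u v"
  using monomial_in_poly_alg poly_alg_subset_closed_alg by blast

lemma closed_alg_generators: "u \<in> closed_alg u v" "v \<in> closed_alg u v"
  using closed_alg_monomial[of u 1 v 0] closed_alg_monomial[of u 0 v 1] by auto

lemma closed_alg_power: "f \<in> closed_alg u v \<Longrightarrow> f ^ n \<in> closed_alg u v"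
  using closed_alg_const[of 1] by (induction n) (auto intro: closed_alg_mult)

lemma poly_alg_subset:
  assumes "U \<in> closed_alg u v" "V \<in> closed_alg u v"
  shows "poly_alg U V \<subseteq> closed_alg u v"
proof
  fix h assume "h \<in> poly_alg U V"
  then show "h \<in> closed_alg u v"
    by (induction rule: poly_alg_induct)
      (auto intro!: closed_alg_0 closed_alg_add closed_alg_scale closed_alg_mult closed_alg_power assms)
qed

lemma closed_alg_subset:
  assumes "U \<in> closed_alg u v" "V \<in> closed_alg u v"
  shows "closed_alg U V \<subseteq> closed_alg u v"
proof
  fix h assume "h \<in> closed_alg U V"
  then show "h \<in> closed_alg u v"
    using poly_alg_subset[OF assms] by (intro closed_algI) (auto elim!: closed_algE)
qed

lemma closed_alg_compose_subset:
  fixes u v r :: "'a::field fps"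
  assumes r: "fps_nth r 0 = 0" and h: "h \<in> closed_alg u v"
  shows "h oo r \<in> closed_alg (u oo r) (v oo r)"
  unfolding closed_alg_def
proof (intro CollectI allI)
  fix N
  obtain P where P: "P \<in> poly_alg u v" "fps_X ^ N dvd h - P"
    using h closed_algE by blast
  have "P oo r \<in> poly_alg (u oo r) (v oo r)"
    using P(1)
  proof (induction rule: poly_alg_induct)
    case (step c i j f)
    then show ?case
      by (simp add: fps_compose_add_distrib fps_compose_mult_distrib[OF r] poly_alg_add
          poly_alg_scale monomial_in_poly_alg flip: fps_compose_power[OF r])
  qed (simp add: poly_alg_0)
  moreover have "fps_X ^ N dvd (h oo r) - (P oo r)"
    using X_power_dvd_compose[OF r P(2)] by (simp add: fps_compose_sub_distrib)
  ultimately show "\<exists>P\<in>poly_alg (u oo r) (v oo r). fps_X ^ N dvd (h oo r) - P" by blast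
qed

lemma closed_alg_compose:
  fixes u v r :: "'a::field fps"
  assumes "fps_nth r 0 = 0" "fps_nth r 1 \<noteq> 0"
  shows "h oo r \<in> closed_alg (u oo r) (v oo r) \<longleftrightarrow> h \<in> closed_alg u v"
proof
  assume "h oo r \<in> closed_alg (u oo r) (v oo r)"
  then have "(h oo r) oo fps_inv r \<in> closed_alg ((u oo r) oo fps_inv r) ((v oo r) oo fps_inv r)"
    by (rule closed_alg_compose_subset[rotated]) (simp add: fps_inv_def)
  then show "h \<in> closed_alg u v"
    by (simp add: fps_compose_fps_inv_cancel[OF assms])
qed (rule closed_alg_compose_subset[OF assms(1)])

lemma poly_alg_deriv:
  assumes "h \<in> poly_alg u v"
  shows "\<exists>h1\<in>poly_alg u v. \<exists>h2\<in>poly_alg u v. fps_deriv h = h1 * fps_deriv u + h2 * fps_deriv v"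
  using assms
proof (induction rule: poly_alg_induct)
  case zero
  show ?case by (intro bexI[of _ 0]) (auto simp: poly_alg_0)
next
  case (step c i j f)
  then obtain h1 h2 where h: "h1 \<in> poly_alg u v" "h2 \<in> poly_alg u v"
    "fps_deriv f = h1 * fps_deriv u + h2 * fps_deriv v" by blast
  let ?g1 = "fps_const (c * of_nat i) * (u ^ (i - 1) * v ^ j)"
  let ?g2 = "fps_const (c * of_nat j) * (u ^ i * v ^ (j - 1))"
  have "fps_deriv (fps_const c * (u ^ i * v ^ j) + f) = (?g1 + h1) * fps_deriv u + (?g2 + h2) * fps_deriv v"
    by (simp add: h fps_deriv_power algebra_simps fps_of_nat flip: fps_const_mult)
  then show ?case
    by (intro bexI) (auto intro!: h poly_alg_add poly_alg_scale monomial_in_poly_alg)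
qed

text \<open>
  The chain rule. It holds exactly for polynomials in \<open>u, v\<close>, and differentiation lowers the precision of
  an approximation by one only.
\<close>

lemma closed_alg_deriv:
  fixes h :: "'a::field fps"
  assumes "h \<in> closed_alg u v"
  shows "\<exists>h1\<in>closed_alg u v. \<exists>h2\<in>closed_alg u v.
           fps_X ^ N dvd fps_deriv h - (h1 * fps_deriv u + h2 * fps_deriv v)"
proof -
  obtain P where P: "P \<in> poly_alg u v" "fps_X ^ Suc N dvd h - P"
    using closed_algE[OF assms] by blast
  have "fps_X ^ N dvd fps_deriv h - fps_deriv P"
    using X_power_dvd_deriv[OF P(2)] by simp
  moreover obtain h1 h2 where "h1 \<in> poly_alg u v" "h2 \<in> poly_alg u v"
    "fps_deriv P = h1 * fps_deriv u + h2 * fps_deriv v"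
    using poly_alg_deriv[OF P(1)] by blast
  ultimately show ?thesis
    using poly_alg_subset_closed_alg[of u v] by (intro bexI[of _ h1] bexI[of _ h2]) auto
qed

section \<open>Perturbation of generators and values of differentials\<close>

lemma X_power_dvd_cong:
  fixes f g :: "'a::field fps"
  assumes "fps_X ^ n dvd f - g"
  shows "fps_X ^ n dvd f \<longleftrightarrow> fps_X ^ n dvd g"
  using dvd_add_right_iff[OF assms, of g] by simp

text \<open>
  The series \<open>t\<^sup>n + O(n+1)\<close>. With \<open>n = 1\<close> these are the admissible changes of parameter tangent to the identity.
\<close>

definition monic_order :: "nat \<Rightarrow> 'a::field fps \<Rightarrow> bool" where
  "monic_order n f \<longleftrightarrow> fps_X ^ Suc n dvd f - fps_X ^ n"

lemma monic_order_iff: "monic_order n f \<longleftrightarrow> (\<forall>i<n. fps_nth f i = 0) \<and> fps_nth f n = 1"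
  unfolding monic_order_def X_power_dvd_iff by (auto simp: less_Suc_eq)

lemma monic_order_dvd: "monic_order n f \<Longrightarrow> fps_X ^ n dvd f"
  by (simp add: monic_order_iff X_power_dvd_iff)

lemma monic_order_X_power: "monic_order n (fps_X ^ n)"
  by (simp add: monic_order_def)

lemma monic_order_1: "monic_order 0 1"
  by (simp add: monic_order_def)

lemma monic_order_mult:
  assumes "monic_order m f" "monic_order n g"
  shows "monic_order (m + n) (f * g)"
proof -
  have "fps_X ^ (Suc m + n) dvd (f - fps_X ^ m) * g"
    using assms by (intro X_power_dvd_mult) (auto simp: monic_order_def intro: monic_order_dvd)
  moreover have "fps_X ^ (m + Suc n) dvd fps_X ^ m * (g - fps_X ^ n)"
    using assms by (intro X_power_dvd_mult) (auto simp: monic_order_def)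
  ultimately have "fps_X ^ Suc (m + n) dvd (f - fps_X ^ m) * g + fps_X ^ m * (g - fps_X ^ n)"
    by simp
  also have "(f - fps_X ^ m) * g + fps_X ^ m * (g - fps_X ^ n) = f * g - fps_X ^ (m + n)"
    by (simp add: algebra_simps power_add)
  finally show ?thesis by (simp add: monic_order_def)
qed

lemma monic_order_power: "monic_order m f \<Longrightarrow> monic_order (m * k) (f ^ k)"
  by (induction k) (auto simp: monic_order_1 dest: monic_order_mult)

lemma monic_order_cong:
  assumes "monic_order n f" "fps_X ^ Suc n dvd g - f"
  shows "monic_order n g"
  using assms X_power_dvd_diff_trans unfolding monic_order_def by blast

lemma monic_order_compose:
  assumes "monic_order 1 r" "monic_order n f"
  shows "monic_order n (f oo r)"
proof -
  have r: "fps_nth r 0 = 0" using assms(1) by (simp add: monic_order_iff)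
  have "fps_X ^ Suc n dvd (f - fps_X ^ n) oo r"
    using assms by (intro X_power_dvd_compose r) (simp add: monic_order_def)
  then have "fps_X ^ Suc n dvd (f oo r) - r ^ n"
    by (simp add: fps_compose_sub_distrib fps_X_power_compose[OF r])
  then show ?thesis
    using monic_order_cong[of n "r ^ n"] monic_order_power[OF assms(1), of n] by simp
qed

lemma weighted_poly_add: "f \<in> weighted_poly a b u v n \<Longrightarrow> g \<in> weighted_poly a b u v n \<Longrightarrow> f + g \<in> weighted_poly a b u v n"
  unfolding weighted_poly_def by (rule fps_space.span_add)

lemma weighted_poly_dvd:
  assumes "fps_X ^ a dvd u" "fps_X ^ b dvd v" "h \<in> weighted_poly a b u v n"
  shows "fps_X ^ n dvd h"
  using assms(3) unfolding weighted_poly_def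
proof (induction rule: fps_space.span_induct_alt)
  case (step c x y)
  then obtain i j where x: "x = u ^ i * v ^ j" "n \<le> a * i + b * j" by auto
  have "fps_X ^ (a * i + b * j) dvd x"
    unfolding x(1) power_add power_mult using assms by (intro mult_dvd_mono dvd_power_same)
  then have "fps_X ^ n dvd x" by (rule power_le_dvd) (rule x(2))
  with step show ?case by simp
qed simp

text \<open>
  A weight up to \<open>b\<close> is a multiple of \<open>a\<close> or equal to \<open>b\<close>, and not both because \<open>a\<close> does not divide \<open>b\<close>. Therefore
  no cancellation between monomials is possible below or at order \<open>b\<close>.
\<close>

lemma small_weight_unique:
  fixes a b :: nat
  assumes "0 < a" "a < b" "\<not> a dvd b" "a * i + b * j = a * i' + b * j'" "a * i + b * j \<le> b"
  shows "i = i' \<and> j = j'"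
proof -
  have *: "j = 0 \<or> (j = 1 \<and> i = 0)" if le: "a * i + b * j \<le> b" for i j
  proof (cases j)
    case (Suc k)
    with le have "a * i + b * k = 0" by simp
    then show ?thesis using assms(1,2) Suc by simp
  qed simp
  have "j = 0 \<or> (j = 1 \<and> i = 0)" "j' = 0 \<or> (j' = 1 \<and> i' = 0)"
    using *[of i j] *[of i' j'] assms(4,5) by simp_all
  moreover have "a * k \<noteq> b" for k using assms(3) by auto
  ultimately show ?thesis using assms(1,4) by (elim disjE) auto
qed

lemma weighted_poly_Suc:
  fixes u v h :: "'a::field fps"
  assumes ab: "0 < a" "a < b" "\<not> a dvd b" and uv: "monic_order a u" "monic_order b v"
    and h: "h \<in> weighted_poly a b u v n" "n \<le> b" "fps_nth h n = 0"
  shows "h \<in> weighted_poly a b u v (Suc n)"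
proof (cases "\<exists>i j. a * i + b * j = n")
  case True
  then obtain i0 j0 where ij: "a * i0 + b * j0 = n" by blast
  let ?S = "{u ^ i * v ^ j | i j. Suc n \<le> a * i + b * j}" and ?m = "u ^ i0 * v ^ j0"
  have "{u ^ i * v ^ j | i j. n \<le> a * i + b * j} \<subseteq> insert ?m ?S"
  proof
    fix x assume "x \<in> {u ^ i * v ^ j | i j. n \<le> a * i + b * j}"
    then obtain i j where x: "x = u ^ i * v ^ j" "n \<le> a * i + b * j" by blast
    show "x \<in> insert ?m ?S"
    proof (cases "Suc n \<le> a * i + b * j")
      case False
      then have "a * i + b * j = a * i0 + b * j0" using x(2) ij by simp
      then have "i = i0 \<and> j = j0" using small_weight_unique[OF ab, of i j i0 j0] ij h(2) by simp
      then show ?thesis using x by simp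
    qed (use x in blast)
  qed
  then have "h \<in> fps_space.span (insert ?m ?S)"
    using h(1) fps_space.span_mono unfolding weighted_poly_def by blast
  then obtain k where k: "h - fps_const k * ?m \<in> weighted_poly a b u v (Suc n)"
    unfolding weighted_poly_def fps_space.span_insert by blast
  have "fps_nth (h - fps_const k * ?m) n = 0"
    using weighted_poly_dvd[OF monic_order_dvd[OF uv(1)] monic_order_dvd[OF uv(2)] k]
    by (rule X_power_dvd_nth) simp
  moreover have "monic_order n ?m"
    using monic_order_mult[OF monic_order_power[OF uv(1), of i0] monic_order_power[OF uv(2), of j0]] ij by simp
  ultimately have "k = 0"
    using h(3) by (simp add: monic_order_iff)
  then show ?thesis using k by simp
next
  case False
  then have "n \<le> a * i + b * j \<longleftrightarrow> Suc n \<le> a * i + b * j" for i j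
    by (metis Suc_leD le_antisym not_less_eq_eq)
  then show ?thesis
    using h(1) unfolding weighted_poly_def by simp
qed

lemma poly_alg_weighted:
  fixes u v h :: "'a::field fps"
  assumes ab: "0 < a" "a < b" "\<not> a dvd b" and uv: "monic_order a u" "monic_order b v"
    and h: "h \<in> poly_alg u v" "n \<le> Suc b" "fps_X ^ n dvd h"
  shows "h \<in> weighted_poly a b u v n"
  using h(2,3)
proof (induction n)
  case 0
  then show ?case using h(1) by (simp add: weighted_poly_0)
next
  case (Suc n)
  then show ?case
    unfolding X_power_dvd_Suc_iff by (intro weighted_poly_Suc[OF ab uv]) auto
qed

definition weighted_mod where
  "weighted_mod N a b u v n = {h. \<exists>P\<in>weighted_poly a b u v n. fps_X ^ N dvd h - P}"

lemma weighted_mod_add: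
  assumes "f \<in> weighted_mod N a b u v n" "g \<in> weighted_mod N a b u v n"
  shows "f + g \<in> weighted_mod N a b u v n"
proof -
  obtain P Q where "P \<in> weighted_poly a b u v n" "fps_X ^ N dvd f - P"
    "Q \<in> weighted_poly a b u v n" "fps_X ^ N dvd g - Q"
    using assms unfolding weighted_mod_def by blast
  then show ?thesis
    unfolding weighted_mod_def
    by (intro CollectI bexI[of _ "P + Q"]) (auto simp: weighted_poly_add add_diff_add)
qed

lemma weighted_mod_mult:
  assumes "f \<in> weighted_mod N a b u v m" "g \<in> weighted_mod N a b u v n"
  shows "f * g \<in> weighted_mod N a b u v (m + n)"
proof -
  obtain P Q where "P \<in> weighted_poly a b u v m" "fps_X ^ N dvd f - P"
    "Q \<in> weighted_poly a b u v n" "fps_X ^ N dvd g - Q"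
    using assms unfolding weighted_mod_def by blast
  then show ?thesis
    unfolding weighted_mod_def
    by (intro CollectI bexI[of _ "P * Q"]) (auto simp: weighted_poly_mult X_power_dvd_diff_cong_mult)
qed

lemma weighted_poly_subset_mod: "weighted_poly a b u v n \<subseteq> weighted_mod N a b u v n"
  unfolding weighted_mod_def by force

lemma weighted_mod_mono: "n \<le> m \<Longrightarrow> weighted_mod N a b u v m \<subseteq> weighted_mod N a b u v n"
  unfolding weighted_mod_def using weighted_poly_mono by blast

lemma weighted_poly_const: "fps_const c \<in> weighted_poly a b u v 0"
  by (simp add: weighted_poly_0 poly_alg_const)

lemma weighted_mod_scale: "f \<in> weighted_mod N a b u v n \<Longrightarrow> fps_const c * f \<in> weighted_mod N a b u v n"
  using weighted_mod_mult[of "fps_const c" N a b u v 0 f n] weighted_poly_const[of c a b u v]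
    weighted_poly_subset_mod[of a b u v 0 N] by auto

lemma weighted_mod_uminus: "f \<in> weighted_mod N a b u v n \<Longrightarrow> - f \<in> weighted_mod N a b u v n"
  using weighted_mod_scale[of f N a b u v n "-1"] by (simp flip: fps_const_neg)

lemma weighted_mod_mult_cong:
  assumes "f' \<in> weighted_mod N a b u v m" "f - f' \<in> weighted_mod N a b u v (Suc m)"
    and "g \<in> weighted_mod N a b u v n" "g - g' \<in> weighted_mod N a b u v (Suc n)"
  shows "f * g - f' * g' \<in> weighted_mod N a b u v (Suc (m + n))"
proof -
  have "(f - f') * g + f' * (g - g') \<in> weighted_mod N a b u v (Suc (m + n))"
    using weighted_mod_mult[OF assms(2,3)] weighted_mod_mult[OF assms(1,4)]
    by (intro weighted_mod_add) simp_all
  also have "(f - f') * g + f' * (g - g') = f * g - f' * g'"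
    by (simp add: algebra_simps)
  finally show ?thesis .
qed

lemma weighted_mod_power_cong:
  assumes f: "f \<in> weighted_mod N a b u v m" and f': "f' \<in> weighted_mod N a b u v m"
    and d: "f - f' \<in> weighted_mod N a b u v (Suc m)"
  shows "f ^ i \<in> weighted_mod N a b u v (m * i) \<and> f' ^ i \<in> weighted_mod N a b u v (m * i) \<and>
    f ^ i - f' ^ i \<in> weighted_mod N a b u v (Suc (m * i))"
proof (induction i)
  case 0
  have 1: "(1::'a fps) \<in> weighted_poly a b u v 0" "(0 :: 'a fps) \<in> weighted_poly a b u v (Suc 0)"
    using weighted_poly_const[of 1 a b u v] by (auto simp: weighted_poly_def fps_space.span_zero)
  then show ?case using weighted_poly_subset_mod by fastforce
next
  case (Suc i)
  then have "f * f ^ i - f' * f' ^ i \<in> weighted_mod N a b u v (Suc (m + m * i))"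
    by (intro weighted_mod_mult_cong[OF f' d]) auto
  then show ?case
    using Suc weighted_mod_mult[OF f] weighted_mod_mult[OF f'] by simp
qed

text \<open>
  An argument of Nakayama type: \<open>U - u\<close> and \<open>V - v\<close> have not only larger order but also larger weight,
  so replacing \<open>u, v\<close> by \<open>U, V\<close> in a polynomial leaves an error of larger weight. Repeating this up to weight
  \<open>N\<close> writes every polynomial in \<open>u, v\<close> as one in \<open>U, V\<close> modulo \<open>O(N)\<close>.
\<close>

theorem closed_alg_perturb:
  fixes u v U V :: "'a::field fps"
  assumes ab: "0 < a" "a < b" "\<not> a dvd b" and uv: "monic_order a u" "monic_order b v"
    and UV: "U \<in> closed_alg u v" "V \<in> closed_alg u v"
    and dU: "fps_X ^ Suc a dvd U - u" and dV: "fps_X ^ Suc b dvd V - v"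
  shows "closed_alg U V = closed_alg u v"
proof
  show "closed_alg U V \<subseteq> closed_alg u v" by (rule closed_alg_subset[OF UV])
  have poly: "\<exists>G\<in>poly_alg U V. fps_X ^ N dvd h - G" if h: "h \<in> poly_alg u v" for h N
  proof -
    define W where "W = weighted_mod N a b u v"
    note W = W_def
    have u: "u \<in> W a" and v: "v \<in> W b"
    proof -
      have "u ^ 1 * v ^ 0 \<in> weighted_poly a b u v a"
        unfolding weighted_poly_def by (rule fps_space.span_base) (intro CollectI exI conjI, rule refl, simp)
      then show "u \<in> W a" unfolding W using weighted_poly_subset_mod[of a b u v a N] by auto
      have "u ^ 0 * v ^ 1 \<in> weighted_poly a b u v b"
        unfolding weighted_poly_def by (rule fps_space.span_base) (intro CollectI exI conjI, rule refl, simp)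
      then show "v \<in> W b" unfolding W using weighted_poly_subset_mod[of a b u v b N] by auto
    qed
    have small: "D \<in> W n" if D: "D \<in> closed_alg u v" "n \<le> Suc b" "fps_X ^ n dvd D" for D n
    proof -
      obtain P where P: "P \<in> poly_alg u v" "fps_X ^ (N + n) dvd D - P"
        using closed_algE[OF D(1)] by blast
      have "fps_X ^ n dvd P"
        using X_power_dvd_cong[OF power_le_dvd[OF P(2), of n]] D(3) by simp
      then have "P \<in> weighted_poly a b u v n"
        by (rule poly_alg_weighted[OF ab uv P(1) D(2)])
      then show ?thesis
        using power_le_dvd[OF P(2), of N] unfolding W weighted_mod_def by auto
    qed
    have "U - u \<in> W (Suc a)" "V - v \<in> W (Suc b)"
      using small[of "U - u" "Suc a"] small[of "V - v" "Suc b"] UV dU dV ab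
      by (auto intro: closed_alg_diff closed_alg_generators)
    then have d: "u - U \<in> W (Suc a)" "v - V \<in> W (Suc b)"
      unfolding W using weighted_mod_uminus by fastforce+
    have U: "U \<in> W a" "V \<in> W b"
      using weighted_mod_add[of u N a b u v a "U - u"] weighted_mod_add[of v N a b u v b "V - v"]
        u v \<open>U - u \<in> W (Suc a)\<close> \<open>V - v \<in> W (Suc b)\<close> weighted_mod_mono[of a "Suc a" N a b u v]
        weighted_mod_mono[of b "Suc b" N a b u v] unfolding W by auto
    have mono: "u ^ i * v ^ j - U ^ i * V ^ j \<in> W (Suc (a * i + b * j))" for i j
      using weighted_mod_power_cong[of u N a b u v a U i] weighted_mod_power_cong[of v N a b u v b V j]
        u v d U unfolding W by (intro weighted_mod_mult_cong) auto
    have lift: "\<exists>G\<in>poly_alg U V. P - G \<in> W (Suc n)" if "P \<in> weighted_poly a b u v n" for P n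
      using that unfolding weighted_poly_def
    proof (induction rule: fps_space.span_induct_alt)
      case base
      show ?case using weighted_poly_subset_mod unfolding W
        by (intro bexI[of _ 0]) (force simp: poly_alg_0 weighted_poly_def fps_space.span_zero)+
    next
      case (step c x y)
      then obtain i j where x: "x = u ^ i * v ^ j" "n \<le> a * i + b * j" by auto
      obtain G where G: "G \<in> poly_alg U V" "y - G \<in> W (Suc n)" using step by blast
      have "u ^ i * v ^ j - U ^ i * V ^ j \<in> W (Suc n)"
        using mono[of i j] x(2) weighted_mod_mono[of "Suc n" "Suc (a * i + b * j)" N a b u v] unfolding W by auto
      then have "fps_const c * (u ^ i * v ^ j - U ^ i * V ^ j) + (y - G) \<in> W (Suc n)"
        using G(2) unfolding W by (intro weighted_mod_add weighted_mod_scale)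
      moreover have "fps_const c * (u ^ i * v ^ j - U ^ i * V ^ j) + (y - G) =
         (fps_const c * x + y) - (fps_const c * (U ^ i * V ^ j) + G)"
        by (simp add: x algebra_simps)
      ultimately show ?case
        using G(1) by (intro bexI[of _ "fps_const c * (U ^ i * V ^ j) + G"])
           (auto intro!: poly_alg_add poly_alg_scale monomial_in_poly_alg)
    qed
    have "\<exists>G\<in>poly_alg U V. h - G \<in> W n" for n
    proof (induction n)
      case 0
      have "h \<in> W 0"
        using h weighted_poly_subset_mod unfolding W weighted_poly_0[of a b, symmetric] by blast
      then show ?case by (intro bexI[of _ 0]) (auto simp: poly_alg_0)
    next
      case (Suc n)
      then obtain G P where G: "G \<in> poly_alg U V" "P \<in> weighted_poly a b u v n" "fps_X ^ N dvd h - G - P"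
        unfolding W weighted_mod_def by blast
      obtain G' where G': "G' \<in> poly_alg U V" "P - G' \<in> W (Suc n)"
        using lift[OF G(2)] by blast
      have "h - G - P \<in> W (Suc n)"
        using G(3) unfolding W weighted_mod_def
        by (intro CollectI bexI[of _ 0]) (auto simp: weighted_poly_def fps_space.span_zero)
      then have "(h - G - P) + (P - G') \<in> W (Suc n)"
        using G'(2) unfolding W by (intro weighted_mod_add)
      then show ?case
        using G(1) G'(1) by (intro bexI[of _ "G + G'"]) (auto simp: poly_alg_add algebra_simps)
    qed
    then obtain G P where "G \<in> poly_alg U V" "P \<in> weighted_poly a b u v N" "fps_X ^ N dvd h - G - P"
      unfolding W weighted_mod_def by blast
    moreover have "fps_X ^ N dvd P"
      using weighted_poly_dvd[OF monic_order_dvd[OF uv(1)] monic_order_dvd[OF uv(2)]] calculation(2) by blast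
    ultimately show ?thesis
      using X_power_dvd_cong by blast
  qed
  then have "u \<in> closed_alg U V" "v \<in> closed_alg U V"
    using monomial_in_poly_alg[of u 1 v 0] monomial_in_poly_alg[of u 0 v 1]
    unfolding closed_alg_def by auto
  then show "closed_alg u v \<subseteq> closed_alg U V" by (rule closed_alg_subset)
qed

definition module_diffs :: "'a::field fps \<Rightarrow> 'a fps \<Rightarrow> 'a fps set" where
  "module_diffs u v = {f * fps_deriv u + g * fps_deriv v | f g. f \<in> closed_alg u v \<and> g \<in> closed_alg u v}"

text \<open>
  By the chain rule, a differential in terms of \<open>dU, dV\<close> is one in terms of \<open>du, dv\<close> with an
  error beyond its own order.
\<close>

lemma value_set_module_diffs_mono:
  fixes u v U V :: "'a::field fps"
  assumes UV: "U \<in> closed_alg u v" "V \<in> closed_alg u v"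
  shows "value_set (module_diffs U V) \<subseteq> value_set (module_diffs u v)"
proof
  fix n assume "n \<in> value_set (module_diffs U V)"
  then obtain f g where fg: "f \<in> closed_alg U V" "g \<in> closed_alg U V"
    and w: "f * fps_deriv U + g * fps_deriv V \<noteq> 0" "subdegree (f * fps_deriv U + g * fps_deriv V) = n"
    unfolding value_set_def module_diffs_def by auto
  obtain p1 p2 where p: "p1 \<in> closed_alg u v" "p2 \<in> closed_alg u v"
    "fps_X ^ Suc n dvd fps_deriv U - (p1 * fps_deriv u + p2 * fps_deriv v)"
    using closed_alg_deriv[OF UV(1), of "Suc n"] by blast
  obtain q1 q2 where q: "q1 \<in> closed_alg u v" "q2 \<in> closed_alg u v"
    "fps_X ^ Suc n dvd fps_deriv V - (q1 * fps_deriv u + q2 * fps_deriv v)"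
    using closed_alg_deriv[OF UV(2), of "Suc n"] by blast
  have fg': "f \<in> closed_alg u v" "g \<in> closed_alg u v"
    using fg closed_alg_subset[OF UV] by auto
  let ?w = "(f * p1 + g * q1) * fps_deriv u + (f * p2 + g * q2) * fps_deriv v"
  have "fps_X ^ Suc n dvd f * (fps_deriv U - (p1 * fps_deriv u + p2 * fps_deriv v)) +
      g * (fps_deriv V - (q1 * fps_deriv u + q2 * fps_deriv v))"
    using p(3) q(3) by (intro dvd_add dvd_mult)
  also have "\<dots> = (f * fps_deriv U + g * fps_deriv V) - ?w"
    by (simp add: algebra_simps)
  finally have "subdegree ?w = n" "?w \<noteq> 0"
    using subdegree_cong w by blast+
  moreover have "?w \<in> module_diffs u v"
    unfolding module_diffs_def using fg' p q by (blast intro: closed_alg_add closed_alg_mult)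
  ultimately show "n \<in> value_set (module_diffs u v)"
    unfolding value_set_def by blast
qed

lemma module_diffs_compose:
  fixes u v r :: "'a::field fps"
  assumes r: "fps_nth r 0 = 0" "fps_nth r 1 \<noteq> 0"
  shows "module_diffs (u oo r) (v oo r) = (\<lambda>w. (w oo r) * fps_deriv r) ` module_diffs u v"
proof -
  have eq: "(f oo r) * fps_deriv (u oo r) + (g oo r) * fps_deriv (v oo r) =
      ((f * fps_deriv u + g * fps_deriv v) oo r) * fps_deriv r" for f g
    by (simp add: fps_compose_deriv[OF r(1)] fps_compose_add_distrib fps_compose_mult_distrib[OF r(1)] algebra_simps)
  show ?thesis
  proof (intro subset_antisym subsetI)
    fix w assume "w \<in> module_diffs (u oo r) (v oo r)"
    then obtain f g where fg: "f \<in> closed_alg (u oo r) (v oo r)" "g \<in> closed_alg (u oo r) (v oo r)"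
      "w = f * fps_deriv (u oo r) + g * fps_deriv (v oo r)" unfolding module_diffs_def by blast
    define f' g' where "f' = f oo fps_inv r" and "g' = g oo fps_inv r"
    have f': "f = f' oo r" "g = g' oo r"
      by (simp_all add: f'_def g'_def fps_compose_fps_inv_cancel[OF r])
    then have "f' \<in> closed_alg u v" "g' \<in> closed_alg u v"
      using fg(1,2) closed_alg_compose[OF r] by auto
    then show "w \<in> (\<lambda>w. (w oo r) * fps_deriv r) ` module_diffs u v"
      unfolding fg(3) unfolding f' eq unfolding module_diffs_def by blast
  next
    fix w assume "w \<in> (\<lambda>w. (w oo r) * fps_deriv r) ` module_diffs u v"
    then obtain f g where fg: "f \<in> closed_alg u v" "g \<in> closed_alg u v"
      "w = ((f * fps_deriv u + g * fps_deriv v) oo r) * fps_deriv r" unfolding module_diffs_def by blast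
    then show "w \<in> module_diffs (u oo r) (v oo r)"
      unfolding fg(3) eq[symmetric] module_diffs_def using closed_alg_compose_subset[OF r(1)] by blast
  qed
qed

lemma subdegree_compose_order_1:
  fixes h r :: "'a::field fps"
  assumes r: "fps_nth r 0 = 0" "fps_nth r 1 \<noteq> 0"
  shows "subdegree (h oo r) = subdegree h" "h oo r = 0 \<longleftrightarrow> h = 0"
proof -
  have "subdegree r = 1" using r by (intro subdegreeI) auto
  then show "subdegree (h oo r) = subdegree h" using subdegree_fps_compose[OF r(1)] by simp
  show "h oo r = 0 \<longleftrightarrow> h = 0" using fps_compose_eq_0_iff[OF r(1)] r by auto
qed

lemma value_set_image:
  assumes "\<And>w. subdegree (\<phi> w) = subdegree w" "\<And>w. \<phi> w = 0 \<longleftrightarrow> w = 0"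
  shows "value_set (\<phi> ` M) = value_set M"
proof -
  have "value_set (\<phi> ` M) = {subdegree (\<phi> w) | w. w \<in> M \<and> \<phi> w \<noteq> 0}"
    unfolding value_set_def by blast
  then show ?thesis unfolding assms value_set_def .
qed

lemma value_set_module_diffs_compose:
  fixes u v r :: "'a::field fps"
  assumes r: "fps_nth r 0 = 0" "fps_nth r 1 \<noteq> 0"
  shows "value_set (module_diffs (u oo r) (v oo r)) = value_set (module_diffs u v)"
proof -
  have d: "subdegree (fps_deriv r) = 0" "fps_deriv r \<noteq> 0"
    using r(2) by (auto simp: subdegree_eq_0_iff dest: arg_cong[of _ _ "\<lambda>f. fps_nth f 0"])
  have "subdegree ((w oo r) * fps_deriv r) = subdegree w" "(w oo r) * fps_deriv r = 0 \<longleftrightarrow> w = 0" for w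
    using subdegree_compose_order_1[OF r, of w] d by (cases "w = 0", auto)+
  then show ?thesis
    unfolding module_diffs_compose[OF r] by (rule value_set_image)
qed

section \<open>Curves with the same ring up to reparametrization\<close>

text \<open>
  The curves \<open>(t\<^sup>a, y)\<close> and \<open>(t\<^sup>a, z)\<close> have the same ring after the substitution \<open>t \<mapsto> \<tau>\<close> in the second one.
  In contrast to right-left equivalence this is obviously transitive, and it fixes semigroup, conductor
  and values of differentials.
\<close>

definition curve_equiv :: "nat \<Rightarrow> 'a::field fps \<Rightarrow> 'a fps \<Rightarrow> bool" where
  "curve_equiv a y z \<longleftrightarrow>
    (\<exists>\<tau>. monic_order 1 \<tau> \<and> closed_alg (fps_X ^ a) y = closed_alg (\<tau> ^ a) (z oo \<tau>))"

lemma monic_order_1D: "monic_order 1 r \<Longrightarrow> fps_nth r 0 = 0" "monic_order 1 r \<Longrightarrow> fps_nth r 1 \<noteq> 0"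
  by (auto simp: monic_order_iff)

lemma curve_equiv_refl: "curve_equiv a y (y :: 'a::field fps)"
proof -
  have "monic_order 1 (fps_X :: 'a fps)" by (simp add: monic_order_iff)
  then show ?thesis unfolding curve_equiv_def by (intro exI[of _ fps_X] conjI) simp_all
qed

lemma closed_alg_compose_image:
  assumes r: "fps_nth r 0 = 0" "fps_nth r 1 \<noteq> 0"
  shows "closed_alg (u oo r) (v oo r) = (\<lambda>h. h oo r) ` closed_alg u v"
proof (intro subset_antisym subsetI)
  fix h assume h: "h \<in> closed_alg (u oo r) (v oo r)"
  define g where "g = h oo fps_inv r"
  have eq: "g oo r = h" unfolding g_def by (rule fps_compose_fps_inv_cancel(1)[OF r])
  then have "g \<in> closed_alg u v"
    using h closed_alg_compose[OF r, of g u v] by simp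
  then show "h \<in> (\<lambda>h. h oo r) ` closed_alg u v"
    using eq by (intro image_eqI[of _ _ g]) simp_all
qed (use closed_alg_compose_subset[OF r(1)] in blast)

lemma curve_equiv_trans:
  assumes "curve_equiv a y z" "curve_equiv a z w"
  shows "curve_equiv a y w"
proof -
  obtain \<tau> \<sigma> where t: "monic_order 1 \<tau>" "closed_alg (fps_X ^ a) y = closed_alg (\<tau> ^ a) (z oo \<tau>)"
    and s: "monic_order 1 \<sigma>" "closed_alg (fps_X ^ a) z = closed_alg (\<sigma> ^ a) (w oo \<sigma>)"
    using assms unfolding curve_equiv_def by blast
  note r = monic_order_1D[OF t(1)]
  have "closed_alg (\<tau> ^ a) (z oo \<tau>) = (\<lambda>h. h oo \<tau>) ` closed_alg (fps_X ^ a) z"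
    using closed_alg_compose_image[OF r, of "fps_X ^ a" z] by (simp add: fps_X_power_compose[OF r(1)])
  also have "\<dots> = closed_alg ((\<sigma> oo \<tau>) ^ a) (w oo (\<sigma> oo \<tau>))"
    unfolding s(2) closed_alg_compose_image[OF r, symmetric] fps_compose_power[OF r(1)]
      fps_compose_assoc[OF r(1) monic_order_1D(1)[OF s(1)]] ..
  finally show ?thesis
    unfolding curve_equiv_def using t(2) monic_order_compose[OF t(1) s(1)] by blast
qed

lemma curve_equiv_closed_alg:
  assumes "curve_equiv a y z"
  obtains \<tau> where "monic_order 1 \<tau>" "closed_alg (fps_X ^ a) y = (\<lambda>h. h oo \<tau>) ` closed_alg (fps_X ^ a) z"
proof -
  obtain \<tau> where t: "monic_order 1 \<tau>" "closed_alg (fps_X ^ a) y = closed_alg (\<tau> ^ a) (z oo \<tau>)"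
    using assms unfolding curve_equiv_def by blast
  note r = monic_order_1D[OF t(1)]
  show ?thesis
    using that[OF t(1)] t(2) closed_alg_compose_image[OF r, of "fps_X ^ a" z]
    by (simp add: fps_X_power_compose[OF r(1)])
qed

lemma curve_equiv_value_set:
  assumes "curve_equiv a y z"
  shows "value_set (closed_alg (fps_X ^ a) z) = value_set (closed_alg (fps_X ^ a) y)"
proof -
  obtain \<tau> where t: "monic_order 1 \<tau>" "closed_alg (fps_X ^ a) y = (\<lambda>h. h oo \<tau>) ` closed_alg (fps_X ^ a) z"
    using curve_equiv_closed_alg[OF assms] .
  show ?thesis
    unfolding t(2) by (rule value_set_image[symmetric]) (rule subdegree_compose_order_1[OF monic_order_1D[OF t(1)]])+
qed

lemma curve_equiv_diff_values:
  assumes "curve_equiv a y z"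
  shows "value_set (module_diffs (fps_X ^ a) z) = value_set (module_diffs (fps_X ^ a) y)"
proof -
  obtain \<tau> where t: "monic_order 1 \<tau>" "closed_alg (fps_X ^ a) y = closed_alg (\<tau> ^ a) (z oo \<tau>)"
    using assms unfolding curve_equiv_def by blast
  note r = monic_order_1D[OF t(1)]
  have "value_set (module_diffs (fps_X ^ a) z) = value_set (module_diffs (\<tau> ^ a) (z oo \<tau>))"
    using value_set_module_diffs_compose[OF r, of "fps_X ^ a" z] by (simp add: fps_X_power_compose[OF r(1)])
  also have "\<dots> = value_set (module_diffs (fps_X ^ a) y)"
    using t(2) closed_alg_generators
    by (intro subset_antisym value_set_module_diffs_mono) blast+
  finally show ?thesis .
qed

lemma curve_equiv_conductor:
  assumes "curve_equiv a y z" and "\<And>h. fps_X ^ c dvd h \<Longrightarrow> h \<in> closed_alg (fps_X ^ a) y"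
    and "fps_X ^ c dvd h"
  shows "h \<in> closed_alg (fps_X ^ a) z"
proof -
  obtain \<tau> where t: "monic_order 1 \<tau>" "closed_alg (fps_X ^ a) y = (\<lambda>h. h oo \<tau>) ` closed_alg (fps_X ^ a) z"
    using curve_equiv_closed_alg[OF assms(1)] .
  note r = monic_order_1D[OF t(1)]
  have "h oo \<tau> \<in> closed_alg (fps_X ^ a) y"
    by (intro assms(2) X_power_dvd_compose r assms(3))
  then obtain h' where "h' \<in> closed_alg (fps_X ^ a) z" "h oo \<tau> = h' oo \<tau>" unfolding t(2) by blast
  then show ?thesis using fps_compose_fps_inv_cancel(2)[OF r] by metis
qed

section \<open>Truncated exponentials of derivations\<close>

text \<open>
  The operator \<open>(\<epsilon> d/dt)\<^sup>n / n!\<close>. The recursion divides by one integer at a time, so it is meaningful as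
  long as \<open>1, ..., n\<close> are nonzero in \<open>K\<close>.
\<close>

primrec divided_pow :: "'a::field fps \<Rightarrow> nat \<Rightarrow> 'a fps \<Rightarrow> 'a fps" where
  "divided_pow \<epsilon> 0 h = h"
| "divided_pow \<epsilon> (Suc n) h = fps_const (1 / of_nat (Suc n)) * (\<epsilon> * fps_deriv (divided_pow \<epsilon> n h))"

definition trunc_exp :: "'a::field fps \<Rightarrow> nat \<Rightarrow> 'a fps \<Rightarrow> 'a fps" where
  "trunc_exp \<epsilon> M h = (\<Sum>n<M. divided_pow \<epsilon> n h)"

lemma divided_pow_add: "divided_pow \<epsilon> n (f + g) = divided_pow \<epsilon> n f + divided_pow \<epsilon> n g"
  by (induction n) (simp_all add: algebra_simps)

lemma divided_pow_scale: "divided_pow \<epsilon> n (fps_const c * f) = fps_const c * divided_pow \<epsilon> n f"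
  by (induction n) (simp_all add: algebra_simps)

lemma derivation_raises:
  fixes \<epsilon> h :: "'a::field fps"
  assumes "fps_X ^ 2 dvd \<epsilon>" "fps_X ^ n dvd h"
  shows "fps_X ^ Suc n dvd \<epsilon> * fps_deriv h"
proof -
  have "fps_X ^ (2 + (n - 1)) dvd \<epsilon> * fps_deriv h"
    using assms by (intro X_power_dvd_mult X_power_dvd_deriv)
  then show ?thesis by (rule power_le_dvd) simp
qed

lemma divided_pow_raises:
  fixes \<epsilon> h :: "'a::field fps"
  assumes e: "fps_X ^ 2 dvd \<epsilon>" and h: "fps_X ^ k dvd h"
  shows "fps_X ^ (k + n) dvd divided_pow \<epsilon> n h"
proof (induction n)
  case (Suc n)
  from derivation_raises[OF e Suc] show ?case by simp
qed (simp add: h)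

lemma divided_pow_derivation:
  assumes "of_nat (Suc n) \<noteq> (0::'a::field)"
  shows "\<epsilon> * fps_deriv (divided_pow \<epsilon> n h) = fps_const (of_nat (Suc n)) * divided_pow \<epsilon> (Suc n) (h :: 'a fps)"
proof -
  have "fps_const (of_nat (Suc n)) * fps_const (1 / of_nat (Suc n)) = (1 :: 'a fps)"
    using assms by (simp del: of_nat_Suc flip: fps_const_1_eq_1)
  then show ?thesis by (simp del: of_nat_Suc flip: mult.assoc)
qed

text \<open>
  With the divided normalization the Leibniz rule is a plain convolution: applying the derivation to the
  \<open>n\<close>-th convolution produces the terms of the next one with multiplicities \<open>i\<close> and \<open>n + 1 - i\<close>.
\<close>

lemma divided_pow_mult:
  fixes u v :: "'a::field fps"
  assumes inv: "\<And>n. 0 < n \<Longrightarrow> n < M \<Longrightarrow> of_nat n \<noteq> (0::'a)" and "n < M"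
  shows "divided_pow \<epsilon> n (u * v) = (\<Sum>i\<le>n. divided_pow \<epsilon> i u * divided_pow \<epsilon> (n - i) v)"
  using assms(2)
proof (induction n)
  case (Suc n)
  let ?A = "\<lambda>i. divided_pow \<epsilon> i u" and ?B = "\<lambda>i. divided_pow \<epsilon> i v" and ?c = "\<lambda>i. fps_const (of_nat i) :: 'a fps"
  have nz: "of_nat (Suc i) \<noteq> (0::'a)" if "i \<le> n" for i
    using inv[of "Suc i"] Suc.prems that by simp
  have "\<epsilon> * fps_deriv (\<Sum>i\<le>n. ?A i * ?B (n - i)) =
     (\<Sum>i\<le>n. (\<epsilon> * fps_deriv (?A i)) * ?B (n - i) + ?A i * (\<epsilon> * fps_deriv (?B (n - i))))"
    by (simp add: fps_deriv_sum sum_distrib_left algebra_simps)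
  also have "\<dots> = (\<Sum>i\<le>n. ?c (Suc i) * (?A (Suc i) * ?B (Suc n - Suc i)) + ?c (Suc n - i) * (?A i * ?B (Suc n - i)))"
  proof (rule sum.cong[OF refl])
    fix i assume "i \<in> {..n}"
    then have i: "i \<le> n" "Suc n - i = Suc (n - i)" by auto
    show "(\<epsilon> * fps_deriv (?A i)) * ?B (n - i) + ?A i * (\<epsilon> * fps_deriv (?B (n - i))) =
      ?c (Suc i) * (?A (Suc i) * ?B (Suc n - Suc i)) + ?c (Suc n - i) * (?A i * ?B (Suc n - i))"
      unfolding i(2) divided_pow_derivation[OF nz[OF i(1)]] divided_pow_derivation[OF nz[OF diff_le_self]]
      by (simp del: divided_pow.simps of_nat_Suc add: mult_ac)
  qed
  also have "\<dots> = (\<Sum>i\<le>n. ?c (Suc i) * (?A (Suc i) * ?B (Suc n - Suc i))) + (\<Sum>i\<le>n. ?c (Suc n - i) * (?A i * ?B (Suc n - i)))"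
    by (rule sum.distrib)
  also have "(\<Sum>i\<le>n. ?c (Suc i) * (?A (Suc i) * ?B (Suc n - Suc i))) = (\<Sum>i\<le>Suc n. ?c i * (?A i * ?B (Suc n - i)))"
    unfolding sum.atMost_Suc_shift[of _ n] by simp
  also have "(\<Sum>i\<le>n. ?c (Suc n - i) * (?A i * ?B (Suc n - i))) = (\<Sum>i\<le>Suc n. ?c (Suc n - i) * (?A i * ?B (Suc n - i)))"
    by simp
  also have "(\<Sum>i\<le>Suc n. ?c i * (?A i * ?B (Suc n - i))) + \<dots> = (\<Sum>i\<le>Suc n. ?c (Suc n) * (?A i * ?B (Suc n - i)))"
    unfolding sum.distrib[symmetric]
  proof (rule sum.cong[OF refl])
    fix i assume "i \<in> {..Suc n}"
    then have "?c (Suc n) = ?c i + ?c (Suc n - i)"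
      by (simp del: of_nat_Suc add: of_nat_diff flip: of_nat_add)
    then show "?c i * (?A i * ?B (Suc n - i)) + ?c (Suc n - i) * (?A i * ?B (Suc n - i)) = ?c (Suc n) * (?A i * ?B (Suc n - i))"
      by (simp only: distrib_right)
  qed
  also have "\<dots> = ?c (Suc n) * (\<Sum>i\<le>Suc n. ?A i * ?B (Suc n - i))"
    by (simp only: sum_distrib_left)
  finally have "?c (Suc n) * divided_pow \<epsilon> (Suc n) (u * v) = ?c (Suc n) * (\<Sum>i\<le>Suc n. ?A i * ?B (Suc n - i))"
    using Suc divided_pow_derivation[OF nz[OF order_refl], of \<epsilon> "u * v"] by simp
  moreover have "?c (Suc n) \<noteq> 0" using nz[OF order_refl] by (simp del: of_nat_Suc)
  ultimately show ?case by simp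
qed simp

lemma trunc_exp_add: "trunc_exp \<epsilon> M (f + g) = trunc_exp \<epsilon> M f + trunc_exp \<epsilon> M g"
  by (simp add: trunc_exp_def divided_pow_add sum.distrib)

lemma trunc_exp_scale: "trunc_exp \<epsilon> M (fps_const c * f) = fps_const c * trunc_exp \<epsilon> M f"
  by (simp add: trunc_exp_def divided_pow_scale sum_distrib_left)

lemma trunc_exp_dvd:
  fixes \<epsilon> h :: "'a::field fps"
  assumes "fps_X ^ 2 dvd \<epsilon>" "fps_X ^ k dvd h"
  shows "fps_X ^ k dvd trunc_exp \<epsilon> M h"
  unfolding trunc_exp_def
  by (intro dvd_sum power_le_dvd[OF divided_pow_raises[OF assms]]) simp

lemma trunc_exp_leading:
  fixes \<epsilon> h :: "'a::field fps"
  assumes "fps_X ^ 2 dvd \<epsilon>" "fps_X ^ k dvd h" "0 < M"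
  shows "fps_X ^ Suc k dvd trunc_exp \<epsilon> M h - h"
proof -
  obtain m where M: "M = Suc m" using assms(3) gr0_implies_Suc by blast
  have "trunc_exp \<epsilon> M h - h = (\<Sum>n<m. divided_pow \<epsilon> (Suc n) h)"
    unfolding trunc_exp_def M sum.lessThan_Suc_shift by (simp del: divided_pow.simps(2))
  also have "fps_X ^ Suc k dvd \<dots>"
    by (intro dvd_sum power_le_dvd[OF divided_pow_raises[OF assms(1,2)]]) simp
  finally show ?thesis .
qed

text \<open>
  The product of two truncated exponentials contains, besides the Leibniz terms, only terms with \<open>i + j \<ge> M\<close>,
  and these have been raised in order at least \<open>M\<close> times.
\<close>

lemma trunc_exp_mult:
  fixes \<epsilon> u v :: "'a::field fps"
  assumes e: "fps_X ^ 2 dvd \<epsilon>" and inv: "\<And>n. 0 < n \<Longrightarrow> n < M \<Longrightarrow> of_nat n \<noteq> (0::'a)"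
  shows "fps_X ^ M dvd trunc_exp \<epsilon> M u * trunc_exp \<epsilon> M v - trunc_exp \<epsilon> M (u * v)"
proof -
  let ?g = "\<lambda>(i, j). divided_pow \<epsilon> i u * divided_pow \<epsilon> j v"
  have "trunc_exp \<epsilon> M u * trunc_exp \<epsilon> M v = sum ?g ({..<M} \<times> {..<M})"
    unfolding trunc_exp_def sum_product sum.cartesian_product ..
  also have "\<dots> = sum ?g ({(i, j). i + j < M} \<union> ({..<M} \<times> {..<M} - {(i, j). i + j < M}))"
    by (rule sum.cong) auto
  also have "\<dots> = sum ?g {(i, j). i + j < M} + sum ?g ({..<M} \<times> {..<M} - {(i, j). i + j < M})"
    by (intro sum.union_disjoint finite_subset[of "{(i, j). i + j < M}" "{..<M} \<times> {..<M}"]) auto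
  also have "sum ?g {(i, j). i + j < M} = (\<Sum>n<M. \<Sum>i\<le>n. divided_pow \<epsilon> i u * divided_pow \<epsilon> (n - i) v)"
    by (rule sum.triangle_reindex)
  also have "\<dots> = trunc_exp \<epsilon> M (u * v)"
    unfolding trunc_exp_def by (intro sum.cong refl divided_pow_mult[OF inv, symmetric]) auto
  finally have "trunc_exp \<epsilon> M u * trunc_exp \<epsilon> M v - trunc_exp \<epsilon> M (u * v) =
      sum ?g ({..<M} \<times> {..<M} - {(i, j). i + j < M})" by simp
  also have "fps_X ^ M dvd \<dots>"
  proof (rule dvd_sum)
    fix x assume "x \<in> {..<M} \<times> {..<M} - {(i, j). i + j < M}"
    then obtain i j where x: "x = (i, j)" "M \<le> (0 + i) + (0 + j)" by auto
    have "fps_X ^ ((0 + i) + (0 + j)) dvd divided_pow \<epsilon> i u * divided_pow \<epsilon> j v"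
      by (intro X_power_dvd_mult divided_pow_raises[OF e]) auto
    then show "fps_X ^ M dvd ?g x"
      unfolding x(1) prod.case by (rule power_le_dvd[OF _ x(2)])
  qed
  finally show ?thesis .
qed

lemma trunc_exp_const:
  assumes "0 < M"
  shows "trunc_exp \<epsilon> M (fps_const c) = fps_const c"
proof -
  obtain m where M: "M = Suc m" using assms gr0_implies_Suc by blast
  have "divided_pow \<epsilon> (Suc n) (fps_const c) = 0" for n
    by (induction n) auto
  then show ?thesis unfolding trunc_exp_def M sum.lessThan_Suc_shift by (simp del: divided_pow.simps(2))
qed

text \<open>
  A linear map that is multiplicative modulo \<open>O(M)\<close> and respects orders is determined there by the image of \<open>t\<close>.
\<close>

lemma trunc_exp_eq_compose:
  fixes \<epsilon> h :: "'a::field fps"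
  assumes e: "fps_X ^ 2 dvd \<epsilon>" and inv: "\<And>n. 0 < n \<Longrightarrow> n < M \<Longrightarrow> of_nat n \<noteq> (0::'a)" and M: "0 < M"
  shows "fps_X ^ M dvd trunc_exp \<epsilon> M h - (h oo trunc_exp \<epsilon> M fps_X)"
proof -
  define \<tau> where "\<tau> = trunc_exp \<epsilon> M fps_X"
  have "fps_X ^ Suc 0 dvd \<tau>"
    unfolding \<tau>_def by (intro trunc_exp_dvd e) simp
  then have t0: "fps_nth \<tau> 0 = 0" using X_power_dvd_nth by blast
  have pow: "fps_X ^ M dvd trunc_exp \<epsilon> M (fps_X ^ i) - \<tau> ^ i" for i
  proof (induction i)
    case 0
    show ?case using trunc_exp_const[OF M, of \<epsilon> 1] by simp
  next
    case (Suc i)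
    have "fps_X ^ M dvd trunc_exp \<epsilon> M (fps_X * fps_X ^ i) - \<tau> * trunc_exp \<epsilon> M (fps_X ^ i)"
      unfolding \<tau>_def by (intro X_power_dvd_diff_sym[OF trunc_exp_mult[OF e inv]])
    moreover have "fps_X ^ M dvd \<tau> * trunc_exp \<epsilon> M (fps_X ^ i) - \<tau> * \<tau> ^ i"
      using Suc by (simp flip: right_diff_distrib)
    ultimately show ?case using X_power_dvd_diff_trans by fastforce
  qed
  define cut where "cut N = (\<Sum>i<N. fps_const (fps_nth h i) * fps_X ^ i)" for N
  have "fps_X ^ M dvd trunc_exp \<epsilon> M (cut N) - (cut N oo \<tau>)" for N
  proof (induction N)
    case 0
    have "trunc_exp \<epsilon> M 0 = 0" using trunc_exp_const[OF M, of \<epsilon> 0] by simp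
    then show ?case by (simp add: cut_def)
  next
    case (Suc N)
    have "fps_X ^ M dvd (trunc_exp \<epsilon> M (cut N) - (cut N oo \<tau>)) +
      fps_const (fps_nth h N) * (trunc_exp \<epsilon> M (fps_X ^ N) - \<tau> ^ N)"
      using Suc pow by (intro dvd_add dvd_mult)
    also have "\<dots> = trunc_exp \<epsilon> M (cut (Suc N)) - (cut (Suc N) oo \<tau>)"
      by (simp add: cut_def trunc_exp_add trunc_exp_scale fps_compose_add_distrib
          fps_compose_mult_distrib[OF t0] fps_X_power_compose[OF t0] right_diff_distrib)
    finally show ?case .
  qed
  note this[of M]
  moreover have rest: "fps_X ^ M dvd h - cut M"
    unfolding X_power_dvd_iff cut_def by (auto simp: fps_sum_nth if_distrib sum.delta cong: if_cong)
  have "fps_X ^ M dvd trunc_exp \<epsilon> M (h - cut M) - ((h - cut M) oo \<tau>)"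
    by (intro dvd_diff trunc_exp_dvd[OF e rest] X_power_dvd_compose[OF t0 rest])
  ultimately have "fps_X ^ M dvd (trunc_exp \<epsilon> M (cut M) - (cut M oo \<tau>)) +
     (trunc_exp \<epsilon> M (h - cut M) - ((h - cut M) oo \<tau>))" by (rule dvd_add)
  also have "\<dots> = trunc_exp \<epsilon> M (cut M + (h - cut M)) - ((cut M + (h - cut M)) oo \<tau>)"
    unfolding trunc_exp_add fps_compose_add_distrib by simp
  finally show ?thesis unfolding \<tau>_def by simp
qed

section \<open>Approximate roots\<close>

text \<open>
  The linear term of \<open>\<sigma>\<^sup>n\<^sup>+\<^sup>1 - \<tau>\<^sup>n\<^sup>+\<^sup>1\<close> in \<open>\<sigma> - \<tau>\<close>, with the coefficient \<open>(n+1) \<tau>\<^sup>n\<close> replaced by its leading term.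
\<close>

lemma power_diff_monic:
  fixes \<sigma> \<tau> :: "'a::field fps"
  assumes "monic_order 1 \<sigma>" "monic_order 1 \<tau>" "fps_X ^ m dvd \<sigma> - \<tau>"
  shows "fps_X ^ (m + Suc n) dvd \<sigma> ^ Suc n - \<tau> ^ Suc n - fps_const (of_nat (Suc n)) * fps_X ^ n * (\<sigma> - \<tau>)"
proof (induction n)
  case 0
  show ?case by simp
next
  case (Suc n)
  let ?d = "\<sigma> - \<tau>"
  have s: "fps_X ^ 1 dvd \<sigma>" by (rule monic_order_dvd[OF assms(1)])
  have s2: "fps_X ^ 2 dvd \<sigma> - fps_X"
    using assms(1) unfolding monic_order_def by (simp add: numeral_2_eq_2)
  have t: "fps_X ^ Suc (Suc n) dvd \<tau> ^ Suc n - fps_X ^ Suc n"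
    using monic_order_power[OF assms(2), of "Suc n"] unfolding monic_order_def by simp
  have "fps_X ^ (1 + (m + Suc n)) dvd \<sigma> * (\<sigma> ^ Suc n - \<tau> ^ Suc n - fps_const (of_nat (Suc n)) * fps_X ^ n * ?d)"
    by (intro X_power_dvd_mult s Suc)
  moreover have "fps_X ^ (2 + (n + m)) dvd (\<sigma> - fps_X) * (fps_X ^ n * (fps_const (of_nat (Suc n)) * ?d))"
    using assms(3) by (intro X_power_dvd_mult s2 dvd_mult) auto
  moreover have "fps_X ^ (Suc (Suc n) + m) dvd (\<tau> ^ Suc n - fps_X ^ Suc n) * ?d"
    by (intro X_power_dvd_mult t assms(3))
  ultimately have "fps_X ^ (m + Suc (Suc n)) dvd
     \<sigma> * (\<sigma> ^ Suc n - \<tau> ^ Suc n - fps_const (of_nat (Suc n)) * fps_X ^ n * ?d)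
     + (\<sigma> - fps_X) * (fps_X ^ n * (fps_const (of_nat (Suc n)) * ?d)) + (\<tau> ^ Suc n - fps_X ^ Suc n) * ?d"
    by (intro dvd_add) (simp_all add: add_ac)
  also have "\<dots> = \<sigma> ^ Suc (Suc n) - \<tau> ^ Suc (Suc n) - (fps_const (of_nat (Suc n)) + 1) * fps_X ^ Suc n * ?d"
    by (simp del: of_nat_Suc add: algebra_simps)
  also have "fps_const (of_nat (Suc n)) + 1 = (fps_const (of_nat (Suc (Suc n))) :: 'a fps)"
    unfolding fps_of_nat by simp
  finally show ?case .
qed

lemma power_diff_monic_dvd:
  fixes \<sigma> \<tau> :: "'a::field fps"
  assumes "monic_order 1 \<sigma>" "monic_order 1 \<tau>" "fps_X ^ m dvd \<sigma> - \<tau>" "0 < n"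
  shows "fps_X ^ (m + n - 1) dvd \<sigma> ^ n - \<tau> ^ n"
proof -
  obtain k where n: "n = Suc k" using assms(4) gr0_implies_Suc by blast
  have "fps_X ^ (k + m) dvd (fps_X ^ k) * (fps_const (of_nat (Suc k)) * (\<sigma> - \<tau>))"
    by (intro X_power_dvd_mult dvd_mult assms(3)) simp
  then have "fps_X ^ (m + n - 1) dvd fps_const (of_nat (Suc k)) * fps_X ^ k * (\<sigma> - \<tau>)"
    unfolding n by (simp add: algebra_simps del: of_nat_Suc)
  moreover have "fps_X ^ (m + n - 1) dvd \<sigma> ^ n - \<tau> ^ n - fps_const (of_nat (Suc k)) * fps_X ^ k * (\<sigma> - \<tau>)"
    using power_le_dvd[OF power_diff_monic[OF assms(1-3), of k], of "m + n - 1"] n by simp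
  ultimately show ?thesis using X_power_dvd_cong by blast
qed

lemma compose_diff_monic_dvd:
  fixes \<sigma> \<tau> h :: "'a::field fps"
  assumes "monic_order 1 \<sigma>" "monic_order 1 \<tau>" "fps_X ^ m dvd \<sigma> - \<tau>" and h: "fps_X ^ n dvd h" "0 < n"
  shows "fps_X ^ (m + n - 1) dvd (h oo \<sigma>) - (h oo \<tau>)"
  unfolding X_power_dvd_iff
proof (intro allI impI)
  fix k assume k: "k < m + n - 1"
  have "fps_nth h i * fps_nth (\<sigma> ^ i - \<tau> ^ i) k = 0" for i
  proof (cases "i < n")
    case True
    then show ?thesis using X_power_dvd_nth[OF h(1)] by simp
  next
    case False
    then show ?thesis
      using X_power_dvd_nth[OF power_diff_monic_dvd[OF assms(1-3), of i], of k] h(2) k by simp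
  qed
  then show "fps_nth ((h oo \<sigma>) - (h oo \<tau>)) k = 0"
    by (auto simp add: fps_compose_nth simp flip: sum_subtractf right_diff_distrib intro!: sum.neutral)
qed

text \<open>
  Newton's iteration for \<open>\<tau>\<^sup>a = U\<close>. Finitely many steps are enough, since a later error in \<open>O(c)\<close> is
  absorbed by the ring; each step gains one order and moves \<open>\<tau>\<close> only in high order.
\<close>

lemma approximate_root:
  fixes \<tau>0 U :: "'a::field fps"
  assumes a: "0 < a" "of_nat a \<noteq> (0::'a)" and t: "monic_order 1 \<tau>0"
    and U: "fps_X ^ k dvd U - \<tau>0 ^ a" and k: "a < k"
  shows "\<exists>\<tau>. monic_order 1 \<tau> \<and> fps_X ^ (k + n) dvd U - \<tau> ^ a \<and> fps_X ^ (k + 1 - a) dvd \<tau> - \<tau>0"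
proof (induction n)
  case 0
  then show ?case using t U by (intro exI[of _ \<tau>0]) auto
next
  case (Suc n)
  then obtain \<tau> where \<tau>: "monic_order 1 \<tau>" "fps_X ^ (k + n) dvd U - \<tau> ^ a" "fps_X ^ (k + 1 - a) dvd \<tau> - \<tau>0"
    by blast
  define N where "N = k + n"
  define c where "c = fps_nth (U - \<tau> ^ a) N / of_nat a"
  \<comment> \<open>The correction whose linear effect \<open>a t\<^sup>a\<^sup>-\<^sup>1 \<delta>\<close> cancels the error term at \<open>t\<^sup>N\<close>.\<close>
  define \<delta> where "\<delta> = fps_const c * fps_X ^ (N + 1 - a)"
  have d: "fps_X ^ (N + 1 - a) dvd \<delta>" by (simp add: \<delta>_def)
  have Na: "a < N" "2 \<le> N + 1 - a" using k by (auto simp: N_def)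
  have m: "monic_order 1 (\<tau> + \<delta>)"
    using monic_order_cong[OF \<tau>(1), of "\<tau> + \<delta>"] power_le_dvd[OF d Na(2)] by (simp add: numeral_2_eq_2)
  obtain a' where a': "a = Suc a'" using a(1) gr0_implies_Suc by blast
  have "fps_X ^ (N + 1 - a + a) dvd (\<tau> + \<delta>) ^ a - \<tau> ^ a - fps_const (of_nat a) * fps_X ^ a' * \<delta>"
    using power_diff_monic[OF m \<tau>(1), of "N + 1 - a" a'] d unfolding a' by simp
  moreover have "fps_const (of_nat a) * fps_X ^ a' * \<delta> = fps_const (of_nat a * c) * fps_X ^ N"
  proof -
    have "a' + (N + 1 - a) = N" using Na a' by simp
    then have "fps_X ^ a' * fps_X ^ (N + 1 - a) = (fps_X ^ N :: 'a fps)" by (metis power_add)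
    moreover have "fps_const (of_nat a) * fps_X ^ a' * \<delta> =
        (fps_const (of_nat a) * fps_const c) * (fps_X ^ a' * fps_X ^ (N + 1 - a))"
      unfolding \<delta>_def by (simp only: mult_ac)
    ultimately show ?thesis by (simp only: fps_const_mult)
  qed
  moreover have "of_nat a * c = fps_nth (U - \<tau> ^ a) N" using a(2) by (simp add: c_def)
  ultimately have 1: "fps_X ^ Suc N dvd (\<tau> + \<delta>) ^ a - \<tau> ^ a - fps_const (fps_nth (U - \<tau> ^ a) N) * fps_X ^ N"
    using Na by simp
  have 2: "fps_X ^ Suc N dvd U - \<tau> ^ a - fps_const (fps_nth (U - \<tau> ^ a) N) * fps_X ^ N"
    unfolding X_power_dvd_Suc_iff using \<tau>(2)
    by (auto simp: N_def X_power_dvd_iff)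
  have "fps_X ^ Suc N dvd U - (\<tau> + \<delta>) ^ a"
  proof -
    have eq: "(A - B - C) - (D - B - C) = A - D" for A B C D :: "'a fps" by simp
    show ?thesis using dvd_diff[OF 2 1] unfolding eq .
  qed
  moreover have "fps_X ^ (k + 1 - a) dvd (\<tau> + \<delta>) - \<tau>0"
  proof -
    have "fps_X ^ (k + 1 - a) dvd \<delta>" using d by (rule power_le_dvd) (simp add: N_def)
    then show ?thesis using dvd_add[OF \<tau>(3)] by (simp add: algebra_simps)
  qed
  ultimately show ?case using m unfolding N_def by (intro exI[of _ "\<tau> + \<delta>"]) auto
qed

section \<open>Moving one coefficient\<close>

lemma X_power_dvd_compose_iff:
  fixes h r :: "'a::field fps"
  assumes "monic_order 1 r"
  shows "fps_X ^ n dvd h oo r \<longleftrightarrow> fps_X ^ n dvd h"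
proof
  assume "fps_X ^ n dvd h oo r"
  then have "fps_X ^ n dvd (h oo r) oo fps_inv r"
    by (rule X_power_dvd_compose[rotated]) (simp add: fps_inv_def)
  then show "fps_X ^ n dvd h"
    unfolding fps_compose_fps_inv_cancel(2)[OF monic_order_1D[OF assms]] .
qed (rule X_power_dvd_compose[OF monic_order_1D(1)[OF assms]])

text \<open>
  Below order \<open>b\<close> only powers of \<open>t\<^sup>a\<close> contribute.
\<close>

lemma closed_alg_low_coeff:
  fixes y h :: "'a::field fps"
  assumes y: "fps_X ^ b dvd y" and h: "h \<in> closed_alg (fps_X ^ a) y" and i: "i < b" "\<not> a dvd i"
  shows "fps_nth h i = 0"
proof -
  obtain P where P: "P \<in> poly_alg (fps_X ^ a) y" "fps_X ^ b dvd h - P"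
    using closed_algE[OF h] by blast
  have "fps_nth P i = 0"
    using P(1)
  proof (induction rule: poly_alg_induct)
    case (step c m j f)
    have "fps_nth ((fps_X ^ a) ^ m * y ^ j) i = 0"
    proof (cases j)
      case 0
      then show ?thesis using i(2) by (auto simp flip: power_mult)
    next
      case (Suc j')
      then have "fps_X ^ b dvd (fps_X ^ a) ^ m * y ^ j" using y by simp
      then show ?thesis using i(1) by (rule X_power_dvd_nth)
    qed
    with step show ?case by simp
  qed simp
  then show ?thesis using X_power_dvd_nth[OF P(2) i(1)] by simp
qed

lemma deriv_X_power: "fps_deriv (fps_X ^ a :: 'a::field fps) = fps_const (of_nat a) * fps_X ^ (a - 1)"
  by (simp add: fps_deriv_power fps_of_nat)

lemma deriv_leading:
  fixes y :: "'a::field fps"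
  assumes "monic_order b y" "0 < b"
  shows "fps_X ^ (b - 1) dvd fps_deriv y" "fps_nth (fps_deriv y) (b - 1) = of_nat b"
  using X_power_dvd_deriv[OF monic_order_dvd[OF assms(1)]] assms by (auto simp: monic_order_iff)

lemma mult_nth_leading:
  fixes f g :: "'a::field fps"
  assumes "fps_X ^ m dvd f" "fps_X ^ n dvd g"
  shows "fps_nth (f * g) (m + n) = fps_nth f m * fps_nth g n"
proof -
  obtain f' g' where fg: "f = fps_X ^ m * f'" "g = fps_X ^ n * g'" using assms by blast
  have eq: "f * g = fps_X ^ (m + n) * (f' * g')" unfolding fg power_add by (simp only: mult_ac)
  have "fps_nth (f * g) (m + n) = fps_nth f' 0 * fps_nth g' 0"
    unfolding eq by (simp add: fps_X_power_mult_nth)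
  then show ?thesis by (simp add: fg fps_X_power_mult_nth)
qed

text \<open>
  A differential \<open>f x' + g y' = x' w\<close> with \<open>w\<close> of order at least \<open>k\<close>. The bounds on the orders of \<open>f\<close> and
  \<open>g\<close> make the induced derivation raise orders and keep the new generators congruent to the old ones.
\<close>

locale elimination =
  fixes a b c k :: nat and y f g w :: "'a::field fps"
  assumes ab: "0 < a" "a < b" "\<not> a dvd b"
    and k: "b < k" "k < c"
    and nonzero: "\<And>n. 0 < n \<Longrightarrow> n \<le> k \<Longrightarrow> of_nat n \<noteq> (0::'a)"
    and y: "monic_order b y"
    and conductor: "\<And>h. fps_X ^ c dvd h \<Longrightarrow> h \<in> closed_alg (fps_X ^ a) y"
    and f: "f \<in> closed_alg (fps_X ^ a) y" "fps_X ^ Suc b dvd f"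
    and g: "g \<in> closed_alg (fps_X ^ a) y" "fps_X ^ Suc a dvd g"
    and w: "f * fps_deriv (fps_X ^ a) + g * fps_deriv y = fps_deriv (fps_X ^ a) * w" "fps_X ^ k dvd w"
begin

abbreviation "C \<equiv> closed_alg (fps_X ^ a) y"

text \<open>
  The coefficient \<open>-g/x'\<close> of the derivation \<open>D = -(g/x') d/dt\<close>. It lies in \<open>O(2)\<close> because \<open>g\<close> has
  order greater than \<open>a\<close>.
\<close>

definition field_coeff :: "'a fps" where
  "field_coeff = (SOME \<epsilon>. fps_X ^ 2 dvd \<epsilon> \<and> \<epsilon> * fps_deriv (fps_X ^ a) = - g)"

lemma of_nat_a: "of_nat a \<noteq> (0::'a)" and of_nat_b: "of_nat b \<noteq> (0::'a)"
  using nonzero ab k by auto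

lemma field_coeff: "fps_X ^ 2 dvd field_coeff" "field_coeff * fps_deriv (fps_X ^ a) = - g"
proof -
  obtain G where G: "g = fps_X ^ Suc a * G" using g(2) by blast
  define \<epsilon> where "\<epsilon> = fps_X ^ 2 * (fps_const (- 1 / of_nat a) * G)"
  have "fps_const (- 1 / of_nat a) * fps_const (of_nat a) = (- 1 :: 'a fps)"
    using of_nat_a by (simp flip: fps_const_neg)
  moreover have "fps_X ^ 2 * fps_X ^ (a - 1) = (fps_X ^ Suc a :: 'a fps)"
    using ab(1) by (simp flip: power_add)
  moreover have "\<epsilon> * fps_deriv (fps_X ^ a) =
      (fps_const (- 1 / of_nat a) * fps_const (of_nat a)) * ((fps_X ^ 2 * fps_X ^ (a - 1)) * G)"
    unfolding \<epsilon>_def deriv_X_power by (simp only: mult_ac)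
  ultimately have "\<epsilon> * fps_deriv (fps_X ^ a) = - g" using G by simp
  then have "\<exists>\<epsilon>. fps_X ^ 2 dvd \<epsilon> \<and> \<epsilon> * fps_deriv (fps_X ^ a) = - g"
    unfolding \<epsilon>_def by (meson dvd_triv_left)
  from someI_ex[OF this] show "fps_X ^ 2 dvd field_coeff" "field_coeff * fps_deriv (fps_X ^ a) = - g"
    unfolding field_coeff_def by auto
qed

lemma field_coeff_y: "field_coeff * fps_deriv y = f - w"
proof -
  have "fps_deriv (fps_X ^ a) * (field_coeff * fps_deriv y) = (field_coeff * fps_deriv (fps_X ^ a)) * fps_deriv y"
    by (simp only: mult_ac)
  also have "\<dots> = fps_deriv (fps_X ^ a) * (f - w)"
    unfolding field_coeff(2) using w(1) by (simp add: algebra_simps)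
  finally have "fps_deriv (fps_X ^ a) * (field_coeff * fps_deriv y) = fps_deriv (fps_X ^ a) * (f - w)" .
  moreover have "fps_deriv (fps_X ^ a) \<noteq> (0 :: 'a fps)"
    unfolding deriv_X_power using of_nat_a by simp
  ultimately show ?thesis by simp
qed

text \<open>
  If \<open>h' = p x' + q y'\<close>, then \<open>D h = -p g + q (f - w)\<close>: an element of the ring up to the error \<open>q w\<close>. If \<open>h\<close>
  has order greater than \<open>b\<close>, then comparing coefficients at \<open>t\<^sup>b\<^sup>-\<^sup>1\<close> shows \<open>q(0) = 0\<close>, so the error gains one order.
\<close>

lemma field_on_closed_alg:
  assumes h: "h \<in> C"
  shows "\<exists>P\<in>C. fps_X ^ k dvd field_coeff * fps_deriv h - P \<and>
     (fps_X ^ Suc b dvd h \<longrightarrow> fps_X ^ Suc b dvd P \<and> fps_X ^ Suc k dvd field_coeff * fps_deriv h - P)"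
proof -
  obtain p q where pq: "p \<in> C" "q \<in> C"
    and d: "fps_X ^ Suc k dvd fps_deriv h - (p * fps_deriv (fps_X ^ a) + q * fps_deriv y)"
    using closed_alg_deriv[OF h, of "Suc k"] by blast
  define P where "P = q * f - p * g"
  let ?R = "fps_deriv h - (p * fps_deriv (fps_X ^ a) + q * fps_deriv y)"
  have P: "P \<in> C" unfolding P_def using pq f g by (intro closed_alg_diff closed_alg_mult)
  have "field_coeff * fps_deriv h = p * (field_coeff * fps_deriv (fps_X ^ a)) + q * (field_coeff * fps_deriv y)
      + field_coeff * ?R"
    by (simp add: algebra_simps)
  then have eq: "field_coeff * fps_deriv h - P = field_coeff * ?R - q * w"
    unfolding field_coeff(2) field_coeff_y P_def by (simp add: algebra_simps)
  have R: "fps_X ^ Suc k dvd field_coeff * ?R" using d by (rule dvd_mult)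
  have 1: "fps_X ^ k dvd field_coeff * fps_deriv h - P"
    unfolding eq by (rule dvd_diff[OF power_le_dvd[OF R] dvd_mult[OF w(2)]]) simp
  moreover have "fps_X ^ Suc b dvd P \<and> fps_X ^ Suc k dvd field_coeff * fps_deriv h - P" if hb: "fps_X ^ Suc b dvd h"
  proof -
    have b1: "b - 1 < b" using ab by simp
    have "fps_nth (fps_deriv h) (b - 1) = 0"
      using X_power_dvd_nth[OF X_power_dvd_deriv[OF hb], of "b - 1"] b1 by simp
    moreover have "fps_nth ?R (b - 1) = 0"
      using X_power_dvd_nth[OF d, of "b - 1"] k b1 by linarith
    moreover have "fps_nth (p * fps_deriv (fps_X ^ a)) (b - 1) = 0"
    proof -
      have "p * fps_deriv (fps_X ^ a) = fps_const (of_nat a) * (fps_X ^ (a - 1) * p)"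
        unfolding deriv_X_power by (simp only: mult_ac)
      moreover have "fps_nth p (b - 1 - (a - 1)) = 0"
      proof (rule closed_alg_low_coeff[OF monic_order_dvd[OF y] pq(1)])
        show "b - 1 - (a - 1) < b" using ab by simp
        show "\<not> a dvd b - 1 - (a - 1)"
          using ab dvd_diffD[of a b a] by auto
      qed
      ultimately show ?thesis by (simp only: fps_mult_left_const_nth fps_X_power_mult_nth) simp
    qed
    moreover have "fps_nth (q * fps_deriv y) (b - 1) = fps_nth q 0 * of_nat b"
      using mult_nth_leading[of 0 q "b - 1" "fps_deriv y"] deriv_leading[OF y] ab by simp
    ultimately have "fps_nth q 0 = 0" using of_nat_b by (simp del: fps_deriv_nth)
    then have "fps_X ^ 1 dvd q" unfolding X_power_dvd_iff by simp
    then have "fps_X ^ (1 + k) dvd q * w" using w(2) by (rule X_power_dvd_mult)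
    then have 2: "fps_X ^ Suc k dvd field_coeff * fps_deriv h - P"
      unfolding eq using R by (intro dvd_diff) simp_all
    have "fps_X ^ Suc b dvd field_coeff * fps_deriv h"
      using derivation_raises[OF field_coeff(1) hb] by (rule power_le_dvd) simp
    then have "fps_X ^ Suc b dvd P"
      using X_power_dvd_cong[OF power_le_dvd[OF 2, of "Suc b"]] k by simp
    with 2 show ?thesis by blast
  qed
  ultimately show ?thesis using P by blast
qed

text \<open>
  The two kinds of approximation that \<open>D\<close> preserves: modulo \<open>O(k)\<close> by arbitrary elements of the ring, and
  modulo \<open>O(k+1)\<close> by elements of order greater than \<open>b\<close>. The first is good enough for \<open>x\<close>, the second is needed for \<open>y\<close>.
\<close>

definition "ring_approx = {h. \<exists>P\<in>C. fps_X ^ k dvd h - P}"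
definition "ring_approx_high = {h. \<exists>P\<in>C. fps_X ^ Suc b dvd P \<and> fps_X ^ Suc k dvd h - P}"

lemma ring_approx_field: "h \<in> ring_approx \<Longrightarrow> fps_const s * (field_coeff * fps_deriv h) \<in> ring_approx"
proof -
  assume "h \<in> ring_approx"
  then obtain P where P: "P \<in> C" "fps_X ^ k dvd h - P" unfolding ring_approx_def by blast
  obtain Q where Q: "Q \<in> C" "fps_X ^ k dvd field_coeff * fps_deriv P - Q"
    using field_on_closed_alg[OF P(1)] by blast
  have "fps_X ^ k dvd field_coeff * fps_deriv (h - P)"
    using derivation_raises[OF field_coeff(1) P(2)] by (rule power_le_dvd) simp
  then have "fps_X ^ k dvd field_coeff * fps_deriv h - field_coeff * fps_deriv P"
    by (simp add: right_diff_distrib)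
  from dvd_mult[OF X_power_dvd_diff_trans[OF this Q(2)], of "fps_const s"]
  have "fps_X ^ k dvd fps_const s * (field_coeff * fps_deriv h) - fps_const s * Q"
    by (simp add: right_diff_distrib)
  then show ?thesis unfolding ring_approx_def using closed_alg_scale[OF Q(1), of s] by blast
qed

lemma ring_approx_high_field: "h \<in> ring_approx_high \<Longrightarrow> fps_const s * (field_coeff * fps_deriv h) \<in> ring_approx_high"
proof -
  assume "h \<in> ring_approx_high"
  then obtain P where P: "P \<in> C" "fps_X ^ Suc b dvd P" "fps_X ^ Suc k dvd h - P" unfolding ring_approx_high_def by blast
  obtain Q where Q: "Q \<in> C" "fps_X ^ Suc b dvd Q" "fps_X ^ Suc k dvd field_coeff * fps_deriv P - Q"
    using field_on_closed_alg[OF P(1)] P(2) by blast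
  have "fps_X ^ Suc k dvd field_coeff * fps_deriv (h - P)"
    using derivation_raises[OF field_coeff(1) P(3)] by (rule power_le_dvd) simp
  then have "fps_X ^ Suc k dvd field_coeff * fps_deriv h - field_coeff * fps_deriv P"
    by (simp add: right_diff_distrib)
  from dvd_mult[OF X_power_dvd_diff_trans[OF this Q(3)], of "fps_const s"]
  have "fps_X ^ Suc k dvd fps_const s * (field_coeff * fps_deriv h) - fps_const s * Q"
    by (simp add: right_diff_distrib)
  then show ?thesis unfolding ring_approx_high_def using closed_alg_scale[OF Q(1), of s] dvd_mult[OF Q(2)] by blast
qed

lemma ring_approx_add: "h \<in> ring_approx \<Longrightarrow> h' \<in> ring_approx \<Longrightarrow> h + h' \<in> ring_approx"
proof -
  assume "h \<in> ring_approx" "h' \<in> ring_approx"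
  then obtain P Q where "P \<in> C" "fps_X ^ k dvd h - P" "Q \<in> C" "fps_X ^ k dvd h' - Q"
    unfolding ring_approx_def by blast
  then show ?thesis unfolding ring_approx_def
    by (intro CollectI bexI[of _ "P + Q"] closed_alg_add) (simp_all add: add_diff_add)
qed

lemma ring_approx_high_add: "h \<in> ring_approx_high \<Longrightarrow> h' \<in> ring_approx_high \<Longrightarrow> h + h' \<in> ring_approx_high"
proof -
  assume "h \<in> ring_approx_high" "h' \<in> ring_approx_high"
  then obtain P Q where "P \<in> C" "fps_X ^ Suc b dvd P" "fps_X ^ Suc k dvd h - P"
    "Q \<in> C" "fps_X ^ Suc b dvd Q" "fps_X ^ Suc k dvd h' - Q"
    unfolding ring_approx_high_def by blast
  then show ?thesis unfolding ring_approx_high_def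
    by (intro CollectI bexI[of _ "P + Q"] closed_alg_add conjI) (simp_all add: add_diff_add)
qed

lemma ring_approx_sum: "(\<And>i. i \<in> I \<Longrightarrow> F i \<in> ring_approx) \<Longrightarrow> sum F I \<in> ring_approx"
proof (induction I rule: infinite_finite_induct)
  case (insert i I) then show ?case by (simp add: ring_approx_add)
qed (auto simp: ring_approx_def intro!: bexI[of _ 0] closed_alg_0)

lemma ring_approx_high_sum: "(\<And>i. i \<in> I \<Longrightarrow> F i \<in> ring_approx_high) \<Longrightarrow> sum F I \<in> ring_approx_high"
proof (induction I rule: infinite_finite_induct)
  case (insert i I) then show ?case by (simp add: ring_approx_high_add)
qed (auto simp: ring_approx_high_def intro!: bexI[of _ 0] closed_alg_0)

definition "T = trunc_exp field_coeff (Suc k)"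

lemma T_x: "\<exists>P\<in>C. fps_X ^ k dvd T (fps_X ^ a) - P"
proof -
  have "divided_pow field_coeff n (fps_X ^ a) \<in> ring_approx" for n
  proof (induction n)
    case 0
    show ?case unfolding ring_approx_def using closed_alg_generators(1) by (auto intro!: bexI[of _ "fps_X ^ a"])
  qed (auto simp del: of_nat_Suc intro: ring_approx_field)
  then have "T (fps_X ^ a) \<in> ring_approx" unfolding T_def trunc_exp_def by (intro ring_approx_sum)
  then show ?thesis unfolding ring_approx_def by blast
qed

lemma T_y: "\<exists>F\<in>C. fps_X ^ Suc b dvd F \<and> fps_X ^ Suc k dvd T y - (y + F - w)"
proof -
  obtain m where "k = Suc m" using k by (cases k) auto
  then have m: "Suc k = Suc (Suc m)" by simp
  have fS: "f \<in> ring_approx_high" unfolding ring_approx_high_def using f by (auto intro!: bexI[of _ f])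
  \<comment> \<open>\<open>f - w\<close> itself is not of the second kind, but its image under \<open>D\<close> is, since \<open>D w\<close> is in \<open>O(k+1)\<close>.\<close>
  have wS: "fps_const s * (field_coeff * fps_deriv w) \<in> ring_approx_high" for s
    unfolding ring_approx_high_def using dvd_mult[OF derivation_raises[OF field_coeff(1) w(2)], of "fps_const s"]
    by (intro CollectI bexI[of _ 0]) (simp_all add: closed_alg_0)
  have 1: "divided_pow field_coeff (Suc 0) y = f - w" by (simp add: field_coeff_y)
  have "divided_pow field_coeff (Suc (Suc n)) y \<in> ring_approx_high" for n
  proof (induction n)
    case 0
    have "fps_const (1 / of_nat (Suc (Suc 0))) * (field_coeff * fps_deriv f) +
        fps_const (- 1 / of_nat (Suc (Suc 0))) * (field_coeff * fps_deriv w) \<in> ring_approx_high" (is "?l \<in> _")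
      by (rule ring_approx_high_add[OF ring_approx_high_field[OF fS] wS])
    also have "?l = divided_pow field_coeff (Suc (Suc 0)) y"
      unfolding divided_pow.simps(2)[of _ "Suc 0"] 1
      by (simp add: right_diff_distrib del: of_nat_Suc flip: fps_const_neg)
    finally show ?case .
  next
    case (Suc n)
    from ring_approx_high_field[OF this] show ?case unfolding divided_pow.simps(2)[of _ "Suc (Suc n)"] .
  qed
  then have "(\<Sum>n<m. divided_pow field_coeff (Suc (Suc n)) y) \<in> ring_approx_high" by (intro ring_approx_high_sum)
  then have "(\<Sum>n<m. divided_pow field_coeff (Suc (Suc n)) y) + f \<in> ring_approx_high" by (rule ring_approx_high_add[OF _ fS])
  then obtain F where F: "F \<in> C" "fps_X ^ Suc b dvd F"
    "fps_X ^ Suc k dvd (\<Sum>n<m. divided_pow field_coeff (Suc (Suc n)) y) + f - F"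
    unfolding ring_approx_high_def by blast
  have "T y = y + (f - w) + (\<Sum>n<m. divided_pow field_coeff (Suc (Suc n)) y)"
    unfolding T_def trunc_exp_def m sum.lessThan_Suc_shift 1[symmetric]
    by (simp del: divided_pow.simps(2) add: add_ac)
  then have eq: "T y - (y + F - w) = (\<Sum>n<m. divided_pow field_coeff (Suc (Suc n)) y) + f - F"
    by simp
  show ?thesis by (rule bexI[OF _ F(1)]) (simp only: eq F simp_thms)
qed

text \<open>
  The exponential of \<open>D\<close> supplies a parameter \<open>\<tau>0\<close> with \<open>\<tau>0\<^sup>a\<close> in \<open>C + O(k)\<close> and \<open>y(\<tau>0) = Y - w + O(k+1)\<close>, \<open>Y\<close> in \<open>C\<close>.
  Replacing \<open>\<tau>0\<close> by a root \<open>\<tau>\<close> with \<open>\<tau>\<^sup>a\<close> in \<open>C\<close> moves it in \<open>O(k+1-a)\<close> only, which changes \<open>y(\<tau>0)\<close> in \<open>O(k+b-a)\<close>,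
  that is, beyond \<open>t\<^sup>k\<close>. The new curve \<open>z\<close> is \<open>Y\<close> expressed in the parameter \<open>\<tau>\<close>.
\<close>

theorem shift_coefficient:
  "\<exists>z. curve_equiv a y z \<and> monic_order b z \<and>
       fps_X ^ Suc k dvd z - (y + fps_const (fps_nth w k) * fps_X ^ k)"
proof -
  have nz: "of_nat n \<noteq> (0::'a)" if "0 < n" "n < Suc k" for n using nonzero that by simp
  define \<tau>0 where "\<tau>0 = T fps_X"
  have \<tau>0: "monic_order 1 \<tau>0"
    unfolding monic_order_def \<tau>0_def T_def
    using trunc_exp_leading[OF field_coeff(1), of 1 fps_X "Suc k"] by simp
  have comp: "fps_X ^ Suc k dvd T h - (h oo \<tau>0)" for h
    unfolding T_def \<tau>0_def by (intro trunc_exp_eq_compose field_coeff(1) nz) auto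
  obtain U where U: "U \<in> C" "fps_X ^ k dvd T (fps_X ^ a) - U" using T_x by blast
  obtain F where F: "F \<in> C" "fps_X ^ Suc b dvd F" "fps_X ^ Suc k dvd T y - (y + F - w)"
    using T_y by blast
  have "fps_X ^ k dvd T (fps_X ^ a) - \<tau>0 ^ a"
    using power_le_dvd[OF comp[of "fps_X ^ a"], of k]
    by (simp add: fps_X_power_compose[OF monic_order_1D(1)[OF \<tau>0]])
  then have "fps_X ^ k dvd U - \<tau>0 ^ a"
    by (rule X_power_dvd_diff_trans[OF X_power_dvd_diff_sym[OF U(2)]])
  then obtain \<tau> where \<tau>: "monic_order 1 \<tau>" "fps_X ^ (k + c) dvd U - \<tau> ^ a" "fps_X ^ (k + 1 - a) dvd \<tau> - \<tau>0"
    using approximate_root[OF ab(1) of_nat_a \<tau>0, of k U c] ab k by auto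
  have "U - \<tau> ^ a \<in> C" by (intro conductor power_le_dvd[OF \<tau>(2)]) simp
  then have root: "\<tau> ^ a \<in> C" using closed_alg_diff[OF U(1)] by fastforce
  define Y where "Y = y + F"
  have Y: "Y \<in> C" unfolding Y_def by (intro closed_alg_add closed_alg_generators F)
  define z where "z = Y oo fps_inv \<tau>"
  have z: "z oo \<tau> = Y"
    unfolding z_def by (rule fps_compose_fps_inv_cancel(1)[OF monic_order_1D[OF \<tau>(1)]])
  have "closed_alg (\<tau> ^ a) Y = C"
  proof (rule closed_alg_perturb[OF ab monic_order_X_power y root Y])
    show "fps_X ^ Suc a dvd \<tau> ^ a - fps_X ^ a"
      using monic_order_power[OF \<tau>(1), of a] unfolding monic_order_def by simp
    show "fps_X ^ Suc b dvd Y - y" unfolding Y_def using F(2) by simp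
  qed
  then have equiv: "curve_equiv a y z"
    unfolding curve_equiv_def using \<tau>(1) z by blast
  define e where "e = fps_const (fps_nth w k)"
  have "fps_X ^ Suc k dvd (y oo \<tau>) - (y oo \<tau>0)"
    using power_le_dvd[OF compose_diff_monic_dvd[OF \<tau>(1) \<tau>0 \<tau>(3) monic_order_dvd[OF y]], of "Suc k"] ab k
    by auto
  from X_power_dvd_diff_trans[OF this X_power_dvd_diff_sym[OF comp]]
  have 1: "fps_X ^ Suc k dvd (y oo \<tau>) - (y + F - w)"
    using X_power_dvd_diff_trans[OF _ F(3)] by blast
  have 2: "fps_X ^ Suc k dvd w - e * fps_X ^ k"
    using w(2) unfolding e_def X_power_dvd_Suc_iff by (auto simp: X_power_dvd_iff)
  have 3: "fps_X ^ Suc k dvd e * \<tau> ^ k - e * fps_X ^ k"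
    unfolding right_diff_distrib[symmetric]
    using monic_order_power[OF \<tau>(1), of k] unfolding monic_order_def by (intro dvd_mult) simp
  have "(z - (y + e * fps_X ^ k)) oo \<tau> = Y - ((y oo \<tau>) + e * \<tau> ^ k)"
    unfolding fps_compose_sub_distrib fps_compose_add_distrib
      fps_compose_mult_distrib[OF monic_order_1D(1)[OF \<tau>(1)]] fps_X_power_compose[OF monic_order_1D(1)[OF \<tau>(1)]] z e_def
    by simp
  also have "\<dots> = (w - e * fps_X ^ k) - ((y oo \<tau>) - (y + F - w)) - (e * \<tau> ^ k - e * fps_X ^ k)"
    unfolding Y_def by simp
  finally have "fps_X ^ Suc k dvd (z - (y + e * fps_X ^ k)) oo \<tau>"
    using dvd_diff[OF dvd_diff[OF 2 1] 3] by (simp only:)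
  then have zk: "fps_X ^ Suc k dvd z - (y + e * fps_X ^ k)"
    unfolding X_power_dvd_compose_iff[OF \<tau>(1)] .
  have "fps_X ^ Suc b dvd (z - (y + e * fps_X ^ k)) + e * fps_X ^ k"
  proof (intro dvd_add power_le_dvd[OF zk] dvd_mult)
    show "Suc b \<le> Suc k" using k by simp
    show "fps_X ^ Suc b dvd (fps_X ^ k :: 'a fps)" using k by (intro le_imp_power_dvd) simp
  qed
  then have "monic_order b z" using monic_order_cong[OF y, of z] by simp
  with equiv zk show ?thesis unfolding e_def by blast
qed

end

section \<open>Expansion in the deviation from a monomial curve\<close>

definition in_monoid :: "nat \<Rightarrow> nat \<Rightarrow> nat \<Rightarrow> bool" where
  "in_monoid a b n \<longleftrightarrow> (\<exists>i j. n = a * i + b * j)"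

lemma in_monoid_add: "in_monoid a b n \<Longrightarrow> in_monoid a b (n + a)" "in_monoid a b n \<Longrightarrow> in_monoid a b (n + b)"
  unfolding in_monoid_def by (metis add.assoc add.commute mult_Suc_right)+

lemma power_perturb_dvd:
  fixes z :: "'a::field fps"
  assumes "fps_X ^ k dvd z" "b \<le> k"
  shows "fps_X ^ (k + b * j) dvd (fps_X ^ b + z) ^ Suc j - fps_X ^ (b * Suc j)"
proof (induction j)
  case 0
  then show ?case using assms by simp
next
  case (Suc j)
  let ?y = "fps_X ^ b + z"
  have y: "fps_X ^ b dvd ?y" using power_le_dvd[OF assms] by simp
  have "fps_X ^ (b + (k + b * j)) dvd ?y * (?y ^ Suc j - fps_X ^ (b * Suc j))"
    by (rule X_power_dvd_mult[OF y Suc])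
  moreover have "fps_X ^ (k + b * Suc j) dvd z * fps_X ^ (b * Suc j)"
    by (rule X_power_dvd_mult[OF assms(1)]) simp
  ultimately have "fps_X ^ (k + b * Suc j) dvd ?y * (?y ^ Suc j - fps_X ^ (b * Suc j)) + z * fps_X ^ (b * Suc j)"
    by (intro dvd_add) (simp_all add: add_ac)
  also have "\<dots> = ?y ^ Suc (Suc j) - fps_X ^ b * fps_X ^ (b * Suc j)"
    by (simp add: algebra_simps)
  finally show ?case by (simp flip: power_add)
qed

lemma monomial_expansion:
  fixes z :: "'a::field fps" and a b k i j :: nat
  assumes ab: "0 < a" "a < b" "\<not> a dvd b" and z: "fps_X ^ k dvd z" "b < k"
  defines "H \<equiv> fps_X ^ (a * i + b * j) :: 'a fps"
  shows "fps_X ^ Suc (k + a) dvd (fps_X ^ a) ^ i * (fps_X ^ b + z) ^ j -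
     (H + (fps_const (fps_nth H b) + fps_const (fps_nth H (a + b)) * fps_X ^ a) * z)"
proof -
  have nd: "a * m \<noteq> b" "a * m \<noteq> a + b" for m
    using ab(3) dvd_triv_left[of a m] by (metis, metis dvd_add_right_iff dvd_refl)
  consider "j = 0" | "j = 1" "i = 0" | "j = 1" "i = 1" | "j = 1" "2 \<le> i" | j' where "j = Suc (Suc j')"
    by (metis One_nat_def Suc_1 Suc_leI le_neq_implies_less less_one linorder_not_less nat.exhaust)
  then show ?thesis
  proof cases
    case 1
    then have "fps_nth H b = 0" "fps_nth H (a + b) = 0" using nd[of i] by (auto simp: H_def)
    then show ?thesis using 1 by (simp add: H_def power_mult)
  next
    case 2
    then show ?thesis using ab by (simp add: H_def)
  next
    case 3
    then have "fps_nth H b = 0" "fps_nth H (a + b) = 1" using ab by (auto simp: H_def)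
    moreover have "(fps_X ^ a) ^ i * (fps_X ^ b + z) ^ j = H + fps_X ^ a * z"
      using 3 by (simp add: H_def power_add distrib_left)
    ultimately show ?thesis by simp
  next
    case 4
    then have "a * i \<noteq> 0" "a * i \<noteq> a" using ab(1) by auto
    then have "fps_nth H b = 0" "fps_nth H (a + b) = 0" using 4 by (auto simp: H_def)
    then have E: "H + (fps_const (fps_nth H b) + fps_const (fps_nth H (a + b)) * fps_X ^ a) * z = H" by simp
    have eq: "(fps_X ^ a) ^ i * (fps_X ^ b + z) ^ j - H = fps_X ^ (a * i) * z"
      using 4 by (simp add: H_def power_add power_mult algebra_simps)
    have d: "fps_X ^ (a * i + k) dvd fps_X ^ (a * i) * z"
      using z(1) by (intro X_power_dvd_mult) auto
    have "a * 2 \<le> a * i" using 4 by (intro mult_le_mono2)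
    then have le: "Suc (k + a) \<le> a * i + k" using ab by linarith
    show ?thesis unfolding E eq by (rule power_le_dvd[OF d le])
  next
    case 5
    then have "b < a * i + b * j" "a + b < a * i + b * j" using ab by auto
    then have "fps_nth H b = 0" "fps_nth H (a + b) = 0" by (auto simp: H_def)
    then have E: "H + (fps_const (fps_nth H b) + fps_const (fps_nth H (a + b)) * fps_X ^ a) * z = H" by simp
    have eq: "(fps_X ^ a) ^ i * (fps_X ^ b + z) ^ j - H =
        fps_X ^ (a * i) * ((fps_X ^ b + z) ^ j - fps_X ^ (b * j))"
      by (simp add: H_def power_add right_diff_distrib flip: power_mult)
    have d: "fps_X ^ (k + b * Suc j') dvd fps_X ^ (a * i) * ((fps_X ^ b + z) ^ j - fps_X ^ (b * j))"
      using power_perturb_dvd[OF z(1), of b "Suc j'"] z(2) 5 by (intro dvd_mult) simp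
    have le: "Suc (k + a) \<le> k + b * Suc j'" using ab by simp
    show ?thesis unfolding E eq by (rule power_le_dvd[OF d le])
  qed
qed

text \<open>
  For a polynomial \<open>P\<close> the value \<open>P(t\<^sup>a, t\<^sup>b + z)\<close> is \<open>P(t\<^sup>a, t\<^sup>b) + P\<^sub>y(t\<^sup>a, t\<^sup>b) z\<close> up to \<open>z\<^sup>2\<close>. Here
  \<open>H = P(t\<^sup>a, t\<^sup>b)\<close> has exponents in the monoid generated by \<open>a\<close> and \<open>b\<close>, and its coefficients at \<open>t\<^sup>b\<close> and \<open>t\<^sup>a\<^sup>+\<^sup>b\<close>
  are those of the monomials \<open>y\<close> and \<open>x y\<close>, which determine \<open>P\<^sub>y(t\<^sup>a, t\<^sup>b)\<close> up to order \<open>a\<close>.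
\<close>

lemma closed_alg_expansion:
  fixes z h :: "'a::field fps"
  assumes ab: "0 < a" "a < b" "\<not> a dvd b" and z: "fps_X ^ k dvd z" "b < k"
    and h: "h \<in> closed_alg (fps_X ^ a) (fps_X ^ b + z)"
  obtains H where "\<And>n. fps_nth H n \<noteq> 0 \<Longrightarrow> in_monoid a b n"
    and "fps_X ^ Suc (k + a) dvd h - (H + (fps_const (fps_nth H b) + fps_const (fps_nth H (a + b)) * fps_X ^ a) * z)"
proof -
  define E where "E H = H + (fps_const (fps_nth H b) + fps_const (fps_nth H (a + b)) * fps_X ^ a) * z" for H
  obtain P where P: "P \<in> poly_alg (fps_X ^ a) (fps_X ^ b + z)" "fps_X ^ Suc (k + a) dvd h - P"
    using closed_algE[OF h] by blast
  have "\<exists>H. (\<forall>n. fps_nth H n \<noteq> 0 \<longrightarrow> in_monoid a b n) \<and> fps_X ^ Suc (k + a) dvd P - E H"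
    using P(1)
  proof (induction rule: poly_alg_induct)
    case zero
    show ?case by (rule exI[of _ 0]) (simp add: E_def)
  next
    case (step c i j f)
    then obtain H where H: "\<And>n. fps_nth H n \<noteq> 0 \<Longrightarrow> in_monoid a b n" "fps_X ^ Suc (k + a) dvd f - E H" by blast
    let ?m = "(fps_X ^ a) ^ i * (fps_X ^ b + z) ^ j" and ?H = "fps_X ^ (a * i + b * j) :: 'a fps"
    have "fps_X ^ Suc (k + a) dvd fps_const c * (?m - E ?H) + (f - E H)"
      using monomial_expansion[OF ab z, of i j] H(2) unfolding E_def by (intro dvd_add dvd_mult)
    also have "\<dots> = (fps_const c * ?m + f) - E (fps_const c * ?H + H)"
      unfolding E_def by (simp add: algebra_simps flip: fps_const_add fps_const_mult)
    finally show ?case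
      using H(1) by (intro exI[of _ "fps_const c * ?H + H"]) (auto simp: in_monoid_def split: if_splits)
  qed
  then obtain H where "\<And>n. fps_nth H n \<noteq> 0 \<Longrightarrow> in_monoid a b n" "fps_X ^ Suc (k + a) dvd P - E H" by blast
  then show ?thesis
    using that X_power_dvd_diff_trans[OF P(2)] unfolding E_def by blast
qed

lemma expansion_coeffs:
  fixes z h :: "'a::field fps"
  assumes ab: "0 < a" "a < b" "\<not> a dvd b" and z: "fps_X ^ k dvd z" "b < k"
    and h: "h \<in> closed_alg (fps_X ^ a) (fps_X ^ b + z)"
  shows "n < k \<Longrightarrow> \<not> in_monoid a b n \<Longrightarrow> fps_nth h n = 0"
    and "\<not> in_monoid a b k \<Longrightarrow> fps_nth h k = fps_nth h b * fps_nth z k"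
proof -
  obtain H where H: "\<And>n. fps_nth H n \<noteq> 0 \<Longrightarrow> in_monoid a b n"
    "fps_X ^ Suc (k + a) dvd h - (H + (fps_const (fps_nth H b) + fps_const (fps_nth H (a + b)) * fps_X ^ a) * z)"
    using closed_alg_expansion[OF assms] by blast
  let ?G = "fps_const (fps_nth H b) + fps_const (fps_nth H (a + b)) * fps_X ^ a"
  have G: "fps_nth ?G 0 = fps_nth H b" using ab by simp
  have eq: "fps_nth h m = fps_nth H m + fps_nth (?G * z) m" if "m \<le> k" for m
    using X_power_dvd_nth[OF H(2), of m] that by simp
  have low: "fps_nth (?G * z) m = 0" if "m < k" for m
    by (rule X_power_dvd_nth[OF dvd_mult[OF z(1)] that])
  have top: "fps_nth (?G * z) k = fps_nth H b * fps_nth z k"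
    using mult_nth_leading[of 0 ?G k z] z(1) G by simp
  show "fps_nth h n = 0" if "n < k" "\<not> in_monoid a b n"
    using eq[of n] low[of n] that H(1)[of n] by auto
  show "fps_nth h k = fps_nth h b * fps_nth z k" if "\<not> in_monoid a b k"
    using eq[of k] eq[of b] low[of b] top that H(1)[of k] z(2) by auto
qed

text \<open>
  An element of order greater than \<open>b\<close> has no term \<open>y\<close>, and no term \<open>x y\<close> either if its order is even greater
  than \<open>a + b\<close>. Then the expansion agrees with \<open>H\<close> up to order \<open>k + a\<close>.
\<close>

lemma order_in_monoid:
  fixes z h :: "'a::field fps"
  assumes ab: "0 < a" "a < b" "\<not> a dvd b" and z: "fps_X ^ k dvd z" "b < k"
    and h: "h \<in> closed_alg (fps_X ^ a) (fps_X ^ b + z)" "h \<noteq> 0" "subdegree h \<le> k + a" "b < subdegree h" "subdegree h \<noteq> a + b"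
  shows "in_monoid a b (subdegree h)"
proof -
  let ?n = "subdegree h"
  obtain H where H: "\<And>n. fps_nth H n \<noteq> 0 \<Longrightarrow> in_monoid a b n"
    "fps_X ^ Suc (k + a) dvd h - (H + (fps_const (fps_nth H b) + fps_const (fps_nth H (a + b)) * fps_X ^ a) * z)"
    using closed_alg_expansion[OF ab z h(1)] by blast
  let ?G = "fps_const (fps_nth H b) + fps_const (fps_nth H (a + b)) * fps_X ^ a"
  have eq: "fps_nth h m = fps_nth H m + fps_nth (?G * z) m" if "m \<le> k + a" for m
    using X_power_dvd_nth[OF H(2), of m] that by simp
  have "fps_nth (?G * z) b = 0"
    by (rule X_power_dvd_nth[OF dvd_mult[OF z(1)] z(2)])
  moreover have "fps_nth h b = 0" using h(4) by (rule nth_less_subdegree_zero)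
  ultimately have Hb: "fps_nth H b = 0" using eq[of b] z(2) by simp
  have d: "fps_X ^ (a + k) dvd ?G * z"
    unfolding Hb using z(1) by (intro X_power_dvd_mult) simp_all
  show ?thesis
  proof (cases "?n < k + a")
    case True
    then have "fps_nth (?G * z) ?n = 0" using X_power_dvd_nth[OF d] by simp
    then have "fps_nth H ?n \<noteq> 0" using eq[of ?n] True nth_subdegree_nonzero[OF h(2)] by simp
    then show ?thesis by (rule H(1))
  next
    case False
    then have n: "?n = k + a" using h(3) by simp
    have "fps_nth (?G * z) (a + b) = 0" using X_power_dvd_nth[OF d] z(2) by simp
    moreover have "fps_nth h (a + b) = 0" using n z(2) by (intro nth_less_subdegree_zero) simp
    ultimately have "fps_nth H (a + b) = 0" using eq[of "a + b"] z(2) by simp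
    then have "?G = 0" using Hb by simp
    then have "fps_nth H ?n \<noteq> 0" using eq[of ?n] n nth_subdegree_nonzero[OF h(2)] by simp
    then show ?thesis by (rule H(1))
  qed
qed

section \<open>Orders of differentials\<close>

lemma deriv_X_power_mult_nth:
  assumes "0 < a"
  shows "fps_nth (f * fps_deriv (fps_X ^ a)) (n + a - 1) = of_nat a * fps_nth (f :: 'a::field fps) n"
proof -
  have "f * fps_deriv (fps_X ^ a) = fps_const (of_nat a) * (fps_X ^ (a - 1) * f)"
    unfolding deriv_X_power by (simp only: mult_ac)
  then show ?thesis using assms by (simp only: fps_mult_left_const_nth fps_X_power_mult_nth) simp
qed

lemma deriv_X_power_mult_nth_low:
  assumes "n < a - 1"
  shows "fps_nth (f * fps_deriv (fps_X ^ a)) n = (0::'a::field)"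
proof -
  have "f * fps_deriv (fps_X ^ a) = fps_const (of_nat a) * (fps_X ^ (a - 1) * f)"
    unfolding deriv_X_power by (simp only: mult_ac)
  then show ?thesis using assms by (simp only: fps_mult_left_const_nth fps_X_power_mult_nth) simp
qed

locale plane_curve =
  fixes a b :: nat and y :: "'a::field fps"
  assumes ab: "0 < a" "a < b" "\<not> a dvd b" and y: "monic_order b y"
begin

abbreviation "C \<equiv> closed_alg (fps_X ^ a) y"
abbreviation "diff f g \<equiv> f * fps_deriv (fps_X ^ a) + g * fps_deriv y"

definition "z = y - fps_X ^ b"

lemma y_eq: "y = fps_X ^ b + z" by (simp add: z_def)

lemma z_dvd: "fps_X ^ Suc b dvd z"
  using y unfolding z_def monic_order_def .

lemma low_coeff: "h \<in> C \<Longrightarrow> i < b \<Longrightarrow> \<not> a dvd i \<Longrightarrow> fps_nth h i = 0"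
  by (rule closed_alg_low_coeff[OF monic_order_dvd[OF y]])

lemma deriv_y: "fps_X ^ (b - 1) dvd fps_deriv y" "fps_nth (fps_deriv y) (b - 1) = of_nat b"
  using deriv_leading[OF y] ab by auto

lemma diff_order_below_b:
  assumes "f \<in> C" "n < b - 1" "fps_nth (diff f g) n \<noteq> 0"
  shows "a dvd Suc n"
proof -
  have "fps_nth (g * fps_deriv y) n = 0"
    by (rule X_power_dvd_nth[OF dvd_mult[OF deriv_y(1)] assms(2)])
  then have nz: "fps_nth (f * fps_deriv (fps_X ^ a)) n \<noteq> 0" using assms(3) by simp
  then have "a - 1 \<le> n" using deriv_X_power_mult_nth_low[of n a f] by fastforce
  then obtain m where m: "n = m + a - 1" using that[of "n + 1 - a"] ab by simp
  then have "fps_nth f m \<noteq> 0" using nz deriv_X_power_mult_nth[OF ab(1), of f m] by auto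
  moreover have "m < b" using m assms(2) ab by simp
  ultimately have "a dvd m" using low_coeff[OF assms(1)] by blast
  then show ?thesis using m ab by simp
qed

lemma diff_const_zero:
  assumes fg: "f \<in> C" "g \<in> C" and b: "of_nat b \<noteq> (0::'a)" and w: "fps_nth (diff f g) (b - 1) = 0"
  shows "fps_nth g 0 = 0"
proof -
  have "fps_nth (f * fps_deriv (fps_X ^ a)) ((b - a) + a - 1) = 0"
    unfolding deriv_X_power_mult_nth[OF ab(1)]
    using low_coeff[OF fg(1), of "b - a"] ab dvd_diffD[of a b a] by auto
  then have "fps_nth (f * fps_deriv (fps_X ^ a)) (b - 1) = 0" using ab by simp
  moreover have "fps_nth (g * fps_deriv y) (0 + (b - 1)) = fps_nth g 0 * of_nat b"
    using mult_nth_leading[of 0 g "b - 1" "fps_deriv y"] deriv_y by simp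
  ultimately show ?thesis using w b by simp
qed

lemma closed_alg_dvd_a:
  assumes "g \<in> C" "fps_nth g 0 = 0"
  shows "fps_X ^ a dvd g"
  unfolding X_power_dvd_iff
proof (intro allI impI)
  fix i assume i: "i < a"
  show "fps_nth g i = 0"
  proof (cases "i = 0")
    case False
    then have "\<not> a dvd i" using i by (simp add: nat_dvd_not_less)
    then show ?thesis using low_coeff[OF assms(1), of i] i ab by simp
  qed (use assms in simp)
qed

text \<open>
  The coefficients of \<open>f x' + g y'\<close> below \<open>a + b - 1\<close> separate: those of \<open>f x'\<close> sit at \<open>a - 1\<close> plus multiples of
  \<open>a\<close>, while the constant term of \<open>g\<close> would be visible at \<open>b - 1\<close>.
\<close>

lemma diff_leading:
  assumes fg: "f \<in> C" "g \<in> C" and b: "of_nat a \<noteq> (0::'a)" "of_nat b \<noteq> (0::'a)"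
    and w: "fps_X ^ (a + b - 1) dvd diff f g"
  shows "fps_X ^ a dvd g" "fps_X ^ b dvd f"
    "fps_nth (diff f g) (a + b - 1) = of_nat a * fps_nth f b + of_nat b * fps_nth g a"
proof -
  have "fps_nth g 0 = 0"
    using diff_const_zero[OF fg b(2)] X_power_dvd_nth[OF w, of "b - 1"] ab by simp
  then show g: "fps_X ^ a dvd g" by (rule closed_alg_dvd_a[OF fg(2)])
  have gy: "fps_X ^ (a + (b - 1)) dvd g * fps_deriv y"
    by (rule X_power_dvd_mult[OF g deriv_y(1)])
  show "fps_X ^ b dvd f"
    unfolding X_power_dvd_iff
  proof (intro allI impI)
    fix i assume "i < b"
    then have "fps_nth (diff f g) (i + a - 1) = 0" "fps_nth (g * fps_deriv y) (i + a - 1) = 0"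
      using X_power_dvd_nth[OF w] X_power_dvd_nth[OF gy] ab by auto
    then show "fps_nth f i = 0" using deriv_X_power_mult_nth[OF ab(1), of f i] b(1) by simp
  qed
  have "fps_nth (g * fps_deriv y) (a + (b - 1)) = fps_nth g a * of_nat b"
    using mult_nth_leading[OF g deriv_y(1)] deriv_y(2) by simp
  moreover have "fps_nth (f * fps_deriv (fps_X ^ a)) (a + (b - 1)) = of_nat a * fps_nth f b"
    using deriv_X_power_mult_nth[OF ab(1), of f b] ab by (simp add: add.commute)
  ultimately show "fps_nth (diff f g) (a + b - 1) = of_nat a * fps_nth f b + of_nat b * fps_nth g a"
    using ab by (simp add: mult.commute)
qed

text \<open>
  Since \<open>q + a\<close> is outside the monoid, the monomial curve \<open>(t\<^sup>a, t\<^sup>b)\<close> contributes nothing at this place and only the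
  terms linear in \<open>z\<close> with the coefficients of \<open>y x'\<close> and \<open>x y'\<close> remain.
\<close>

lemma diff_coeff_first:
  assumes fg: "f \<in> C" "g \<in> C" and g: "fps_X ^ a dvd g" and q: "fps_X ^ q dvd z" "b < q" "\<not> in_monoid a b (q + a)"
  shows "fps_nth (diff f g) (q + a - 1) = fps_nth z q * (of_nat a * fps_nth f b + of_nat q * fps_nth g a)"
proof -
  have "\<not> in_monoid a b q" using q(3) in_monoid_add(1) by blast
  then have f: "fps_nth f q = fps_nth f b * fps_nth z q"
    using expansion_coeffs(2)[OF ab q(1,2), of f] fg(1) y_eq by simp
  have "\<not> in_monoid a b (q + a - b)" using q(2,3) in_monoid_add(2)[of a b "q + a - b"] by auto
  then have g0: "fps_nth g (q + a - b) = 0"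
    using expansion_coeffs(1)[OF ab q(1,2), of g "q + a - b"] fg(2) y_eq ab q(2) by simp
  have dy: "fps_deriv y = fps_const (of_nat b) * fps_X ^ (b - 1) + fps_deriv z"
    by (subst y_eq) (simp only: fps_deriv_add deriv_X_power)
  have "g * fps_deriv y = fps_const (of_nat b) * (fps_X ^ (b - 1) * g) + g * fps_deriv z"
    unfolding dy by (simp add: algebra_simps)
  moreover have "fps_nth (fps_const (of_nat b) * (fps_X ^ (b - 1) * g)) (q + a - 1) = 0"
    using g0 ab q(2) by (simp add: fps_X_power_mult_nth)
  moreover have "fps_nth (g * fps_deriv z) (a + (q - 1)) = fps_nth g a * fps_nth (fps_deriv z) (q - 1)"
    by (rule mult_nth_leading[OF g X_power_dvd_deriv[OF q(1)]])
  moreover have "fps_nth (fps_deriv z) (q - 1) = of_nat q * fps_nth z q"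
    using q(2) ab by simp
  moreover have "a + (q - 1) = q + a - 1" using q(2) by simp
  ultimately have "fps_nth (g * fps_deriv y) (q + a - 1) = fps_nth g a * (of_nat q * fps_nth z q)" by simp
  then show ?thesis
    using deriv_X_power_mult_nth[OF ab(1), of f q] f by (simp add: algebra_simps)
qed

text \<open>
  The coefficients at \<open>a + b - 1\<close> and \<open>q + a - 1\<close> give \<open>a f\<^sub>b + b g\<^sub>a = 0\<close> and \<open>a f\<^sub>b + q g\<^sub>a = 0\<close>, and \<open>q - b\<close> is nonzero in \<open>K\<close>.
\<close>

lemma diff_after_first:
  assumes fg: "f \<in> C" "g \<in> C" and nz: "of_nat a \<noteq> (0::'a)" "of_nat b \<noteq> (0::'a)" "of_nat (q - b) \<noteq> (0::'a)"
    and q: "fps_X ^ q dvd z" "b < q" "\<not> in_monoid a b (q + a)" "fps_nth z q \<noteq> 0"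
    and w: "fps_X ^ (q + a) dvd diff f g"
  shows "fps_X ^ Suc a dvd g" "fps_X ^ Suc b dvd f"
proof -
  have w': "fps_X ^ (a + b - 1) dvd diff f g" by (rule power_le_dvd[OF w]) (use q in simp)
  note l = diff_leading[OF fg nz(1,2) w']
  have 1: "of_nat a * fps_nth f b + of_nat b * fps_nth g a = 0"
    using l(3) X_power_dvd_nth[OF w, of "a + b - 1"] q(2) ab by simp
  have "fps_nth (diff f g) (q + a - 1) = 0" using X_power_dvd_nth[OF w, of "q + a - 1"] ab by simp
  then have 2: "of_nat a * fps_nth f b + of_nat q * fps_nth g a = 0"
    using diff_coeff_first[OF fg l(1) q(1-3)] q(4) by simp
  have "of_nat b * fps_nth g a = of_nat q * fps_nth g a"
    using 1 2 by (metis add_left_cancel)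
  then have "of_nat (q - b) * fps_nth g a = 0"
    using q(2) by (auto simp: of_nat_diff)
  then have ga: "fps_nth g a = 0" using nz(3) by simp
  then have "fps_nth f b = 0" using 1 nz(1) by simp
  then show "fps_X ^ Suc a dvd g" "fps_X ^ Suc b dvd f"
    using l(1,2) ga unfolding X_power_dvd_Suc_iff by auto
qed

lemma diff_first_nonzero:
  assumes fg: "f \<in> C" "g \<in> C" and nz: "of_nat a \<noteq> (0::'a)" "of_nat b \<noteq> (0::'a)"
    and q: "fps_X ^ q dvd z" "b < q" "\<not> in_monoid a b (q + a)"
    and w: "diff f g \<noteq> 0" "subdegree (diff f g) = q + a - 1"
  shows "fps_nth z q \<noteq> 0"
proof -
  have "fps_X ^ (q + a - 1) dvd diff f g"
    unfolding X_power_dvd_iff using nth_less_subdegree_zero w(2) by metis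
  then have "fps_X ^ (a + b - 1) dvd diff f g" by (rule power_le_dvd) (use q in simp)
  note l = diff_leading[OF fg nz this]
  show ?thesis
    using diff_coeff_first[OF fg l(1) q] nth_subdegree_nonzero[OF w(1)] w(2) by auto
qed

lemma diff_order_above_b:
  assumes fg: "f \<in> C" "g \<in> C" and nz: "of_nat b \<noteq> (0::'a)"
    and w: "diff f g \<noteq> 0" "b - 1 < subdegree (diff f g)" "subdegree (diff f g) < a + b - 1"
  shows "a dvd Suc (subdegree (diff f g))"
proof -
  let ?n = "subdegree (diff f g)"
  have "fps_nth g 0 = 0"
    by (rule diff_const_zero[OF fg nz]) (rule nth_less_subdegree_zero[OF w(2)])
  then have "fps_X ^ (a + (b - 1)) dvd g * fps_deriv y"
    by (intro X_power_dvd_mult closed_alg_dvd_a fg deriv_y)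
  then have "fps_nth (g * fps_deriv y) ?n = 0" by (rule X_power_dvd_nth) (use w(3) ab in simp)
  moreover obtain m where m: "?n = m + a - 1" using that[of "?n + 1 - a"] w(2) ab by simp
  ultimately have "fps_nth f m \<noteq> 0"
    using nth_subdegree_nonzero[OF w(1)] deriv_X_power_mult_nth[OF ab(1), of f m] by auto
  moreover have "m < b" using m w(3) ab by simp
  ultimately have "a dvd m" using low_coeff[OF fg(1)] by blast
  then show ?thesis using m ab by simp
qed

lemma monoid_values: "in_monoid a b n \<Longrightarrow> n \<in> value_set C"
proof -
  assume "in_monoid a b n"
  then obtain i j where n: "n = a * i + b * j" unfolding in_monoid_def by blast
  have "monic_order n ((fps_X ^ a) ^ i * y ^ j)"
    unfolding n by (intro monic_order_mult monic_order_power y monic_order_X_power)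
  then have "subdegree ((fps_X ^ a) ^ i * y ^ j) = n" "(fps_X ^ a) ^ i * y ^ j \<noteq> 0"
    by (auto simp: monic_order_iff intro!: subdegreeI simp del: mult_eq_0_iff power_eq_0_iff)
  then show ?thesis unfolding value_set_def using closed_alg_monomial by blast
qed

lemma diff_valueE:
  assumes "n \<in> value_set (module_diffs (fps_X ^ a) y)"
  obtains f g where "f \<in> C" "g \<in> C" "diff f g \<noteq> 0" "subdegree (diff f g) = n"
  using assms unfolding value_set_def module_diffs_def by blast

lemma small_diff_values:
  assumes b: "of_nat b \<noteq> (0::'a) \<or> Suc n < b" and n: "n \<in> value_set (module_diffs (fps_X ^ a) y)" "Suc n \<le> a + b"
  shows "Suc n \<in> value_set C"
proof -
  obtain f g where fg: "f \<in> C" "g \<in> C" and w: "diff f g \<noteq> 0" "subdegree (diff f g) = n"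
    using diff_valueE[OF n(1)] .
  have dvd: "in_monoid a b (Suc n)" if "a dvd Suc n"
    using that unfolding in_monoid_def dvd_def by (metis add_0_right mult_0_right)
  consider "n < b - 1" | "n = b - 1" | "n = a + b - 1" | "b - 1 < n" "n < a + b - 1"
    using n(2) by linarith
  then have "in_monoid a b (Suc n)"
  proof cases
    case 1
    then show ?thesis
      using diff_order_below_b[OF fg(1) 1, of g] nth_subdegree_nonzero[OF w(1)] w(2) dvd by blast
  next
    case 2
    then have "Suc n = a * 0 + b * 1" using ab by simp
    then show ?thesis unfolding in_monoid_def by blast
  next
    case 3
    then have "Suc n = a * 1 + b * 1" using ab by simp
    then show ?thesis unfolding in_monoid_def by blast
  next
    case 4
    then show ?thesis using diff_order_above_b[OF fg] w b dvd by auto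
  qed
  then show ?thesis by (rule monoid_values)
qed

text \<open>
  The Euler form \<open>x y' - (b/a) y x'\<close> vanishes on the monomial curve, and \<open>t\<^sup>q\<close> in \<open>y\<close> contributes \<open>(q - b) t\<^sup>q\<^sup>+\<^sup>a\<^sup>-\<^sup>1\<close>.
\<close>

lemma euler_value:
  assumes q: "fps_X ^ q dvd z" "b < q" "fps_nth z q \<noteq> 0" and nz: "of_nat a \<noteq> (0::'a)" "of_nat (q - b) \<noteq> (0::'a)"
  shows "q + a - 1 \<in> value_set (module_diffs (fps_X ^ a) y)"
proof -
  let ?f = "fps_const (- of_nat b / of_nat a) * y" and ?w = "fps_X ^ a * fps_deriv z - fps_const (of_nat b) * (fps_X ^ (a - 1) * z)"
  have x: "(fps_X ^ a :: 'a fps) = fps_X ^ (a - 1) * fps_X" using ab(1) by (metis power_minus_mult)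
  have b: "fps_X * fps_deriv (fps_X ^ b) = fps_const (of_nat b) * (fps_X ^ b :: 'a fps)"
  proof -
    have "fps_X * fps_X ^ (b - 1) = (fps_X ^ b :: 'a fps)" using ab by (metis less_trans power_minus_mult mult.commute)
    then show ?thesis unfolding deriv_X_power by (metis mult.left_commute)
  qed
  have c: "fps_const (- of_nat b / of_nat a) * fps_const (of_nat a) = (- fps_const (of_nat b) :: 'a fps)"
    using nz(1) by simp
  have "fps_X ^ a * fps_deriv y = fps_X ^ (a - 1) * (fps_X * fps_deriv y)"
    by (subst x) (simp only: mult_ac)
  moreover have "?f * fps_deriv (fps_X ^ a) =
      (fps_const (- of_nat b / of_nat a) * fps_const (of_nat a)) * (fps_X ^ (a - 1) * y)"
    unfolding deriv_X_power by (simp only: mult_ac)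
  ultimately have "diff ?f (fps_X ^ a) = (fps_const (- of_nat b / of_nat a) * fps_const (of_nat a)) * (fps_X ^ (a - 1) * y)
      + fps_X ^ (a - 1) * (fps_X * fps_deriv y)"
    by (simp only:)
  also have "\<dots> = - (fps_const (of_nat b) * (fps_X ^ (a - 1) * y)) + fps_X ^ (a - 1) * (fps_X * fps_deriv (fps_X ^ b) + fps_X * fps_deriv z)"
    unfolding c by (subst (2) y_eq) (simp only: fps_deriv_add distrib_left minus_mult_left)
  also have "\<dots> = ?w"
    unfolding b unfolding x by (subst y_eq) (simp add: algebra_simps)
  finally have eq: "diff ?f (fps_X ^ a) = ?w" .
  have q1: "a + (q - 1) = q + a - 1" "(a - 1) + q = q + a - 1" using ab q by auto
  have d1: "fps_X ^ (a + (q - 1)) dvd fps_X ^ a * fps_deriv z"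
    by (intro X_power_dvd_mult X_power_dvd_deriv q) simp
  have d2: "fps_X ^ ((a - 1) + q) dvd fps_X ^ (a - 1) * z"
    by (intro X_power_dvd_mult q) simp
  have "fps_X ^ (q + a - 1) dvd ?w"
    using d1 d2 dvd_mult unfolding q1 by (intro dvd_diff) blast+
  moreover have "fps_nth ?w (q + a - 1) = of_nat (q - b) * fps_nth z q"
  proof -
    have "fps_nth (fps_X ^ a * fps_deriv z) (a + (q - 1)) = of_nat q * fps_nth z q"
      using mult_nth_leading[of a "fps_X ^ a" "q - 1" "fps_deriv z"] X_power_dvd_deriv[OF q(1)] q(2) ab by simp
    moreover have "fps_nth (fps_X ^ (a - 1) * z) ((a - 1) + q) = fps_nth z q"
      using mult_nth_leading[of "a - 1" "fps_X ^ (a - 1)" q z] q(1) by simp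
    ultimately show ?thesis
      unfolding q1 using q(2) by (simp add: of_nat_diff algebra_simps)
  qed
  ultimately have "subdegree ?w = q + a - 1" "?w \<noteq> 0"
    using q(3) nz(2) by (auto intro!: subdegreeI simp: X_power_dvd_iff)
  moreover have "?w \<in> module_diffs (fps_X ^ a) y"
    unfolding eq[symmetric] module_diffs_def
    using closed_alg_generators[of y "fps_X ^ a"] closed_alg_generators[of "fps_X ^ a" y] closed_alg_scale by blast
  ultimately show ?thesis unfolding value_set_def mem_Collect_eq by metis
qed

end

section \<open>Elimination of all removable terms\<close>

text \<open>
  Here \<open>G\<close> is the semigroup, \<open>V\<close> the set of orders of differentials (so that \<open>\<Lambda>\<close> is \<open>V + 1\<close> together with 0) and \<open>l\<close>
  the Zariski number, described by the two properties of it that the elimination uses. All of these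
  data are shared by equivalent curves.
\<close>

locale plane_branch = plane_curve +
  fixes c :: nat and l :: enat and G V :: "nat set"
  assumes bc: "b < c"
    and nonzero: "\<And>n. 0 < n \<Longrightarrow> n < c \<Longrightarrow> of_nat n \<noteq> (0::'a)"
    and conductor: "\<And>h. fps_X ^ c dvd h \<Longrightarrow> h \<in> C"
    and G: "G = value_set C"
    and V: "V = value_set (module_diffs (fps_X ^ a) y)"
    and below_l: "\<And>k. b < k \<Longrightarrow> enat k < l \<Longrightarrow> k + a - 1 \<in> V \<Longrightarrow> k + a \<in> G"
    and at_l: "\<And>q. l = enat q \<Longrightarrow> b < q \<and> q + a - 1 \<in> V \<and> q + a \<notin> G"
begin

lemma nz: "of_nat a \<noteq> (0::'a)" "of_nat b \<noteq> (0::'a)"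
  using nonzero ab bc by auto

lemma equiv_branch:
  assumes "curve_equiv a y u" "monic_order b u"
  shows "plane_branch a b u c l G V"
proof -
  interpret u: plane_curve a b u by unfold_locales (use ab assms in auto)
  show ?thesis
    by unfold_locales
      (use bc nonzero curve_equiv_conductor[OF assms(1) conductor] below_l at_l
          G V curve_equiv_value_set[OF assms(1)] curve_equiv_diff_values[OF assms(1)] in auto)
qed

lemma l_less_conductor:
  assumes "l = enat q"
  shows "q + a < c"
proof (rule ccontr)
  assume "\<not> q + a < c"
  then have "fps_X ^ (q + a) \<in> C" by (intro conductor le_imp_power_dvd) simp
  then have "subdegree (fps_X ^ (q + a) :: 'a fps) \<in> G"
    unfolding G value_set_def by (intro CollectI exI conjI) (rule refl, simp_all)
  then show False using at_l[OF assms] by simp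
qed

lemma l_not_in_monoid: "l = enat q \<Longrightarrow> \<not> in_monoid a b (q + a)"
  using at_l monoid_values G by blast

lemma z_nth: "b < i \<Longrightarrow> fps_nth z i = fps_nth y i"
  by (simp add: z_def)

text \<open>
  The first term after \<open>t\<^sup>b\<close> would sit at an exponent \<open>q\<close> with \<open>q + a - 1\<close> in \<open>V\<close>, by the Euler form,
  and such exponents have been cleared.
\<close>

lemma first_coeff:
  assumes norm: "\<And>i. b < i \<Longrightarrow> i < k \<Longrightarrow> i + a - 1 \<in> V \<Longrightarrow> enat i \<noteq> l \<Longrightarrow> fps_nth y i = 0"
    and k: "k \<le> c" "enat k \<le> l"
  shows "fps_X ^ k dvd z"
proof (rule ccontr)
  assume "\<not> ?thesis"
  then have ex: "\<exists>i. i < k \<and> fps_nth z i \<noteq> 0" unfolding X_power_dvd_iff by blast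
  define q where "q = (LEAST i. i < k \<and> fps_nth z i \<noteq> 0)"
  have q: "q < k" "fps_nth z q \<noteq> 0" using LeastI_ex[OF ex] unfolding q_def by auto
  have "fps_nth z i = 0" if "i < q" for i
    using not_less_Least[of i "\<lambda>i. i < k \<and> fps_nth z i \<noteq> 0"] that q(1) unfolding q_def by auto
  then have d: "fps_X ^ q dvd z" unfolding X_power_dvd_iff by blast
  have bq: "b < q" using X_power_dvd_nth[OF z_dvd, of q] q(2) by force
  have "of_nat (q - b) \<noteq> (0::'a)" using nonzero[of "q - b"] bq q(1) k by simp
  then have "q + a - 1 \<in> V" unfolding V using euler_value[OF d bq q(2) nz(1)] by blast
  moreover have "enat q \<noteq> l" using q(1) k(2) by auto
  ultimately show False using norm[OF bq q(1)] q(2) z_nth[OF bq] by simp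
qed

lemma l_coeff_nonzero:
  assumes norm: "\<And>i. b < i \<Longrightarrow> i < q \<Longrightarrow> i + a - 1 \<in> V \<Longrightarrow> enat i \<noteq> l \<Longrightarrow> fps_nth y i = 0"
    and l: "l = enat q"
  shows "fps_nth y q \<noteq> 0"
proof -
  have q: "b < q" "q + a - 1 \<in> V" using at_l[OF l] by auto
  have d: "fps_X ^ q dvd z"
    by (rule first_coeff) (use l l_less_conductor[OF l] in \<open>auto intro: norm\<close>)
  obtain f g where "f \<in> C" "g \<in> C" "diff f g \<noteq> 0" "subdegree (diff f g) = q + a - 1"
    using diff_valueE[OF q(2)[unfolded V]] .
  then have "fps_nth z q \<noteq> 0"
    by (intro diff_first_nonzero[OF _ _ nz d q(1) l_not_in_monoid[OF l]])
  then show ?thesis unfolding z_nth[OF q(1)] .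
qed

text \<open>
  Before the Zariski exponent, \<open>k + a = a i + b j\<close>, and \<open>x\<^sup>i\<^sup>-\<^sup>1 y\<^sup>j x'\<close> or, for \<open>i = 0\<close>, \<open>y\<^sup>j\<^sup>-\<^sup>1 y'\<close> has the right order.
  After it, every differential of the right order qualifies.
\<close>

lemma eliminating_pair:
  assumes norm: "\<And>i. b < i \<Longrightarrow> i < k \<Longrightarrow> i + a - 1 \<in> V \<Longrightarrow> enat i \<noteq> l \<Longrightarrow> fps_nth y i = 0"
    and k: "b < k" "k < c" "k + a - 1 \<in> V" "enat k \<noteq> l"
  shows "\<exists>f g. f \<in> C \<and> g \<in> C \<and> fps_X ^ Suc b dvd f \<and> fps_X ^ Suc a dvd g \<and>
           fps_X ^ (k + a - 1) dvd diff f g \<and> fps_nth (diff f g) (k + a - 1) \<noteq> 0"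
proof (cases "enat k < l")
  case True
  have d: "fps_X ^ k dvd z"
    by (rule first_coeff) (use k True in \<open>auto intro: norm\<close>)
  have "k + a \<in> G" using below_l k True by blast
  then obtain h where h: "h \<in> C" "h \<noteq> 0" "subdegree h = k + a"
    unfolding G value_set_def by auto
  then have "in_monoid a b (subdegree h)"
    using order_in_monoid[OF ab d k(1), of h] y_eq k ab by simp
  then obtain i j where ij: "k + a = a * i + b * j" unfolding in_monoid_def h(3) by blast
  show ?thesis
  proof (cases i)
    case (Suc i')
    define f where "f = (fps_X ^ a) ^ i' * y ^ j"
    have "monic_order k f"
      using monic_order_mult[OF monic_order_power[OF monic_order_X_power, of a i'] monic_order_power[OF y, of j]]
        ij Suc unfolding f_def by simp
    note m = monic_order_dvd[OF this] this
    have "f \<in> C" unfolding f_def by (rule closed_alg_monomial)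
    moreover have "fps_X ^ Suc b dvd f" by (rule power_le_dvd[OF m(1)]) (use k in simp)
    moreover have "fps_X ^ (k + (a - 1)) dvd f * fps_deriv (fps_X ^ a)"
      by (intro X_power_dvd_mult m X_power_dvd_deriv) simp
    then have "fps_X ^ (k + a - 1) dvd diff f 0" using ab by simp
    moreover have "fps_nth (diff f 0) (k + a - 1) \<noteq> 0"
      using deriv_X_power_mult_nth[OF ab(1), of f k] m(2) nz(1) by (simp add: monic_order_iff)
    ultimately show ?thesis by (intro exI[of _ f] exI[of _ 0]) (simp add: closed_alg_0)
  next
    case 0
    have "j \<noteq> 0" using ij 0 ab by (intro notI) simp
    moreover have "j \<noteq> 1" using ij 0 k ab by auto
    ultimately obtain j' where j: "j = Suc (Suc j')" by (metis One_nat_def not0_implies_Suc)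
    define g where "g = y ^ Suc j'"
    have "monic_order (b * Suc j') g" unfolding g_def by (rule monic_order_power[OF y])
    note m = monic_order_dvd[OF this] this
    have kj: "k + a - 1 = b * Suc j' + (b - 1)" using ij 0 j ab by simp
    have "g \<in> C" unfolding g_def by (intro closed_alg_power closed_alg_generators)
    moreover have "fps_X ^ Suc a dvd g" by (rule power_le_dvd[OF m(1)]) (use ab in simp)
    moreover have "fps_X ^ (k + a - 1) dvd diff 0 g"
      using X_power_dvd_mult[OF m(1) deriv_y(1)] unfolding kj by simp
    moreover have "fps_nth (diff 0 g) (k + a - 1) \<noteq> 0"
      using mult_nth_leading[OF m(1) deriv_y(1)] m(2) deriv_y(2) nz(2) unfolding kj
      by (simp add: monic_order_iff)
    ultimately show ?thesis by (intro exI[of _ 0] exI[of _ g]) (simp add: closed_alg_0)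
  qed
next
  case False
  with k(4) obtain q where l: "l = enat q" and qk: "q < k" by (cases l) auto
  have bq: "b < q" using at_l[OF l] by blast
  have norm': "\<And>i. b < i \<Longrightarrow> i < q \<Longrightarrow> i + a - 1 \<in> V \<Longrightarrow> enat i \<noteq> l \<Longrightarrow> fps_nth y i = 0"
    using norm qk by simp
  have d: "fps_X ^ q dvd z"
    by (rule first_coeff) (use l l_less_conductor[OF l] in \<open>auto intro: norm'\<close>)
  have "fps_nth y q \<noteq> 0"
    by (rule l_coeff_nonzero[OF _ l]) (rule norm')
  then have nzq: "fps_nth z q \<noteq> 0" using z_nth[OF bq] by simp
  have qb: "of_nat (q - b) \<noteq> (0::'a)" using nonzero[of "q - b"] bq l_less_conductor[OF l] by simp
  obtain f g where fg: "f \<in> C" "g \<in> C" and w: "diff f g \<noteq> 0" "subdegree (diff f g) = k + a - 1"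
    using diff_valueE[OF k(3)[unfolded V]] .
  have dw: "fps_X ^ (k + a - 1) dvd diff f g"
    unfolding X_power_dvd_iff using nth_less_subdegree_zero w(2) by metis
  then have "fps_X ^ (q + a) dvd diff f g" by (rule power_le_dvd) (use qk in simp)
  note l2 = diff_after_first[OF fg nz qb d bq l_not_in_monoid[OF l] nzq this]
  show ?thesis using fg l2 dw nth_subdegree_nonzero[OF w(1)] w(2) by metis
qed

lemma eliminate_coeff:
  assumes norm: "\<And>i. b < i \<Longrightarrow> i < k \<Longrightarrow> i + a - 1 \<in> V \<Longrightarrow> enat i \<noteq> l \<Longrightarrow> fps_nth y i = 0"
    and k: "b < k" "k < c" "k + a - 1 \<in> V" "enat k \<noteq> l"
  shows "\<exists>u. curve_equiv a y u \<and> monic_order b u \<and> (\<forall>i<k. fps_nth u i = fps_nth y i) \<and> fps_nth u k = 0"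
proof -
  obtain f g where fg: "f \<in> C" "g \<in> C" "fps_X ^ Suc b dvd f" "fps_X ^ Suc a dvd g"
    and d: "fps_X ^ (k + a - 1) dvd diff f g" "fps_nth (diff f g) (k + a - 1) \<noteq> 0"
  proof -
    have "\<exists>f g. f \<in> C \<and> g \<in> C \<and> fps_X ^ Suc b dvd f \<and> fps_X ^ Suc a dvd g \<and>
           fps_X ^ (k + a - 1) dvd diff f g \<and> fps_nth (diff f g) (k + a - 1) \<noteq> 0"
      by (rule eliminating_pair[OF _ k]) (rule norm)
    then show ?thesis using that by blast
  qed
  \<comment> \<open>Scaling the pair so that the shift cancels the coefficient of \<open>y\<close> at \<open>t\<^sup>k\<close>.\<close>
  define s where "s = - fps_nth y k * of_nat a / fps_nth (diff f g) (k + a - 1)"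
  obtain w0 where w0: "diff f g = fps_X ^ (k + a - 1) * w0" using d(1) by blast
  define w where "w = fps_X ^ k * (fps_const (s / of_nat a) * w0)"
  have pw: "fps_X ^ (a - 1) * fps_X ^ k = (fps_X ^ (k + a - 1) :: 'a fps)"
    using ab(1) by (simp add: add.commute flip: power_add)
  have cc: "fps_const (of_nat a) * fps_const (s / of_nat a) = fps_const s"
    using nz(1) by simp
  have "fps_deriv (fps_X ^ a) * w = (fps_const (of_nat a) * fps_const (s / of_nat a)) * ((fps_X ^ (a - 1) * fps_X ^ k) * w0)"
    unfolding w_def deriv_X_power by (simp only: mult_ac)
  also have "\<dots> = fps_const s * diff f g" unfolding cc pw w0 ..
  also have "\<dots> = diff (fps_const s * f) (fps_const s * g)" by (simp add: algebra_simps)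
  finally have eq: "diff (fps_const s * f) (fps_const s * g) = fps_deriv (fps_X ^ a) * w" ..
  have dw: "fps_X ^ k dvd w" by (simp add: w_def)
  have wk: "fps_nth w k = - fps_nth y k"
  proof -
    have "fps_nth (diff f g) (k + a - 1) = fps_nth w0 0" unfolding w0 by (simp add: fps_X_power_mult_nth)
    then show ?thesis using d(2) nz(1) by (simp add: w_def fps_X_power_mult_nth s_def)
  qed
  interpret e: elimination a b c k y "fps_const s * f" "fps_const s * g" w
  proof unfold_locales
    show "of_nat n \<noteq> (0::'a)" if "0 < n" "n \<le> k" for n using nonzero[of n] that k(2) by simp
    show "diff (fps_const s * f) (fps_const s * g) = fps_deriv (fps_X ^ a) * w" by (rule eq)
  qed (use ab y k conductor fg dw in \<open>auto intro: closed_alg_scale dvd_mult\<close>)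
  obtain u where u: "curve_equiv a y u" "monic_order b u"
    "fps_X ^ Suc k dvd u - (y + fps_const (fps_nth w k) * fps_X ^ k)"
    using e.shift_coefficient by blast
  have c: "fps_nth u i = fps_nth y i + (if i = k then - fps_nth y k else 0)" if "i \<le> k" for i
    using X_power_dvd_nth[OF u(3), of i] that by (simp add: wk)
  show ?thesis using u(1,2) c[of k] c by (intro exI[of _ u]) auto
qed

lemma normalize_below:
  "\<exists>u. curve_equiv a y u \<and> monic_order b u \<and>
      (\<forall>i. b < i \<longrightarrow> i < k \<longrightarrow> i < c \<longrightarrow> i + a - 1 \<in> V \<longrightarrow> enat i \<noteq> l \<longrightarrow> fps_nth u i = 0)"
proof (induction k)
  case 0
  then show ?case using y curve_equiv_refl by blast
next
  case (Suc k)
  then obtain u where u: "curve_equiv a y u" "monic_order b u"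
    and norm: "\<And>i. b < i \<Longrightarrow> i < k \<Longrightarrow> i < c \<Longrightarrow> i + a - 1 \<in> V \<Longrightarrow> enat i \<noteq> l \<Longrightarrow> fps_nth u i = 0" by blast
  interpret u: plane_branch a b u c l G V by (rule equiv_branch[OF u])
  show ?case
  proof (cases "b < k \<and> k < c \<and> k + a - 1 \<in> V \<and> enat k \<noteq> l")
    case True
    then have "\<exists>v. curve_equiv a u v \<and> monic_order b v \<and> (\<forall>i<k. fps_nth v i = fps_nth u i) \<and> fps_nth v k = 0"
      by (intro u.eliminate_coeff norm) auto
    then obtain v where v: "curve_equiv a u v" "monic_order b v" "\<And>i. i < k \<Longrightarrow> fps_nth v i = fps_nth u i" "fps_nth v k = 0"
      by blast
    then show ?thesis
      using curve_equiv_trans[OF u(1) v(1)] norm by (intro exI[of _ v]) (auto simp: less_Suc_eq)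
  next
    case False
    then show ?thesis using u norm by (intro exI[of _ u]) (auto simp: less_Suc_eq)
  qed
qed

lemma cut_tail:
  fixes u :: "'a fps"
  assumes "fps_X ^ c dvd u - y"
  shows "curve_equiv a y u" "monic_order b u"
proof -
  have d: "fps_X ^ Suc b dvd u - y" using assms by (rule power_le_dvd) (use bc in simp)
  then show "monic_order b u" using monic_order_cong[OF y] by blast
  have "y + (u - y) \<in> C" by (intro closed_alg_add closed_alg_generators conductor assms)
  then have "closed_alg (fps_X ^ a) u = C"
    using d by (intro closed_alg_perturb[OF ab monic_order_X_power y]) (simp_all add: closed_alg_generators)
  then show "curve_equiv a y u"
    unfolding curve_equiv_def by (intro exI[of _ fps_X]) (simp add: monic_order_iff)
qed

theorem normal_form:
  "\<exists>u. curve_equiv a y u \<and>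
     (case l of \<infinity> \<Rightarrow> u = fps_X ^ b
      | enat q \<Rightarrow> \<exists>e \<beta>. e \<noteq> 0 \<and> u = fps_X ^ b + fps_const e * fps_X ^ q +
           Abs_fps (\<lambda>i. if q < i \<and> i + a - 1 \<notin> V then \<beta> i else 0))"
proof -
  obtain u where u: "curve_equiv a y u" "monic_order b u"
    and norm: "\<And>i. b < i \<Longrightarrow> i < c \<Longrightarrow> i + a - 1 \<in> V \<Longrightarrow> enat i \<noteq> l \<Longrightarrow> fps_nth u i = 0"
    using normalize_below[of c] by blast
  interpret u: plane_branch a b u c l G V by (rule equiv_branch[OF u])
  \<comment> \<open>The tail lies in the ring and can be dropped.\<close>
  define v where "v = fps_cutoff c u"
  have "fps_X ^ c dvd v - u" unfolding X_power_dvd_iff by (simp add: v_def)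
  from u.cut_tail[OF this] have v: "curve_equiv a y v" "monic_order b v"
    using curve_equiv_trans[OF u(1)] by auto
  interpret v: plane_branch a b v c l G V by (rule equiv_branch[OF v])
  have vn: "fps_nth v i = 0" if "b < i" "i + a - 1 \<in> V" "enat i \<noteq> l" for i
    using norm that by (auto simp: v_def)
  have vc: "fps_nth v i = 0" if "c \<le> i" for i using that by (simp add: v_def)
  have vb: "fps_nth v i = (if i = b then 1 else 0)" if "i \<le> b" for i
    using v(2) that by (auto simp: monic_order_iff)
  show ?thesis
  proof (cases l)
    case infinity
    have d: "fps_X ^ c dvd v.z"
      by (rule v.first_coeff) (use infinity in \<open>auto intro: vn\<close>)
    have "v = fps_X ^ b"
    proof (rule fps_ext)
      fix i
      consider "i \<le> b" | "b < i" "i < c" | "b < i" "c \<le> i" by linarith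
      then show "fps_nth v i = fps_nth (fps_X ^ b) i"
        using vb[of i] vc[of i] v.z_nth[of i] X_power_dvd_nth[OF d, of i] by cases auto
    qed
    then show ?thesis using v(1) infinity by auto
  next
    case (enat q)
    have bq: "b < q" using at_l[OF enat] by blast
    have d: "fps_X ^ q dvd v.z"
      by (rule v.first_coeff) (use enat l_less_conductor[OF enat] in \<open>auto intro: vn\<close>)
    have vq: "fps_nth v i = 0" if "b < i" "i < q" for i
      using v.z_nth[OF that(1)] X_power_dvd_nth[OF d that(2)] by simp
    have "fps_nth v q \<noteq> 0"
      by (rule v.l_coeff_nonzero[OF _ enat]) (rule vn)
    moreover have "v = fps_X ^ b + fps_const (fps_nth v q) * fps_X ^ q +
           Abs_fps (\<lambda>i. if q < i \<and> i + a - 1 \<notin> V then fps_nth v i else 0)"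
    proof (rule fps_ext)
      fix i
      consider "i \<le> b" | "b < i" "i < q" | "i = q" | "q < i" by linarith
      then show "fps_nth v i = fps_nth (fps_X ^ b + fps_const (fps_nth v q) * fps_X ^ q +
           Abs_fps (\<lambda>i. if q < i \<and> i + a - 1 \<notin> V then fps_nth v i else 0)) i"
        using vb[of i] vq[of i] vn[of i] bq enat by cases auto
    qed
    ultimately show ?thesis using v(1) enat by auto
  qed
qed

end

section \<open>Substitution into power series in two variables\<close>

lemma coeff2_add: "coeff2 (F + G) i j = coeff2 F i j + coeff2 (G :: 'a::comm_ring_1 fps fps) i j"
  by (simp add: coeff2_def)

lemma coeff2_scale: "coeff2 (fps_const (fps_const k) * F) i j = k * coeff2 (F :: 'a::comm_ring_1 fps fps) i j"
  by (simp add: coeff2_def)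

lemma coeff2_X_mult: "coeff2 (fps_X * F) i j = (if i = 0 then 0 else coeff2 (F :: 'a::comm_ring_1 fps fps) (i - 1) j)"
  by (simp add: coeff2_def)

lemma subst2_add: "subst2 (F + G) u v = subst2 F u v + subst2 (G :: 'a::comm_ring_1 fps fps) u v"
  by (rule fps_ext) (simp add: subst2_def coeff2_add distrib_right sum.distrib)

lemma subst2_scale: "subst2 (fps_const (fps_const k) * F) u v = fps_const k * subst2 (F :: 'a::comm_ring_1 fps fps) u v"
  by (rule fps_ext) (simp add: subst2_def coeff2_scale sum_distrib_left mult.assoc)

lemma subst2_0: "subst2 0 u v = (0 :: 'a::comm_ring_1 fps)"
  by (rule fps_ext) (simp add: subst2_def coeff2_def)

lemma subst2_sum: "subst2 (\<Sum>i\<in>I. F i) u v = (\<Sum>i\<in>I. subst2 (F i :: 'a::comm_ring_1 fps fps) u v)"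
  by (induction I rule: infinite_finite_induct) (simp_all add: subst2_0 subst2_add)

lemma X_power_dvd_monomial:
  fixes u v :: "'a::field fps"
  assumes "fps_nth u 0 = 0" "fps_nth v 0 = 0"
  shows "fps_X ^ (i + j) dvd u ^ i * v ^ j"
proof -
  have "fps_X ^ 1 dvd u" "fps_X ^ 1 dvd v"
    using assms unfolding X_power_dvd_iff by auto
  then show ?thesis
    unfolding power_add by (intro mult_dvd_mono dvd_power_same) simp_all
qed

text \<open>
  Modulo \<open>O(N+1)\<close> any box containing the indices up to \<open>N\<close> gives the same sum, so that the box can be shifted
  along with the coefficients.
\<close>

lemma subst2_truncate:
  fixes u v :: "'a::field fps"
  assumes uv: "fps_nth u 0 = 0" "fps_nth v 0 = 0" and N: "N \<le> I" "N \<le> J"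
  shows "fps_X ^ Suc N dvd subst2 F u v - (\<Sum>i\<le>I. \<Sum>j\<le>J. fps_const (coeff2 F i j) * (u ^ i * v ^ j))"
  unfolding X_power_dvd_iff
proof (intro allI impI)
  fix n assume n: "n < Suc N"
  let ?t = "\<lambda>i j. coeff2 F i j * fps_nth (u ^ i * v ^ j) n"
  have 0: "?t i j = 0" if "n < i \<or> n < j" for i j
    using X_power_dvd_nth[OF X_power_dvd_monomial[OF uv, of i j], of n] that by auto
  have "(\<Sum>i\<le>I. \<Sum>j\<le>J. ?t i j) = (\<Sum>i\<le>n. \<Sum>j\<le>J. ?t i j)"
    using n N 0 by (intro sum.mono_neutral_right) (auto intro!: sum.neutral)
  also have "\<dots> = (\<Sum>i\<le>n. \<Sum>j\<le>n. ?t i j)"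
    using n N 0 by (intro sum.cong refl sum.mono_neutral_right) auto
  finally show "fps_nth (subst2 F u v - (\<Sum>i\<le>I. \<Sum>j\<le>J. fps_const (coeff2 F i j) * (u ^ i * v ^ j))) n = 0"
    by (simp add: subst2_def fps_sum_nth)
qed

lemma subst2_X_mult:
  fixes u v :: "'a::field fps"
  assumes uv: "fps_nth u 0 = 0" "fps_nth v 0 = 0"
  shows "subst2 (fps_X * F) u v = u * subst2 F u v"
proof -
  have "fps_X ^ N dvd subst2 (fps_X * F) u v - u * subst2 F u v" for N
  proof -
    let ?S = "\<Sum>i\<le>N. \<Sum>j\<le>N. fps_const (coeff2 F i j) * (u ^ i * v ^ j)"
    have "(\<Sum>i\<le>Suc N. \<Sum>j\<le>N. fps_const (coeff2 (fps_X * F) i j) * (u ^ i * v ^ j)) =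
      (\<Sum>i\<le>N. \<Sum>j\<le>N. fps_const (coeff2 F i j) * (u ^ Suc i * v ^ j))"
      unfolding sum.atMost_Suc_shift by (simp add: coeff2_X_mult)
    also have "\<dots> = u * ?S"
      by (simp add: sum_distrib_left algebra_simps)
    finally have "fps_X ^ Suc N dvd subst2 (fps_X * F) u v - u * ?S"
      using subst2_truncate[OF uv, of N "Suc N" N "fps_X * F"] by simp
    moreover have "fps_X ^ Suc N dvd u * ?S - u * subst2 F u v"
      using dvd_mult[OF X_power_dvd_diff_sym[OF subst2_truncate[OF uv order_refl order_refl, of N F]], of u]
      by (simp only: right_diff_distrib)
    ultimately have "fps_X ^ Suc N dvd subst2 (fps_X * F) u v - u * subst2 F u v"
      by (rule X_power_dvd_diff_trans)
    then show ?thesis by (rule power_le_dvd) simp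
  qed
  from X_power_dvd_zero[OF this] show ?thesis by simp
qed

lemma subst2_X_power_mult:
  fixes u v :: "'a::field fps"
  assumes "fps_nth u 0 = 0" "fps_nth v 0 = 0"
  shows "subst2 (fps_X ^ i * F) u v = u ^ i * subst2 F u v"
  by (induction i) (simp_all add: subst2_X_mult[OF assms] mult.assoc)

lemma subst2_const_X_power:
  fixes u v :: "'a::field fps"
  assumes "fps_nth v 0 = 0"
  shows "subst2 (fps_const (fps_X ^ j)) u v = v ^ j"
proof (rule fps_ext)
  fix n
  have c: "coeff2 (fps_const (fps_X ^ j :: 'a fps)) i j' = (if i = 0 \<and> j' = j then 1 else 0)" for i j'
    by (simp add: coeff2_def)
  have "fps_nth (subst2 (fps_const (fps_X ^ j)) u v) n =
      (\<Sum>i\<le>n. if i = 0 then (\<Sum>j'\<le>n. if j' = j then fps_nth (v ^ j) n else 0) else 0)"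
    unfolding subst2_def fps_nth_Abs_fps c
    by (intro sum.cong refl) (simp add: if_distrib[where f = "\<lambda>x. x * _"] cong: if_cong)
  also have "\<dots> = (if j \<le> n then fps_nth (v ^ j) n else 0)" by simp
  also have "\<dots> = fps_nth (v ^ j) n"
    using X_power_dvd_nth[OF X_power_dvd_monomial[of 0 v 0 j], of n] assms by auto
  finally show "fps_nth (subst2 (fps_const (fps_X ^ j)) u v) n = fps_nth (v ^ j) n" .
qed

lemma branch_ring_monomial:
  fixes u v :: "'a::field fps"
  assumes "fps_nth u 0 = 0" "fps_nth v 0 = 0"
  shows "u ^ i * v ^ j \<in> branch_ring u v"
  unfolding branch_ring_def
  by (rule range_eqI[of _ _ "fps_X ^ i * fps_const (fps_X ^ j)"])
     (simp add: subst2_X_power_mult[OF assms] subst2_const_X_power[OF assms(2)])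

lemma branch_ring_add: "f \<in> branch_ring u v \<Longrightarrow> g \<in> branch_ring u v \<Longrightarrow> f + g \<in> branch_ring u v"
  unfolding branch_ring_def by (auto simp flip: subst2_add)

lemma branch_ring_scale: "f \<in> branch_ring u v \<Longrightarrow> fps_const k * f \<in> branch_ring u v"
  unfolding branch_ring_def by (auto simp flip: subst2_scale)

lemma branch_ring_0: "0 \<in> branch_ring u v"
  unfolding branch_ring_def by (rule range_eqI[of _ _ 0]) (simp add: subst2_0)

lemma poly_alg_subset_branch_ring:
  fixes u v :: "'a::field fps"
  assumes "fps_nth u 0 = 0" "fps_nth v 0 = 0"
  shows "poly_alg u v \<subseteq> branch_ring u v"
proof
  fix h assume "h \<in> poly_alg u v"
  then show "h \<in> branch_ring u v"
    by (induction rule: poly_alg_induct)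
       (auto intro: branch_ring_0 branch_ring_add branch_ring_scale branch_ring_monomial assms)
qed

lemma poly_alg_sum: "(\<And>i. i \<in> I \<Longrightarrow> f i \<in> poly_alg u v) \<Longrightarrow> sum f I \<in> poly_alg u v"
  unfolding poly_alg_def by (rule fps_space.span_sum)

lemma branch_ring_subset_closed_alg:
  fixes u v :: "'a::field fps"
  assumes "fps_nth u 0 = 0" "fps_nth v 0 = 0"
  shows "branch_ring u v \<subseteq> closed_alg u v"
proof
  fix h assume "h \<in> branch_ring u v"
  then obtain F where h: "h = subst2 F u v" unfolding branch_ring_def by blast
  show "h \<in> closed_alg u v"
    unfolding closed_alg_def
  proof (intro CollectI allI)
    fix N
    let ?P = "\<Sum>i\<le>N. \<Sum>j\<le>N. fps_const (coeff2 F i j) * (u ^ i * v ^ j)"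
    have "?P \<in> poly_alg u v" by (intro poly_alg_sum poly_alg_scale monomial_in_poly_alg)
    moreover have "fps_X ^ N dvd h - ?P"
      unfolding h using subst2_truncate[OF assms order_refl order_refl, of N F] by (rule power_le_dvd) simp
    ultimately show "\<exists>P\<in>poly_alg u v. fps_X ^ N dvd h - P" by blast
  qed
qed

lemma subst2_compose:
  fixes u v r :: "'a::field fps"
  assumes uv: "fps_nth u 0 = 0" "fps_nth v 0 = 0" and r: "fps_nth r 0 = 0"
  shows "subst2 F (u oo r) (v oo r) = subst2 F u v oo r"
proof -
  have "fps_X ^ N dvd subst2 F (u oo r) (v oo r) - (subst2 F u v oo r)" for N
  proof -
    let ?S = "\<Sum>i\<le>N. \<Sum>j\<le>N. fps_const (coeff2 F i j) * (u ^ i * v ^ j)"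
    have S: "?S oo r = (\<Sum>i\<le>N. \<Sum>j\<le>N. fps_const (coeff2 F i j) * ((u oo r) ^ i * (v oo r) ^ j))"
      by (simp add: fps_compose_sum_distrib fps_compose_mult_distrib[OF r] flip: fps_compose_power[OF r])
    have "fps_X ^ Suc N dvd subst2 F (u oo r) (v oo r) - (?S oo r)"
      unfolding S by (rule subst2_truncate) (simp_all add: uv)
    moreover have "fps_X ^ Suc N dvd (?S oo r) - (subst2 F u v oo r)"
      using X_power_dvd_compose[OF r X_power_dvd_diff_sym[OF subst2_truncate[OF uv order_refl order_refl, of N F]]]
      by (simp only: fps_compose_sub_distrib)
    ultimately have "fps_X ^ Suc N dvd subst2 F (u oo r) (v oo r) - (subst2 F u v oo r)"
      by (rule X_power_dvd_diff_trans)
    then show ?thesis by (rule power_le_dvd) simp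
  qed
  from X_power_dvd_zero[OF this] show ?thesis by simp
qed

section \<open>The conductor of the ring of a branch\<close>

lemma monic_element:
  assumes "n \<in> value_set W" "\<And>f k. f \<in> W \<Longrightarrow> fps_const k * f \<in> W"
  obtains e where "e \<in> W" "monic_order n (e :: 'a::field fps)"
proof -
  obtain h where h: "h \<in> W" "h \<noteq> 0" "subdegree h = n" using assms(1) unfolding value_set_def by blast
  have "monic_order n (fps_const (inverse (fps_nth h n)) * h)"
    using nth_subdegree_nonzero[OF h(2)] nth_less_subdegree_zero[of _ h] unfolding monic_order_iff h(3) by simp
  then show ?thesis using that assms(2)[OF h(1)] by blast
qed

text \<open>
  Independent vectors modulo \<open>W\<close> come from gaps: a combination of powers of \<open>t\<close> with gaps as exponents has a gap as
  its order, so it lies in \<open>W\<close> only if it is zero. Hence the number of gaps is at most the codimension.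
\<close>

lemma cofinite_value_set:
  fixes W :: "'a::field fps set"
  assumes "finite_codim W" and W: "0 \<in> W" "\<And>f g. f \<in> W \<Longrightarrow> g \<in> W \<Longrightarrow> f + g \<in> W" "\<And>f k. f \<in> W \<Longrightarrow> fps_const k * f \<in> W"
  shows "finite (- value_set W)"
proof (rule ccontr)
  assume inf: "infinite (- value_set W)"
  obtain B where B: "finite B" "\<And>h. \<exists>w\<in>W. h - w \<in> fps_space.span B"
    using assms(1) unfolding finite_codim_def by blast
  obtain S where S: "S \<subseteq> - value_set W" "finite S" "card S = Suc (card B)"
    using infinite_arbitrarily_large[OF inf] by blast
  obtain w where w: "\<And>h. w h \<in> W" "\<And>h. h - w h \<in> fps_space.span B"
    using B(2) by metis
  have gaps: "\<forall>n\<in>S. u n = 0" if W': "(\<Sum>n\<in>S. fps_const (u n) * fps_X ^ n) \<in> W" for u :: "nat \<Rightarrow> 'a"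
  proof (rule ccontr)
    let ?f = "\<Sum>n\<in>S. fps_const (u n) * fps_X ^ n"
    assume "\<not> ?thesis"
    then obtain n where n: "n \<in> S" "u n \<noteq> 0" by blast
    have f: "fps_nth ?f i = (if i \<in> S then u i else 0)" for i
      using S(2) by (simp add: fps_sum_nth if_distrib sum.delta cong: if_cong)
    have nz: "?f \<noteq> 0" using f[of n] n by auto
    then have "subdegree ?f \<in> S" using f[of "subdegree ?f"] nth_subdegree_nonzero[OF nz] by (metis (full_types))
    moreover have "subdegree ?f \<in> value_set W" using nz W' unfolding value_set_def by blast
    ultimately show False using S(1) by blast
  qed
  define v where "v n = fps_X ^ n - w (fps_X ^ n)" for n :: nat
  have Wsum: "(\<Sum>n\<in>S'. fps_const (u n) * w (fps_X ^ n)) \<in> W" if "finite S'" for u and S' :: "nat set"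
    using that by (induction S') (simp_all add: W w)
  have rel: "\<forall>n\<in>S. u n = 0" if "(\<Sum>n\<in>S. fps_const (u n) * v n) = 0" for u
  proof -
    have "(\<Sum>n\<in>S. fps_const (u n) * fps_X ^ n) = (\<Sum>n\<in>S. fps_const (u n) * w (fps_X ^ n))"
      using that by (simp add: v_def right_diff_distrib sum_subtractf)
    then have "(\<Sum>n\<in>S. fps_const (u n) * fps_X ^ n) \<in> W" using Wsum[OF S(2)] by simp
    from gaps[OF this] show ?thesis .
  qed
  have inj: "inj_on v S"
  proof (rule inj_onI, rule ccontr)
    fix m n assume mn: "m \<in> S" "n \<in> S" "v m = v n" "m \<noteq> n"
    let ?u = "\<lambda>i. if i = m then 1 else if i = n then - 1 else (0 :: 'a)"
    have "(\<Sum>i\<in>S. fps_const (?u i) * v i) = (\<Sum>i\<in>S. (if i = m then v m else 0) - (if i = n then v n else 0))"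
      using mn(4) by (intro sum.cong refl) (auto simp flip: fps_const_neg)
    also have "\<dots> = 0" using mn S(2) by (simp add: sum_subtractf)
    finally have "\<forall>i\<in>S. ?u i = 0" by (rule rel)
    from bspec[OF this mn(1)] show False by simp
  qed
  have "fps_space.independent (v ` S)"
    unfolding fps_space.independent_explicit_finite_subsets
  proof (intro allI impI ballI)
    fix A u x assume A: "A \<subseteq> v ` S" "finite A" "(\<Sum>x\<in>A. fps_const (u x) * x) = 0" "x \<in> A"
    have "(\<Sum>n\<in>S. fps_const (if v n \<in> A then u (v n) else 0) * v n) = (\<Sum>x\<in>v ` S. fps_const (if x \<in> A then u x else 0) * x)"
      by (simp add: sum.reindex[OF inj])
    also have "\<dots> = (\<Sum>x\<in>A. fps_const (if x \<in> A then u x else 0) * x)"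
      using A(1) S(2) by (intro sum.mono_neutral_right) auto
    also have "\<dots> = 0" using A(3) by simp
    finally have "\<forall>n\<in>S. (if v n \<in> A then u (v n) else 0) = 0" by (rule rel)
    moreover obtain n where "n \<in> S" "x = v n" using A(1,4) by blast
    ultimately show "u x = 0" using A(4) by auto
  qed
  then have "card (v ` S) \<le> card B"
    using fps_space.independent_span_bound[OF B(1)] w(2) unfolding v_def by blast
  then show False using card_image[OF inj] S(3) by simp
qed

text \<open>
  The point is that \<open>h\<close> is the value of a genuine power series. With elements \<open>e\<^sub>m\<close> of the ring of orders \<open>c + m\<close>, \<open>m < a\<close>,
  one divides \<open>h = \<Sum> k\<^sub>m e\<^sub>m + t\<^sup>a h\<^sub>1\<close> with \<open>h\<^sub>1\<close> again in \<open>O(c)\<close>; iterating, the \<open>q\<close>-th quotient is multiplied by \<open>x\<^sup>q\<close>, so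
  the coefficients assemble into a power series in \<open>x\<close> times each \<open>E\<^sub>m\<close>.
\<close>

lemma branch_ring_conductor:
  fixes v :: "'a::field fps"
  assumes a: "0 < a" and v: "fps_nth v 0 = 0"
    and vals: "\<And>n. c \<le> n \<Longrightarrow> n \<in> value_set (branch_ring (fps_X ^ a) v)"
    and h: "fps_X ^ c dvd h"
  shows "h \<in> branch_ring (fps_X ^ a) v"
proof -
  let ?x = "fps_X ^ a :: 'a fps"
  have uv: "fps_nth ?x 0 = 0" "fps_nth v 0 = 0" using a v by auto
  have "\<exists>E. monic_order (c + m) (subst2 E ?x v)" for m
  proof -
    obtain e where "e \<in> branch_ring ?x v" "monic_order (c + m) e"
      using monic_element[OF vals[of "c + m"]] branch_ring_scale by (metis le_add1)
    then show ?thesis unfolding branch_ring_def by blast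
  qed
  then obtain E where E: "\<And>m. monic_order (c + m) (subst2 (E m) ?x v)" by metis
  have part: "\<exists>k. fps_X ^ (c + j) dvd h - (\<Sum>m<j. fps_const (k m) * subst2 (E m) ?x v)"
    if "fps_X ^ c dvd h" for h j
  proof (induction j)
    case (Suc j)
    then obtain k where k: "fps_X ^ (c + j) dvd h - (\<Sum>m<j. fps_const (k m) * subst2 (E m) ?x v)" (is "_ dvd ?d") by blast
    define k' where "k' = k(j := fps_nth ?d (c + j))"
    have "(\<Sum>m<j. fps_const (k' m) * subst2 (E m) ?x v) = (\<Sum>m<j. fps_const (k m) * subst2 (E m) ?x v)"
      by (intro sum.cong) (auto simp: k'_def)
    then have "h - (\<Sum>m<Suc j. fps_const (k' m) * subst2 (E m) ?x v) =
        ?d - fps_const (fps_nth ?d (c + j)) * subst2 (E j) ?x v"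
      by (simp add: k'_def)
    moreover have "fps_X ^ Suc (c + j) dvd ?d - fps_const (fps_nth ?d (c + j)) * subst2 (E j) ?x v"
      unfolding X_power_dvd_Suc_iff using E[of j] k by (auto simp: monic_order_iff X_power_dvd_iff)
    ultimately have "fps_X ^ (c + Suc j) dvd h - (\<Sum>m<Suc j. fps_const (k' m) * subst2 (E m) ?x v)"
      by (simp only: add_Suc_right)
    then show ?case by blast
  qed (use that in simp)
  define divides where "divides h k h' \<longleftrightarrow>
      fps_X ^ c dvd h' \<and> h = (\<Sum>m<a. fps_const (k m) * subst2 (E m) ?x v) + ?x * h'" for h k h'
  have "\<exists>k h'. divides h k h'" if h: "fps_X ^ c dvd h" for h
  proof -
    obtain k where "fps_X ^ (c + a) dvd h - (\<Sum>m<a. fps_const (k m) * subst2 (E m) ?x v)"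
      using part[OF h] by blast
    then obtain g where "h - (\<Sum>m<a. fps_const (k m) * subst2 (E m) ?x v) = ?x * (fps_X ^ c * g)"
      by (auto simp: power_add mult_ac)
    then have "h = (\<Sum>m<a. fps_const (k m) * subst2 (E m) ?x v) + ?x * (fps_X ^ c * g)"
      by (simp add: algebra_simps)
    then show ?thesis unfolding divides_def by (intro exI[of _ k] exI[of _ "fps_X ^ c * g"]) simp
  qed
  then obtain K Q where "\<And>h. fps_X ^ c dvd h \<Longrightarrow> divides h (K h) (Q h)" by metis
  then have KQ: "fps_X ^ c dvd Q h" "h = (\<Sum>m<a. fps_const (K h m) * subst2 (E m) ?x v) + ?x * Q h"
    if "fps_X ^ c dvd h" for h
    using that unfolding divides_def by blast+
  define H where "H q = (Q ^^ q) h" for q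
  have H: "fps_X ^ c dvd H q" for q by (induction q) (simp_all add: H_def h KQ(1))
  \<comment> \<open>\<open>\<Phi> q\<close> is the series whose value is the quotient \<open>H q\<close>.\<close>
  define \<Phi> where "\<Phi> q = (\<Sum>m<a. Abs_fps (\<lambda>i. fps_const (K (H (q + i)) m)) * E m)" for q
  have \<Phi>: "\<Phi> q = (\<Sum>m<a. fps_const (fps_const (K (H q) m)) * E m) + fps_X * \<Phi> (Suc q)" for q
  proof -
    have "Abs_fps (\<lambda>i. fps_const (K (H (q + i)) m)) =
        fps_const (fps_const (K (H q) m)) + fps_X * Abs_fps (\<lambda>i. fps_const (K (H (Suc q + i)) m))" for m
    proof (rule fps_ext)
      show "fps_nth (Abs_fps (\<lambda>i. fps_const (K (H (q + i)) m))) n =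
        fps_nth (fps_const (fps_const (K (H q) m)) + fps_X * Abs_fps (\<lambda>i. fps_const (K (H (Suc q + i)) m))) n" for n
        by (cases n) simp_all
    qed
    then show ?thesis
      by (simp add: \<Phi>_def distrib_right sum.distrib sum_distrib_left mult.assoc)
  qed
  have step: "H q - subst2 (\<Phi> q) ?x v = ?x * (H (Suc q) - subst2 (\<Phi> (Suc q)) ?x v)" for q
  proof -
    have "subst2 (\<Phi> q) ?x v = (\<Sum>m<a. fps_const (K (H q) m) * subst2 (E m) ?x v) + ?x * subst2 (\<Phi> (Suc q)) ?x v"
      by (subst \<Phi>) (simp add: subst2_add subst2_sum subst2_scale subst2_X_mult[OF uv])
    moreover have "H q = (\<Sum>m<a. fps_const (K (H q) m) * subst2 (E m) ?x v) + ?x * H (Suc q)"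
      using KQ(2)[OF H[of q]] by (simp add: H_def)
    moreover have "D - A = E - B" if "A = S + B" "D = S + E" for A B D E S :: "'a fps"
      using that by simp
    ultimately show ?thesis unfolding right_diff_distrib by blast
  qed
  have "h - subst2 (\<Phi> 0) ?x v = ?x ^ n * (H n - subst2 (\<Phi> n) ?x v)" for n
  proof (induction n)
    case (Suc n)
    then show ?case using step[of n] by (simp add: algebra_simps)
  qed (simp add: H_def)
  then have "?x ^ n dvd h - subst2 (\<Phi> 0) ?x v" for n by (metis dvd_triv_left)
  then have "fps_X ^ n dvd h - subst2 (\<Phi> 0) ?x v" for n
    by (metis a le_imp_power_dvd dvd_trans power_mult mult_le_mono1 nat_mult_1 Suc_leI One_nat_def)
  from X_power_dvd_zero[OF this] have "h = subst2 (\<Phi> 0) ?x v" by simp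
  then show ?thesis unfolding branch_ring_def by blast
qed

lemma branch_ring_eq_closed_alg:
  fixes v :: "'a::field fps"
  assumes "0 < a" "fps_nth v 0 = 0" "\<And>n. c \<le> n \<Longrightarrow> n \<in> value_set (branch_ring (fps_X ^ a) v)"
  shows "branch_ring (fps_X ^ a) v = closed_alg (fps_X ^ a) v"
proof
  have uv: "fps_nth (fps_X ^ a :: 'a fps) 0 = 0" "fps_nth v 0 = 0" using assms by auto
  show "branch_ring (fps_X ^ a) v \<subseteq> closed_alg (fps_X ^ a) v" by (rule branch_ring_subset_closed_alg[OF uv])
  show "closed_alg (fps_X ^ a) v \<subseteq> branch_ring (fps_X ^ a) v"
  proof
    fix h assume "h \<in> closed_alg (fps_X ^ a) v"
    then obtain P where P: "P \<in> poly_alg (fps_X ^ a) v" "fps_X ^ c dvd h - P" by (rule closed_algE)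
    have "P + (h - P) \<in> branch_ring (fps_X ^ a) v"
      using poly_alg_subset_branch_ring[OF uv] P(1) branch_ring_conductor[OF assms P(2)]
      by (intro branch_ring_add) auto
    then show "h \<in> branch_ring (fps_X ^ a) v" by simp
  qed
qed

section \<open>Right-left equivalence\<close>

text \<open>
  Up to order \<open>b\<close> the order of a monomial determines it, so the linear part of \<open>L\<close> can be read off from its value.
\<close>

lemma subst2_low_coeff:
  fixes y :: "'a::field fps"
  assumes ab: "0 < a" "a < b" "\<not> a dvd b" and y: "monic_order b y" and n: "a * i0 + b * j0 = n" "n \<le> b"
  shows "fps_nth (subst2 L (fps_X ^ a) y) n = coeff2 L i0 j0"
proof -
  have c: "fps_nth ((fps_X ^ a) ^ i * y ^ j) n = (if i = i0 \<and> j = j0 then 1 else 0)" for i j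
  proof -
    have m: "monic_order (a * i + b * j) ((fps_X ^ a) ^ i * y ^ j)"
      by (intro monic_order_mult monic_order_power monic_order_X_power y)
    consider "n < a * i + b * j" | "a * i + b * j = n" | "a * i + b * j < n" by linarith
    then show ?thesis
    proof cases
      case 1
      then show ?thesis using m n(1) by (auto simp: monic_order_iff)
    next
      case 2
      then have "i = i0 \<and> j = j0" using small_weight_unique[OF ab, of i j i0 j0] n by simp
      then show ?thesis using m 2 by (auto simp: monic_order_iff)
    next
      case 3
      then have "j = 0" using n(2) by (cases j) auto
      then show ?thesis using 3 n(1) by (auto simp flip: power_mult)
    qed
  qed
  have le: "i0 \<le> n" "j0 \<le> n"
  proof -
    have "1 * i0 \<le> a * i0" "1 * j0 \<le> b * j0" using ab by (intro mult_le_mono1; simp)+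
    then show "i0 \<le> n" "j0 \<le> n" using n(1) by linarith+
  qed
  have "fps_nth (subst2 L (fps_X ^ a) y) n = (\<Sum>i\<le>n. if i = i0 then (\<Sum>j\<le>n. if j = j0 then coeff2 L i0 j0 else 0) else 0)"
    unfolding subst2_def fps_nth_Abs_fps c
    by (intro sum.cong refl) (simp add: if_distrib[where f = "\<lambda>x. _ * x"] cong: if_cong)
  also have "\<dots> = coeff2 L i0 j0" using le by simp
  finally show ?thesis .
qed

text \<open>
  The reparametrization is the inverse of \<open>\<tau>\<close> followed by the scaling. The linear part of \<open>(L1, L2)\<close> is triangular,
  because \<open>L2\<close> takes a value of order \<open>b > a\<close>.
\<close>

lemma A_equivalent_curve_equiv:
  fixes y u :: "'a::field fps"
  assumes ab: "0 < a" "a < b" "\<not> a dvd b" and y: "monic_order b y" and u: "monic_order b u"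
    and eq: "curve_equiv a y u" and R: "branch_ring (fps_X ^ a) y = closed_alg (fps_X ^ a) y" and s: "s \<noteq> 0"
  shows "(fps_X ^ a, y) \<sim>\<^sub>A (fps_X ^ a, fps_const (inverse (s ^ b)) * (u oo (fps_const s * fps_X)))"
proof -
  obtain \<tau> where \<tau>: "monic_order 1 \<tau>" "closed_alg (fps_X ^ a) y = closed_alg (\<tau> ^ a) (u oo \<tau>)"
    using eq unfolding curve_equiv_def by blast
  note t = monic_order_1D[OF \<tau>(1)]
  have "\<tau> ^ a \<in> branch_ring (fps_X ^ a) y" "u oo \<tau> \<in> branch_ring (fps_X ^ a) y"
    unfolding R \<tau>(2) by (rule closed_alg_generators)+
  then obtain L1 L2 where L: "\<tau> ^ a = subst2 L1 (fps_X ^ a) y" "u oo \<tau> = subst2 L2 (fps_X ^ a) y"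
    unfolding branch_ring_def by blast
  note L = L[symmetric]
  define r where "r = fps_inv \<tau> oo (fps_const s * fps_X)"
  have s0: "fps_nth (fps_const s * fps_X) 0 = 0" and i0: "fps_nth (fps_inv \<tau>) 0 = 0"
    by (simp_all add: fps_inv_def)
  have r0: "fps_nth r 0 = 0" by (simp add: r_def i0)
  have tr: "\<tau> oo r = fps_const s * fps_X"
    unfolding r_def fps_compose_assoc[OF s0 i0] fps_inv_right[OF t] by (simp add: s0)
  have "fps_nth (\<tau> oo r) 1 = fps_nth r 1"
    using \<tau>(1) by (simp add: fps_compose_nth monic_order_iff)
  then have r1: "fps_nth r 1 = s" unfolding tr by simp
  have uv: "fps_nth (fps_X ^ a :: 'a fps) 0 = 0" "fps_nth y 0 = 0"
    using ab y by (auto simp: monic_order_iff)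
  let ?L1 = "fps_const (fps_const (inverse (s ^ a))) * L1" and ?L2 = "fps_const (fps_const (inverse (s ^ b))) * L2"
  have t1: "monic_order a (\<tau> ^ a)" using monic_order_power[OF \<tau>(1), of a] by simp
  have t2: "monic_order b (u oo \<tau>)" by (rule monic_order_compose[OF \<tau>(1) u])
  note low = subst2_low_coeff[OF ab y, of 0 0 0] subst2_low_coeff[OF ab y, of 1 0 a] subst2_low_coeff[OF ab y, of 0 1 b]
  have c1: "coeff2 L1 0 0 = 0" "coeff2 L1 1 0 = 1"
    using low(1,2)[of L1] t1 ab unfolding L by (auto simp: monic_order_iff)
  have c2: "coeff2 L2 0 0 = 0" "coeff2 L2 1 0 = 0" "coeff2 L2 0 1 = 1"
    using low[of L2] t2 ab unfolding L by (auto simp: monic_order_iff)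
  have det: "invertible (vector [vector [coeff2 ?L1 1 0, coeff2 ?L1 0 1], vector [coeff2 ?L2 1 0, coeff2 ?L2 0 1]] :: 'a^2^2)"
    unfolding invertible_det_nz det_2 coeff2_scale using c1 c2 s by simp
  have x1: "fps_X ^ a = subst2 ?L1 (fps_X ^ a oo r) (y oo r)"
  proof -
    have "subst2 ?L1 (fps_X ^ a oo r) (y oo r) = fps_const (inverse (s ^ a)) * (\<tau> oo r) ^ a"
      unfolding subst2_compose[OF uv r0] subst2_scale L fps_compose_mult_distrib[OF r0] fps_compose_power[OF r0]
      by simp
    also have "\<dots> = (fps_const (inverse (s ^ a)) * fps_const (s ^ a)) * fps_X ^ a"
      unfolding tr power_mult_distrib fps_const_power by (simp only: mult.assoc)
    also have "\<dots> = fps_X ^ a" using s by simp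
    finally show ?thesis ..
  qed
  have x2: "fps_const (inverse (s ^ b)) * (u oo (fps_const s * fps_X)) = subst2 ?L2 (fps_X ^ a oo r) (y oo r)"
    unfolding subst2_compose[OF uv r0] subst2_scale L fps_compose_mult_distrib[OF r0]
      fps_compose_assoc[OF r0 t(1), symmetric] tr by simp
  show ?thesis
    unfolding A_equivalent_def fst_conv snd_conv
    using r0 r1 s c1(1) c2(1) det x1 x2
    by (intro exI[of _ r] exI[of _ ?L1] exI[of _ ?L2] conjI) (simp_all add: coeff2_scale)
qed

section \<open>Existence of the normal form\<close>

lemma conductor_of_cofinite:
  assumes "finite (- \<Gamma>)"
  shows "conductor \<Gamma> \<le> n \<Longrightarrow> n \<in> \<Gamma>"
proof -
  obtain N where N: "\<And>n. n \<in> - \<Gamma> \<Longrightarrow> n < N"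
    using finite_nat_set_iff_bounded[THEN iffD1, OF assms] by blast
  have "\<exists>n. n \<in> \<Gamma> \<and> (\<forall>m. n + m \<in> \<Gamma>)"
  proof (intro exI[of _ N] conjI allI)
    show "N \<in> \<Gamma>" using N[of N] by auto
    show "N + m \<in> \<Gamma>" for m using N[of "N + m"] by auto
  qed
  from LeastI_ex[OF this] have "conductor \<Gamma> + m \<in> \<Gamma>" for m
    unfolding conductor_def by blast
  then show "conductor \<Gamma> \<le> n \<Longrightarrow> n \<in> \<Gamma>" by (metis le_add_diff_inverse)
qed

context plane_curve
begin

lemma multiplicity: "multiplicity_of (value_set C) = a"
  unfolding multiplicity_of_def
proof (rule Least_equality)
  have "in_monoid a b a" unfolding in_monoid_def by (intro exI[of _ 1] exI[of _ 0]) simp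
  then show "a \<in> value_set C \<and> a \<noteq> 0" using monoid_values ab by simp
next
  fix n assume n: "n \<in> value_set C \<and> n \<noteq> 0"
  then obtain h where h: "h \<in> C" "h \<noteq> 0" "subdegree h = n" unfolding value_set_def by blast
  show "a \<le> n"
  proof (rule ccontr)
    assume "\<not> a \<le> n"
    then have "\<not> a dvd n" "n < b" using n ab by (auto dest: dvd_imp_le)
    then have "fps_nth h n = 0" by (intro low_coeff h(1))
    then show False using nth_subdegree_nonzero[OF h(2)] h(3) by simp
  qed
qed

text \<open>
  Between \<open>b\<close> and \<open>a + b\<close> the semigroup contains only multiples of \<open>a\<close>, so \<open>b + 1\<close> and \<open>b + 2\<close> are not both in it.
\<close>

lemma conductor_bound:
  assumes a: "3 \<le> a" and vals: "\<And>n. c \<le> n \<Longrightarrow> n \<in> value_set C"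
  shows "b + 2 \<le> c"
proof (rule ccontr)
  assume "\<not> b + 2 \<le> c"
  then have "b + 1 \<in> value_set C" "b + 2 \<in> value_set C" using vals by auto
  moreover have "a dvd s" if s: "s \<in> value_set C" "b < s" "s \<le> b + 2" for s
  proof -
    obtain h where h: "h \<in> C" "h \<noteq> 0" "subdegree h = s" using s(1) unfolding value_set_def by blast
    have "in_monoid a b (subdegree h)"
      by (rule order_in_monoid[OF ab z_dvd]) (use h s a y_eq in auto)
    then obtain i j where ij: "s = a * i + b * j" unfolding in_monoid_def h(3) by blast
    have "j = 0"
    proof (rule ccontr)
      assume "j \<noteq> 0"
      then consider "j = 1" | "2 \<le> j" by linarith
      then show False
      proof cases
        case 1
        then have "i \<noteq> 0" using ij s(2) by (intro notI) simp
        then have "a * 1 \<le> a * i" by (intro mult_le_mono2) simp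
        moreover have "s = a * i + b" using ij 1 by simp
        ultimately show False using s(3) a by linarith
      next
        case 2
        then have "b * 2 \<le> b * j" by (intro mult_le_mono2)
        then show False using ij s(3) a ab by linarith
      qed
    qed
    then show ?thesis using ij by simp
  qed
  ultimately have "a dvd b + 1" "a dvd b + 2" by auto
  then have "a dvd (b + 2) - (b + 1)" by (rule dvd_diff_nat[rotated])
  then show False using a by simp
qed

end

lemma monoid_2_odd:
  assumes "odd b"
  shows "in_monoid 2 b (b - 1 + m)"
proof (cases "even m")
  case True
  then have "even (b - 1 + m)" using assms odd_pos[OF assms] by simp
  then obtain i where "b - 1 + m = 2 * i" by (rule evenE)
  then have "b - 1 + m = 2 * i + b * 0" by simp
  then show ?thesis unfolding in_monoid_def by blast
next
  case False
  then obtain k where "m = 2 * k + 1" by (rule oddE)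
  then have "b - 1 + m = 2 * k + b * 1" using odd_pos[OF assms] by simp
  then show ?thesis unfolding in_monoid_def by blast
qed

theorem corollary7p8:
  fixes a b p :: nat
    and coef :: "nat \<Rightarrow> 'a::alg_closed_field"
    and x y :: "'a fps"
    and \<Gamma> \<Lambda> :: "nat set"
    and l :: enat
  assumes char: "CHAR('a) = p"
    and ab: "a < b" "\<not> a dvd b"
    and x: "x = fps_X ^ a"
    and y: "y = fps_X ^ b + Abs_fps (\<lambda>i. if i > b then coef i else 0)"
    and primitive: "primitive_parameterization x y"
    and Gamma: "\<Gamma> = semigroup_of x y"
    and Lambda: "\<Lambda> = semimodule_of x y"
    and zariski: "l = zariski_number x y"
    and large_char: "p > conductor \<Gamma>"
  shows "\<exists>\<beta> :: nat \<Rightarrow> 'a.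
           (x, y) \<sim>\<^sub>A
             (fps_X ^ a,
              case l of
                \<infinity> \<Rightarrow> fps_X ^ b
              | enat k \<Rightarrow> fps_X ^ b + fps_X ^ k
                  + Abs_fps (\<lambda>i. if i > k \<and> i + a \<notin> \<Lambda> then \<beta> i else 0))"
proof -
  have prim: "fps_nth x 0 = 0" "fps_nth y 0 = 0" "finite_codim (branch_ring x y)"
    using primitive unfolding primitive_parameterization_def by auto
  have a0: "0 < a"
  proof (rule ccontr)
    assume "\<not> 0 < a"
    then show False using prim(1) x by simp
  qed
  have a1: "a \<noteq> 1" using ab by auto
  have my: "monic_order b y" unfolding monic_order_iff y by auto
  interpret plane_curve a b y by unfold_locales (use a0 ab my in auto)
  define c where "c = conductor \<Gamma>"
  have "finite (- \<Gamma>)"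
    unfolding Gamma semigroup_of_def
    by (rule cofinite_value_set[OF prim(3)]) (auto intro: branch_ring_0 branch_ring_add branch_ring_scale)
  then have vals: "n \<in> \<Gamma>" if "c \<le> n" for n using conductor_of_cofinite that unfolding c_def by blast
  have R: "branch_ring (fps_X ^ a) y = C"
    by (rule branch_ring_eq_closed_alg[OF a0 prim(2), of c])
      (use vals in \<open>simp add: Gamma semigroup_of_def x\<close>)
  have G: "\<Gamma> = value_set C" unfolding Gamma semigroup_of_def x R ..
  have cond: "h \<in> C" if "fps_X ^ c dvd h" for h
    using branch_ring_conductor[OF a0 prim(2) _ that] vals unfolding R G by blast
  define V where "V = value_set (module_diffs (fps_X ^ a) y)"
  have L: "\<Lambda> = Suc ` V \<union> {0}"
    unfolding Lambda semimodule_of_def V_def differentials_def module_diffs_def x R ..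
  have Lk: "k + a \<in> \<Lambda> \<longleftrightarrow> k + a - 1 \<in> V" for k
  proof -
    obtain a' where "a = Suc a'" using a0 gr0_conv_Suc by blast
    then show ?thesis unfolding L by auto
  qed
  have "in_monoid a b 0" unfolding in_monoid_def by auto
  then have zero: "0 \<in> \<Gamma>" using monoid_values G by blast
  have zar: "l = (if \<Lambda> - \<Gamma> = {} then \<infinity> else enat ((LEAST s. s \<in> \<Lambda> - \<Gamma>) - a))"
    unfolding zariski zariski_number_def Let_def Lambda[symmetric] Gamma[symmetric] using multiplicity G by simp
  have "\<exists>u. curve_equiv a y u \<and> monic_order b u \<and>
     (case l of \<infinity> \<Rightarrow> u = fps_X ^ b
      | enat q \<Rightarrow> b < q \<and> (\<exists>e \<beta>. e \<noteq> 0 \<and> u = fps_X ^ b + fps_const e * fps_X ^ q +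
           Abs_fps (\<lambda>i. if q < i \<and> i + a - 1 \<notin> V then \<beta> i else 0)))"
  proof (cases "a = 2")
    case True
    \<comment> \<open>Here \<open>b\<close> may be zero in \<open>K\<close>, so this case avoids the elimination; the conductor is at most \<open>b - 1\<close>.\<close>
    then have "odd b" using ab by simp
    have big: "n \<in> \<Gamma>" if "b - 1 \<le> n" for n
      using monoid_2_odd[OF \<open>odd b\<close>, of "n - (b - 1)"] monoid_values that True G by auto
    have "c \<le> b - 1"
      unfolding c_def conductor_def by (rule Least_le) (use big in auto)
    then have "fps_X ^ c dvd (fps_X ^ b - y)"
      using z_dvd power_le_dvd[OF z_dvd, of c] unfolding z_def by (metis X_power_dvd_diff_sym diff_le_self le_SucI order_trans)
    then have "y + (fps_X ^ b - y) \<in> C" by (intro closed_alg_add closed_alg_generators cond)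
    then have "closed_alg (fps_X ^ a) (fps_X ^ b) = C"
      by (intro closed_alg_perturb[OF ab monic_order_X_power my])
        (simp_all add: closed_alg_generators X_power_dvd_diff_sym[OF my[unfolded monic_order_def]] del: power_Suc)
    then have "curve_equiv a y (fps_X ^ b)"
      unfolding curve_equiv_def by (intro exI[of _ fps_X]) (simp add: monic_order_iff)
    moreover have "\<Lambda> - \<Gamma> = {}"
    proof -
      have "s \<in> \<Gamma>" if s: "s \<in> \<Lambda>" for s
      proof (cases "s = 0 \<or> b - 1 \<le> s")
        case False
        then obtain n where n: "s = Suc n" "n \<in> V" "Suc n < b" using s unfolding L by auto
        then show ?thesis using small_diff_values[of n] unfolding V_def G by simp
      qed (use zero big in auto)
      then show ?thesis by blast
    qed
    ultimately show ?thesis using zar monic_order_X_power by (intro exI[of _ "fps_X ^ b"]) simp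
  next
    case False
    then have "3 \<le> a" using a0 a1 by linarith
    then have bc: "b + 2 \<le> c" by (rule conductor_bound) (use vals G in blast)
    have nonzero: "of_nat n \<noteq> (0::'a)" if "0 < n" "n < c" for n
      using that large_char char of_nat_eq_0_iff_char_dvd[of n, where 'a = 'a] unfolding c_def
      by (auto dest: dvd_imp_le)
    interpret plane_branch a b y c l \<Gamma> V
    proof unfold_locales
      show "b < c" using bc by simp
      show "k + a \<in> \<Gamma>" if k: "b < k" "enat k < l" "k + a - 1 \<in> V" for k
      proof (rule ccontr)
        assume "k + a \<notin> \<Gamma>"
        then have m: "k + a \<in> \<Lambda> - \<Gamma>" using k(3) Lk by simp
        then have "l = enat ((LEAST s. s \<in> \<Lambda> - \<Gamma>) - a)" using zar by auto
        moreover have "(LEAST s. s \<in> \<Lambda> - \<Gamma>) \<le> k + a" using m by (rule Least_le)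
        ultimately show False using k(2) by simp
      qed
      show "b < q \<and> q + a - 1 \<in> V \<and> q + a \<notin> \<Gamma>" if q: "l = enat q" for q
      proof -
        define s where "s = (LEAST s. s \<in> \<Lambda> - \<Gamma>)"
        have ne: "\<Lambda> - \<Gamma> \<noteq> {}" and qs: "q = s - a" using q zar unfolding s_def by (auto split: if_splits)
        from ne have "\<exists>s. s \<in> \<Lambda> - \<Gamma>" by blast
        then have s: "s \<in> \<Lambda> - \<Gamma>" unfolding s_def by (rule LeastI_ex)
        then obtain n where n: "s = Suc n" "n \<in> V" using zero unfolding L by auto
        have "\<not> Suc n \<le> a + b"
          using small_diff_values[of n] nonzero[of b] bc ab s n unfolding V_def G by auto
        then show ?thesis using qs n s by auto
      qed
    qed (use nonzero cond G V_def in auto)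
    obtain u where u: "curve_equiv a y u" and uf: "case l of \<infinity> \<Rightarrow> u = fps_X ^ b
      | enat q \<Rightarrow> \<exists>e \<beta>. e \<noteq> 0 \<and> u = fps_X ^ b + fps_const e * fps_X ^ q +
           Abs_fps (\<lambda>i. if q < i \<and> i + a - 1 \<notin> V then \<beta> i else 0)"
      using normal_form by blast
    show ?thesis
    proof (cases l)
      case infinity
      then show ?thesis using u uf monic_order_X_power by (intro exI[of _ u]) auto
    next
      case (enat q)
      then have "b < q" using at_l by blast
      moreover from this have "monic_order b u" using uf enat by (auto simp: monic_order_iff)
      ultimately show ?thesis using u uf enat by (intro exI[of _ u]) auto
    qed
  qed
  then obtain u where u: "curve_equiv a y u" "monic_order b u"
    and uf: "case l of \<infinity> \<Rightarrow> u = fps_X ^ b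
      | enat q \<Rightarrow> b < q \<and> (\<exists>e \<beta>. e \<noteq> 0 \<and> u = fps_X ^ b + fps_const e * fps_X ^ q +
           Abs_fps (\<lambda>i. if q < i \<and> i + a - 1 \<notin> V then \<beta> i else 0))" by blast
  have equiv: "(x, y) \<sim>\<^sub>A (fps_X ^ a, fps_const (inverse (s ^ b)) * (u oo (fps_const s * fps_X)))"
    if "s \<noteq> 0" for s
    unfolding x by (rule A_equivalent_curve_equiv[OF ab my u(2,1) R that])
  show ?thesis
  proof (cases l)
    case infinity
    then show ?thesis using equiv[of 1] uf by simp
  next
    case (enat q)
    then obtain e \<beta> where q: "b < q" and e: "e \<noteq> 0" and ueq: "u = fps_X ^ b + fps_const e * fps_X ^ q +
           Abs_fps (\<lambda>i. if q < i \<and> i + a - 1 \<notin> V then \<beta> i else 0)" using uf by auto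
    \<comment> \<open>The scaling \<open>t \<mapsto> s t\<close> together with division of \<open>y\<close> by \<open>s\<^sup>b\<close> multiplies the coefficient at \<open>t\<^sup>q\<close> by \<open>s\<^sup>q\<^sup>-\<^sup>b\<close>.\<close>
    obtain s where s: "s ^ (q - b) = inverse e" using nth_root_exists[of "q - b"] q by auto
    have s0: "s \<noteq> 0" using s e q by (intro notI) (simp add: power_0_left)
    have "s ^ q = s ^ b * inverse e"
      using q by (simp flip: s power_add)
    then have sq: "inverse (s ^ b) * (s ^ q * e) = 1" using s0 e by (simp add: field_simps)
    have "fps_const (inverse (s ^ b)) * (u oo (fps_const s * fps_X)) =
        fps_X ^ b + fps_X ^ q + Abs_fps (\<lambda>i. if q < i \<and> i + a \<notin> \<Lambda> then inverse (s ^ b) * (s ^ i * \<beta> i) else 0)"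
    proof (rule fps_ext)
      fix i
      consider "i < b" | "i = b" | "b < i" "i < q" | "i = q" | "q < i" by linarith
      then show "fps_nth (fps_const (inverse (s ^ b)) * (u oo (fps_const s * fps_X))) i =
        fps_nth (fps_X ^ b + fps_X ^ q + Abs_fps (\<lambda>i. if q < i \<and> i + a \<notin> \<Lambda> then inverse (s ^ b) * (s ^ i * \<beta> i) else 0)) i"
        using q s0 e sq Lk[of i] by cases (auto simp: ueq)
    qed
    then show ?thesis using equiv[OF s0] enat by (intro exI[of _ "\<lambda>i. inverse (s ^ b) * (s ^ i * \<beta> i)"]) simp
  qed
qed

end
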